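(* For every quantum while-program $S$, state $\rho\in\mathcal D(\mathcal H)$ and predicate $P\in\mathcal P(\mathcal H)$: $CER_P=\hat{\mathrm{tr}}(qcwp[\![S]\!](P,I)\cdot\rho)$ and $CLER_P=\hat{\mathrm{tr}}(qcwlp[\![S]\!](P,I)\cdot\rho)$, where $CER_P=ER_P/\Pr^{\mathfrak R_\rho[\![S]\!]}(\neg\lozenge\langle\mathsf{viol}\rangle)$ and $CLER_P=LER_P/\Pr^{\mathfrak R_\rho[\![S]\!]}(\neg\lozenge\langle\mathsf{viol}\rangle)$ (undefined if the denominator is $0$), with $ER_P=\sum_{\rho'\in\mathcal D(\mathcal H)}\Pr^{\mathfrak R_\rho[\![S]\!]}(\lozenge\langle\downarrow,\rho'\rangle)\,\mathrm{tr}(P\rho')$ and $LER_P=ER_P+\Pr^{\mathfrak R_\rho[\![S]\!]}(\neg\lozenge\langle\mathsf{sink}\rangle)$; in particular each side is defined iff the other is.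
   Context: Let $\mathcal{H}_2=\ell^2(\{0,1\})$ and $\mathcal{H}_\infty=\ell^2(\mathbb{Z})$ with computational bases. There is a finite set of quantum variables of type $\mathit{Bool}$ (space $\mathcal H_2$) or $\mathit{Int}$ (space $\mathcal H_\infty$); registers $\bar q$ have space $\bigotimes_i\mathcal H_{q_i}$; $\mathcal H$ is the tensor product of all variables' spaces; operators on sub-registers are extended by the identity; $|\phi\rangle\langle\psi|_q$ denotes $|\phi\rangle\langle\psi|$ acting on variable $q$. $\mathcal D^-(\mathcal H)$: positive trace-class operators with trace $\le1$; $\mathcal D(\mathcal H)$: those of trace $1$. $A\sqsubseteq B$ iff $B-A$ positive; predicates $\mathcal P(\mathcal H)=\{P:0\sqsubseteq P\sqsubseteq I\}$. A measurement is a family $\{M_m\}_{m\in I}$ with $\sum_m M_m^\dagger M_m=I$. Programs: $S::=\mathbf{skip}\mid q:=0\mid \bar q:=U\bar q\mid \mathbf{observe}(\bar q,O)\mid S_1;S_2\mid \mathbf{measure}\ M[\bar q]:\bar S\mid \mathbf{while}\ M[\bar q]=1\ \mathbf{do}\ S$ ($U$ unitary, $O$ an orthogonal projection on $\mathcal H_{\bar q}$, $M=\{M_m\}$ a measurement with programs $\bar S=\{S_m\}$; $M=\{M_0,M_1\}$ in loops; $\mathbf{if}$ abbreviates a two-outcome $\mathbf{measure}$). Denotational semantics on $\mathcal{DR}=\{(\rho,p)\in\mathcal D^-(\mathcal H)\times\mathbb R_{\ge0}:\mathrm{tr}\rho+p\le1\}$ (componentwise operations and least upper bounds): $[\![\mathbf{skip}]\!](\rho,p)=(\rho,p)$;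 $[\![q:=0]\!](\rho,p)=(|0\rangle\langle0|_q\rho|0\rangle\langle0|_q+|0\rangle\langle1|_q\rho|1\rangle\langle0|_q,p)$ (Bool) resp. $(\sum_{n\in\mathbb Z}|0\rangle\langle n|_q\rho|n\rangle\langle0|_q,p)$ (Int); $[\![\bar q:=U\bar q]\!](\rho,p)=(U\rho U^\dagger,p)$; $[\![\mathbf{observe}(\bar q,O)]\!](\rho,p)=(O\rho O^\dagger,p+\mathrm{tr}\rho-\mathrm{tr}(O\rho O^\dagger))$; $[\![S_1;S_2]\!]=[\![S_2]\!]\circ[\![S_1]\!]$; $[\![\mathbf{measure}\ M[\bar q]:\bar S]\!](\rho,p)=\sum_m[\![S_m]\!](M_m\rho M_m^\dagger,0)+(0,p)$; $[\![\mathbf{while}\ M[\bar q]=1\ \mathbf{do}\ S]\!](\rho,p)=\bigvee_n[\![W^n]\!](\rho,p)$, $W^0=\Omega$ with $[\![\Omega]\!](\rho,p)=(0,p)$, $W^{n+1}=\mathbf{if}\ M[\bar q]=1\ \mathbf{then}\ (S;W^n)\ \mathbf{else}\ \mathbf{skip}$. $[\![S]\!]_\rho,[\![S]\!]_{\mathrm{err}}$ are the two components. $qwp[\![S]\!](P)$ is the greatest $Q\in\mathcal P(\mathcal H)$ (w.r.t. $\sqsubseteq$) with $\mathrm{tr}(Q\rho)\le\mathrm{tr}(P[\![S]\!]_\rho(\rho,0))$ for all $\rho\in\mathcal D^-(\mathcal H)$; $qwlp[\![S]\!](P)$ is the greatest $Q$ with $\mathrm{tr}(Q\rho)\le\mathrm{tr}(P[\![S]\!]_\rho(\rho,0))+\mathrm{tr}(\rho)-\mathrm{tr}([\![S]\!]_\rho(\rho,0))-[\![S]\!]_{\mathrm{err}}(\rho,0)$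 for all $\rho\in\mathcal D^-(\mathcal H)$ (both exist). $qcwp[\![S]\!](P,Q)=(qwp[\![S]\!](P),qwlp[\![S]\!](Q))$, $qcwlp[\![S]\!](P,Q)=(qwlp[\![S]\!](P),qwlp[\![S]\!](Q))$, $(A,B)\cdot\rho=(A\rho,B\rho)$, and $\hat{\mathrm{tr}}(A\rho,B\rho)=\mathrm{tr}(A\rho)/\mathrm{tr}(B\rho)$ if $\mathrm{tr}(B\rho)\ne0$, undefined otherwise. Operational semantics: configurations are $\langle S,\sigma\rangle$ with $\sigma\in\mathcal D(\mathcal H)$ and $S$ a program or the empty program $\downarrow$ ($\downarrow;S_2\equiv S_2$), plus special states $\langle\mathsf{viol}\rangle$ and $\langle\mathsf{sink}\rangle$. The Markov chain $\mathfrak R_\rho[\![S]\!]$ has initial state $\langle S,\rho\rangle$ and its transition probability function is the smallest satisfying ($c\xrightarrow{p}c'$ means probability $p>0$; others are $0$): $\langle\mathbf{skip},\sigma\rangle\xrightarrow{1}\langle\downarrow,\sigma\rangle$; $\langle q:=0,\sigma\rangle\xrightarrow{1}\langle\downarrow,\sigma'\rangle$ with $\sigma'$ the first component of $[\![q:=0]\!](\sigma,0)$; $\langle\bar q:=U\bar q,\sigma\rangle\xrightarrow{1}\langle\downarrow,U\sigma U^\dagger\rangle$; with $t=\mathrm{tr}(O\sigma O^\dagger)$: if $t>0$, $\langle\mathbf{observe}(\bar q,O),\sigma\rangle\xrightarrow{t}\langle\downarrow,O\sigma O^\dagger/t\rangle$, and if $t<1$, $\langle\mathbf{observe}(\bar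 q,O),\sigma\rangle\xrightarrow{1-t}\langle\mathsf{viol}\rangle$; for each $m$ with $t_m=\mathrm{tr}(M_m\sigma M_m^\dagger)>0$, $\langle\mathbf{measure}\ M[\bar q]:\bar S,\sigma\rangle\xrightarrow{t_m}\langle S_m,M_m\sigma M_m^\dagger/t_m\rangle$; if $\langle S_1,\sigma\rangle\xrightarrow{p}\langle\mathsf{viol}\rangle$ then $\langle S_1;S_2,\sigma\rangle\xrightarrow{p}\langle\mathsf{viol}\rangle$; if $\langle S_1,\sigma\rangle\xrightarrow{p}\langle S_1',\sigma'\rangle$ then $\langle S_1;S_2,\sigma\rangle\xrightarrow{p}\langle S_1';S_2,\sigma'\rangle$; for $W=\mathbf{while}\ M[\bar q]=1\ \mathbf{do}\ S$ and $t_i=\mathrm{tr}(M_i\sigma M_i^\dagger)$: if $t_0>0$, $\langle W,\sigma\rangle\xrightarrow{t_0}\langle\downarrow,M_0\sigma M_0^\dagger/t_0\rangle$; if $t_1>0$, $\langle W,\sigma\rangle\xrightarrow{t_1}\langle S;W,M_1\sigma M_1^\dagger/t_1\rangle$; and $\langle\mathsf{viol}\rangle\xrightarrow{1}\langle\mathsf{sink}\rangle$, $\langle\downarrow,\sigma\rangle\xrightarrow{1}\langle\mathsf{sink}\rangle$, $\langle\mathsf{sink}\rangle\xrightarrow{1}\langle\mathsf{sink}\rangle$. $\Pr(\lozenge T)$ is the probability of eventually reaching $T$ and $\Pr(\neg\lozenge T)=1-\Pr(\lozenge T)$. ($ER_P$, $LER_P$ are the (liberal) expected rewards of reaching $\langle\mathsf{sink}\rangle$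 for the reward $r(\langle\downarrow,\rho'\rangle)=\mathrm{tr}(P\rho')$, $0$ elsewhere, and $CER_P$, $CLER_P$ their conditional versions given that $\langle\mathsf{viol}\rangle$ is never visited.) *)

theory Defs
  imports "HOL-Probability.Probability" "HOL-Library.Nonpos_Ints"
begin
typedef 'a ell2 = "{f :: 'a \<Rightarrow> complex. (\<lambda>x. (cmod (f x))\<^sup>2) summable_on UNIV}"
  morphisms coord Abs_ell2
  by (rule exI[of _ "\<lambda>_. 0"]) simp

setup_lifting type_definition_ell2

lemma ell2_prod_abs_summable:
  assumes "(\<lambda>x. (cmod (f x))\<^sup>2) summable_on UNIV" "(\<lambda>x. (cmod (g x))\<^sup>2) summable_on UNIV"
  shows "(\<lambda>x. norm (cnj (f x) * g x)) summable_on UNIV"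
proof -
  have "(\<lambda>x. (cmod (f x))\<^sup>2 + (cmod (g x))\<^sup>2) summable_on UNIV"
    using assms by (rule summable_on_add)
  then show ?thesis
  proof (rule Infinite_Sum.abs_summable_on_comparison_test')
    fix x
    have "2 * (cmod (f x) * cmod (g x)) \<le> (cmod (f x))\<^sup>2 + (cmod (g x))\<^sup>2"
      using sum_squares_bound[of "cmod (f x)" "cmod (g x)"] by simp
    moreover have "0 \<le> cmod (f x) * cmod (g x)"
      by simp
    ultimately show "cmod (cnj (f x) * g x) \<le> (cmod (f x))\<^sup>2 + (cmod (g x))\<^sup>2"
      unfolding norm_mult complex_mod_cnj by linarith
  qed
qed

lemma ell2_add_summable:
  assumes "(\<lambda>x. (cmod (f x))\<^sup>2) summable_on UNIV" "(\<lambda>x. (cmod (g x))\<^sup>2) summable_on UNIV"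
  shows "(\<lambda>x. (cmod (f x + g x))\<^sup>2) summable_on UNIV"
proof -
  have "(\<lambda>x. 2 * ((cmod (f x))\<^sup>2 + (cmod (g x))\<^sup>2)) summable_on UNIV"
    using assms by (intro summable_on_cmult_right summable_on_add)
  then show ?thesis
  proof (rule summable_on_comparison_test)
    fix x
    have "(cmod (f x + g x))\<^sup>2 \<le> (cmod (f x) + cmod (g x))\<^sup>2"
      by (intro power_mono norm_triangle_ineq) simp
    also have "\<dots> \<le> 2 * ((cmod (f x))\<^sup>2 + (cmod (g x))\<^sup>2)"
      using sum_squares_bound[of "cmod (f x)" "cmod (g x)"]
      by (simp add: power2_eq_square algebra_simps)
    finally show "(cmod (f x + g x))\<^sup>2 \<le> 2 * ((cmod (f x))\<^sup>2 + (cmod (g x))\<^sup>2)" .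
  qed simp
qed

lemma ell2_scale_summable:
  assumes "(\<lambda>x. (cmod (f x))\<^sup>2) summable_on UNIV"
  shows "(\<lambda>x. (cmod (c * f x))\<^sup>2) summable_on UNIV"
  unfolding norm_mult power_mult_distrib using assms by (rule summable_on_cmult_right)

lift_definition scaleC :: "complex \<Rightarrow> 'a ell2 \<Rightarrow> 'a ell2" (infixr \<open>*\<^sub>C\<close> 75)
  is "\<lambda>c f x. c * f x"
  by (rule ell2_scale_summable)

text \<open>Inner products are conjugate-linear in the first argument.\<close>

lift_definition cinner :: "'a ell2 \<Rightarrow> 'a ell2 \<Rightarrow> complex"
  is "\<lambda>f g. \<Sum>\<^sub>\<infinity>x. cnj (f x) * g x" .

lift_definition ket :: "'a \<Rightarrow> 'a ell2" is "\<lambda>x y. if y = x then 1 else 0"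
proof -
  fix x :: 'a
  have "(\<lambda>y. (cmod (if y = x then 1 else 0))\<^sup>2) summable_on {x}"
    by (rule summable_on_finite) simp
  then show "(\<lambda>y. (cmod (if y = x then 1 else 0))\<^sup>2) summable_on UNIV"
    by (rule summable_on_cong_neutral[THEN iffD1, rotated -1]) auto
qed

instantiation ell2 :: (type) real_inner
begin

lift_definition zero_ell2 :: "'a ell2" is "\<lambda>_. 0" by simp

lift_definition plus_ell2 :: "'a ell2 \<Rightarrow> 'a ell2 \<Rightarrow> 'a ell2" is "\<lambda>f g x. f x + g x"
  by (rule ell2_add_summable)

lift_definition uminus_ell2 :: "'a ell2 \<Rightarrow> 'a ell2" is "\<lambda>f x. - f x" by simp

lift_definition minus_ell2 :: "'a ell2 \<Rightarrow> 'a ell2 \<Rightarrow> 'a ell2" is "\<lambda>f g x. f x - g x"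
proof -
  fix f g :: "'a \<Rightarrow> complex"
  assume "(\<lambda>x. (cmod (f x))\<^sup>2) summable_on UNIV" "(\<lambda>x. (cmod (g x))\<^sup>2) summable_on UNIV"
  then show "(\<lambda>x. (cmod (f x - g x))\<^sup>2) summable_on UNIV"
    using ell2_add_summable[of f "\<lambda>x. - g x"] by simp
qed

lift_definition scaleR_ell2 :: "real \<Rightarrow> 'a ell2 \<Rightarrow> 'a ell2" is "\<lambda>r f x. complex_of_real r * f x"
  by (rule ell2_scale_summable)

definition inner_ell2 :: "'a ell2 \<Rightarrow> 'a ell2 \<Rightarrow> real" where
  "inner_ell2 \<phi> \<psi> = Re (cinner \<phi> \<psi>)"

definition norm_ell2 :: "'a ell2 \<Rightarrow> real" where
  "norm_ell2 \<psi> = sqrt (inner \<psi> \<psi>)"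

definition dist_ell2 :: "'a ell2 \<Rightarrow> 'a ell2 \<Rightarrow> real" where
  "dist_ell2 \<phi> \<psi> = norm (\<phi> - \<psi>)"

definition sgn_ell2 :: "'a ell2 \<Rightarrow> 'a ell2" where
  "sgn_ell2 \<psi> = inverse (norm \<psi>) *\<^sub>R \<psi>"

definition uniformity_ell2 :: "('a ell2 \<times> 'a ell2) filter" where
  "uniformity_ell2 = (INF e\<in>{0<..}. principal {(\<phi>, \<psi>). dist \<phi> \<psi> < e})"

definition open_ell2 :: "'a ell2 set \<Rightarrow> bool" where
  "open_ell2 U \<longleftrightarrow> (\<forall>\<phi>\<in>U. eventually (\<lambda>(\<phi>', \<psi>). \<phi>' = \<phi> \<longrightarrow> \<psi> \<in> U) uniformity)"

lemma inner_ell2_sums: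
  fixes \<phi> \<psi> :: "'a ell2"
  shows "((\<lambda>x. Re (cnj (coord \<phi> x) * coord \<psi> x)) has_sum inner \<phi> \<psi>) UNIV"
proof -
  have "(\<lambda>x. cnj (coord \<phi> x) * coord \<psi> x) summable_on UNIV"
    using coord[of \<phi>] coord[of \<psi>]
    by (auto intro: Infinite_Sum.abs_summable_summable[OF ell2_prod_abs_summable])
  then show ?thesis
    unfolding inner_ell2_def cinner.rep_eq by (intro has_sum_Re has_sum_infsum)
qed

instance
proof
  fix x y z :: "'a ell2" and a b r :: real
  show "x + y + z = x + (y + z)" "x + y = y + x" "0 + x = x" "- x + x = 0" "x - y = x + - y"
    by (transfer; simp add: fun_eq_iff algebra_simps)+
  show "a *\<^sub>R (x + y) = a *\<^sub>R x + a *\<^sub>R y" "(a + b) *\<^sub>R x = a *\<^sub>R x + b *\<^sub>R x"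
    "a *\<^sub>R b *\<^sub>R x = (a * b) *\<^sub>R x" "1 *\<^sub>R x = x"
    by (transfer; simp add: fun_eq_iff algebra_simps)+
  show "sgn x = inverse (norm x) *\<^sub>R x" by (rule sgn_ell2_def)
  show "dist x y = norm (x - y)" by (rule dist_ell2_def)
  show "(uniformity :: ('a ell2 \<times> 'a ell2) filter) =
      (INF e\<in>{0<..}. principal {(x, y). dist x y < e})"
    by (rule uniformity_ell2_def)
  show "open U = (\<forall>x\<in>U. eventually (\<lambda>(x', y). x' = x \<longrightarrow> y \<in> U) uniformity)"
    for U :: "'a ell2 set"
    by (rule open_ell2_def)
  show "norm x = sqrt (inner x x)" by (rule norm_ell2_def)
  show "inner x y = inner y x"
    using inner_ell2_sums[of x y] inner_ell2_sums[of y x]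
    by (simp add: mult.commute infsumI[symmetric] has_sum_unique)
  have "((\<lambda>w. Re (cnj (coord x w) * coord z w) + Re (cnj (coord y w) * coord z w))
      has_sum (inner x z + inner y z)) UNIV"
    by (intro has_sum_add inner_ell2_sums)
  then show "inner (x + y) z = inner x z + inner y z"
    using inner_ell2_sums[of "x + y" z]
    by (simp add: plus_ell2.rep_eq algebra_simps has_sum_unique)
  have "((\<lambda>w. r * Re (cnj (coord x w) * coord y w)) has_sum (r * inner x y)) UNIV"
    by (intro has_sum_cmult_right inner_ell2_sums)
  then show "inner (r *\<^sub>R x) y = r * inner x y"
    using inner_ell2_sums[of "r *\<^sub>R x" y]
    by (simp add: scaleR_ell2.rep_eq algebra_simps has_sum_unique)
  have sq: "Re (cnj c * c) = (cmod c)\<^sup>2" for c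
    using cmod_power2[of c] by (simp add: power2_eq_square)
  have xx: "((\<lambda>w. (cmod (coord x w))\<^sup>2) has_sum inner x x) UNIV"
    using inner_ell2_sums[of x x] unfolding sq .
  then show "0 \<le> inner x x"
    by (rule has_sum_nonneg) simp
  show "inner x x = 0 \<longleftrightarrow> x = 0"
  proof
    assume "inner x x = 0"
    with xx have "((\<lambda>w. (cmod (coord x w))\<^sup>2) has_sum 0) UNIV" by simp
    then have "(cmod (coord x w))\<^sup>2 = 0" for w
      by (rule nonneg_has_sum_le_0D[where A = UNIV]) simp_all
    then show "x = 0"
      by transfer (simp add: fun_eq_iff)
  next
    assume "x = 0"
    then show "inner x x = 0"
      by (simp add: inner_ell2_def cinner.rep_eq zero_ell2.rep_eq)
  qed
qed

end

lemma norm_ell2_square: "((\<lambda>x. (cmod (coord \<psi> x))\<^sup>2) has_sum (norm \<psi>)\<^sup>2) UNIV"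
proof -
  have sq: "Re (cnj c * c) = (cmod c)\<^sup>2" for c
    using cmod_power2[of c] by (simp add: power2_eq_square)
  show ?thesis
    using inner_ell2_sums[of \<psi> \<psi>] unfolding sq power2_norm_eq_inner .
qed

type_synonym 'a op = "'a ell2 \<Rightarrow>\<^sub>L 'a ell2"

text \<open>
  The space \<open>\<ell>\<^sup>2(B)\<close> of a set \<open>B\<close> is the closed subspace of \<^typ>\<open>'a ell2\<close> of all vectors vanishing
  outside \<open>B\<close>.  A bounded operator on \<open>\<ell>\<^sup>2(B)\<close> is represented by its extension by \<open>0\<close> to the
  orthogonal complement, so \<open>idop B\<close> is the identity of \<open>\<ell>\<^sup>2(B)\<close>.
\<close>

lift_definition restr :: "'a set \<Rightarrow> 'a ell2 \<Rightarrow> 'a ell2" is "\<lambda>B f x. if x \<in> B then f x else 0"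
proof -
  fix B and f :: "'a \<Rightarrow> complex"
  assume "(\<lambda>x. (cmod (f x))\<^sup>2) summable_on UNIV"
  then show "(\<lambda>x. (cmod (if x \<in> B then f x else 0))\<^sup>2) summable_on UNIV"
    by (rule summable_on_comparison_test) auto
qed

lift_definition idop :: "'a set \<Rightarrow> 'a op" is restr
proof (rule bounded_linear_intro[where K = 1])
  fix B :: "'a set" and \<phi> \<psi> :: "'a ell2" and r
  show "restr B (\<phi> + \<psi>) = restr B \<phi> + restr B \<psi>" "restr B (r *\<^sub>R \<psi>) = r *\<^sub>R restr B \<psi>"
    by (transfer; auto)+
  have "(norm (restr B \<psi>))\<^sup>2 \<le> (norm \<psi>)\<^sup>2"
    by (rule has_sum_mono[OF norm_ell2_square norm_ell2_square]) (simp add: restr.rep_eq)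
  then show "norm (restr B \<psi>) \<le> norm \<psi> * 1"
    by (simp add: power2_le_iff_abs_le)
qed

lemma coord_ket: "coord (ket x) y = (if y = x then 1 else 0)"
  by (rule ket.rep_eq[THEN fun_cong])

lemma cinner_ket: "cinner (ket y) \<psi> = coord \<psi> y"
proof -
  have "(\<Sum>\<^sub>\<infinity>x. cnj (coord (ket y) x) * coord \<psi> x) = (\<Sum>\<^sub>\<infinity>x\<in>{y}. coord \<psi> x)"
    by (rule infsum_cong_neutral) (auto simp: coord_ket)
  then show ?thesis
    by (simp add: cinner.rep_eq)
qed

lift_definition ketbra :: "'a \<Rightarrow> 'a \<Rightarrow> 'a op" is "\<lambda>x y \<psi>. cinner (ket y) \<psi> *\<^sub>C ket x"
proof (rule bounded_linear_intro[where K = 1])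
  fix x y :: 'a and \<phi> \<psi> :: "'a ell2" and r
  show "cinner (ket y) (\<phi> + \<psi>) *\<^sub>C ket x = cinner (ket y) \<phi> *\<^sub>C ket x + cinner (ket y) \<psi> *\<^sub>C ket x"
    "cinner (ket y) (r *\<^sub>R \<psi>) *\<^sub>C ket x = r *\<^sub>R (cinner (ket y) \<psi> *\<^sub>C ket x)"
    unfolding cinner_ket by (transfer; simp add: fun_eq_iff algebra_simps)+
  let ?v = "cinner (ket y) \<psi> *\<^sub>C ket x"
  have "((\<lambda>z. (cmod (coord \<psi> y))\<^sup>2) has_sum (cmod (coord \<psi> y))\<^sup>2) {x}"
    using has_sum_finite[of "{x}" "\<lambda>z. (cmod (coord \<psi> y))\<^sup>2"] by simp
  then have "((\<lambda>z. (cmod (coord ?v z))\<^sup>2) has_sum (cmod (coord \<psi> y))\<^sup>2) UNIV"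
    by (rule has_sum_cong_neutral[THEN iffD1, rotated -1])
       (auto simp: scaleC.rep_eq cinner_ket coord_ket)
  then have "(norm ?v)\<^sup>2 = (cmod (coord \<psi> y))\<^sup>2"
    using norm_ell2_square by (rule has_sum_unique[symmetric])
  moreover have "((\<lambda>z. (cmod (coord \<psi> z))\<^sup>2) has_sum (cmod (coord \<psi> y))\<^sup>2) {y}"
    using has_sum_finite[of "{y}" "\<lambda>z. (cmod (coord \<psi> z))\<^sup>2"] by simp
  then have "(cmod (coord \<psi> y))\<^sup>2 \<le> (norm \<psi>)\<^sup>2"
    by (rule has_sum_mono2[OF _ norm_ell2_square]) auto
  ultimately show "norm ?v \<le> norm \<psi> * 1"
    by (simp add: power2_le_iff_abs_le)
qed

definition op_on :: "'a set \<Rightarrow> 'a op \<Rightarrow> bool" where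
  "op_on B A \<longleftrightarrow> (\<forall>c \<psi>. A (c *\<^sub>C \<psi>) = c *\<^sub>C A \<psi>) \<and> idop B o\<^sub>L A o\<^sub>L idop B = A"

definition adj :: "'a op \<Rightarrow> 'a op" (\<open>_\<^sup>\<dagger>\<close> [1000] 999) where
  "A\<^sup>\<dagger> = (THE A' :: 'a op. \<forall>\<phi> \<psi>. cinner (A \<phi>) \<psi> = cinner \<phi> (A' \<psi>))"

definition positive :: "'a op \<Rightarrow> bool" where
  "positive A \<longleftrightarrow> (\<forall>\<psi>. cinner \<psi> (A \<psi>) \<in> \<real>\<^sub>\<ge>\<^sub>0)"

definition loewner :: "'a op \<Rightarrow> 'a op \<Rightarrow> bool" (infix \<open>\<sqsubseteq>\<close> 50) where
  "A \<sqsubseteq> B \<longleftrightarrow> positive (B - A)"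

text \<open>
  All traces below are traces of positive trace-class operators or of products \<open>P\<rho>\<close> of two positive
  operators with \<open>\<rho>\<close> trace-class.  Those are real numbers, so \<open>tr\<close> is taken to be real-valued.
\<close>

definition tr :: "'a op \<Rightarrow> real" where
  "tr A = Re (\<Sum>\<^sub>\<infinity>x. cinner (ket x) (A (ket x)))"

text \<open>
  A positive operator equals its own absolute value, so it is trace-class iff the sum of its
  diagonal entries converges.
\<close>

definition pos_trace_class :: "'a set \<Rightarrow> 'a op set" where
  "pos_trace_class B =
    {\<rho>. op_on B \<rho> \<and> positive \<rho> \<and> (\<lambda>x. cinner (ket x) (\<rho> (ket x))) summable_on UNIV}"

definition partial_states :: "'a set \<Rightarrow> 'a op set" where
  "partial_states B = {\<rho> \<in> pos_trace_class B. tr \<rho> \<le> 1}"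

definition states :: "'a set \<Rightarrow> 'a op set" where
  "states B = {\<rho> \<in> pos_trace_class B. tr \<rho> = 1}"

definition predicates :: "'a set \<Rightarrow> 'a op set" where
  "predicates B = {P. op_on B P \<and> 0 \<sqsubseteq> P \<and> P \<sqsubseteq> idop B}"

definition unitary_on :: "'a set \<Rightarrow> 'a op \<Rightarrow> bool" where
  "unitary_on B U \<longleftrightarrow> op_on B U \<and> U\<^sup>\<dagger> o\<^sub>L U = idop B \<and> U o\<^sub>L U\<^sup>\<dagger> = idop B"

definition projection_on :: "'a set \<Rightarrow> 'a op \<Rightarrow> bool" where
  "projection_on B R \<longleftrightarrow> op_on B R \<and> R o\<^sub>L R = R \<and> R\<^sup>\<dagger> = R"

text \<open>For infinitely many outcomes, the completeness relation is a sum in the strong operator topology.\<close>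

definition measurement_on :: "'a set \<Rightarrow> 'm set \<Rightarrow> ('m \<Rightarrow> 'a op) \<Rightarrow> bool" where
  "measurement_on B I M \<longleftrightarrow> (\<forall>m\<in>I. op_on B (M m)) \<and>
    (\<forall>\<psi>. ((\<lambda>m. ((M m)\<^sup>\<dagger> o\<^sub>L M m) \<psi>) has_sum idop B \<psi>) I)"

definition conj_op :: "'a op \<Rightarrow> 'a op \<Rightarrow> 'a op" where
  "conj_op A \<rho> = A o\<^sub>L \<rho> o\<^sub>L A\<^sup>\<dagger>"

datatype qtype = QBool | QInt

fun vals :: "qtype \<Rightarrow> int set" where
  "vals QBool = {0, 1}"
| "vals QInt = UNIV"

text \<open>
  A partial map \<open>\<Gamma>\<close> with finite domain is the set of quantum variables together with their types.
  Finite tensor products \<open>\<Otimes>\<^sub>i \<ell>\<^sup>2(X\<^sub>i)\<close> are identified with \<open>\<ell>\<^sup>2(\<Prod>\<^sub>i X\<^sub>i)\<close>: the global space is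
  \<open>\<ell>\<^sup>2(basis \<Gamma>)\<close> and the space of a register \<open>qs\<close> (a list of distinct variables) is
  \<open>\<ell>\<^sup>2(reg_basis \<Gamma> qs)\<close>.
\<close>

type_synonym 'v qctx = "'v \<Rightarrow> qtype option"

definition basis :: "'v qctx \<Rightarrow> ('v \<Rightarrow> int) set" where
  "basis \<Gamma> = (\<Pi>\<^sub>E q\<in>dom \<Gamma>. vals (the (\<Gamma> q)))"

definition reg_basis :: "'v qctx \<Rightarrow> 'v list \<Rightarrow> int list set" where
  "reg_basis \<Gamma> qs = {xs. list_all2 (\<lambda>q x. x \<in> vals (the (\<Gamma> q))) qs xs}"

definition register :: "'v qctx \<Rightarrow> 'v list \<Rightarrow> bool" where
  "register \<Gamma> qs \<longleftrightarrow> distinct qs \<and> set qs \<subseteq> dom \<Gamma>"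

text \<open>The extension \<open>A \<otimes> I\<close> of a register operator to the global space, given by its matrix elements.\<close>

definition extend_op :: "'v qctx \<Rightarrow> 'v list \<Rightarrow> int list op \<Rightarrow> ('v \<Rightarrow> int) op" where
  "extend_op \<Gamma> qs A = (THE T :: ('v \<Rightarrow> int) op. op_on (basis \<Gamma>) T \<and>
    (\<forall>f\<in>basis \<Gamma>. \<forall>g\<in>basis \<Gamma>. cinner (ket f) (T (ket g)) =
      (if \<forall>q\<in>dom \<Gamma> - set qs. f q = g q
       then cinner (ket (map f qs)) (A (ket (map g qs))) else 0)))"

datatype ('v, 'm) prog =
    Skip
  | Init 'v
  | Unitary "'v list" "int list op"
  | Observe "'v list" "int list op"
  | Seq "('v, 'm) prog" "('v, 'm) prog"
  | Measure "'v list" "'m set" "'m \<Rightarrow> int list op" "'m \<Rightarrow> ('v, 'm) prog"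
  | While "'v list" "int list op" "int list op" "('v, 'm) prog"
    \<comment> \<open>the loop measurement is \<open>{M\<^sub>0, M\<^sub>1}\<close>, in this order\<close>

primrec wf_prog :: "'v qctx \<Rightarrow> ('v, 'm) prog \<Rightarrow> bool" where
  "wf_prog \<Gamma> Skip \<longleftrightarrow> True"
| "wf_prog \<Gamma> (Init q) \<longleftrightarrow> q \<in> dom \<Gamma>"
| "wf_prog \<Gamma> (Unitary qs U) \<longleftrightarrow> register \<Gamma> qs \<and> unitary_on (reg_basis \<Gamma> qs) U"
| "wf_prog \<Gamma> (Observe qs R) \<longleftrightarrow> register \<Gamma> qs \<and> projection_on (reg_basis \<Gamma> qs) R"
| "wf_prog \<Gamma> (Seq S1 S2) \<longleftrightarrow> wf_prog \<Gamma> S1 \<and> wf_prog \<Gamma> S2"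
| "wf_prog \<Gamma> (Measure qs I M Ss) \<longleftrightarrow> register \<Gamma> qs \<and> measurement_on (reg_basis \<Gamma> qs) I M \<and>
    (\<forall>m\<in>I. wf_prog \<Gamma> (Ss m))"
| "wf_prog \<Gamma> (While qs M0 M1 S) \<longleftrightarrow> register \<Gamma> qs \<and>
    measurement_on (reg_basis \<Gamma> qs) UNIV (\<lambda>b. if b then M1 else M0) \<and> wf_prog \<Gamma> S"

type_synonym 'v dstate = "('v \<Rightarrow> int) op \<times> real"

definition DR :: "'v qctx \<Rightarrow> 'v dstate set" where
  "DR \<Gamma> = {(\<rho>, p). \<rho> \<in> partial_states (basis \<Gamma>) \<and> 0 \<le> p \<and> tr \<rho> + p \<le> 1}"

definition dr_le :: "'v dstate \<Rightarrow> 'v dstate \<Rightarrow> bool" where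
  "dr_le d d' \<longleftrightarrow> fst d \<sqsubseteq> fst d' \<and> snd d \<le> snd d'"

definition dr_lub :: "'v qctx \<Rightarrow> (nat \<Rightarrow> 'v dstate) \<Rightarrow> 'v dstate" where
  "dr_lub \<Gamma> X = (THE d. d \<in> DR \<Gamma> \<and> (\<forall>n. dr_le (X n) d) \<and>
    (\<forall>d'\<in>DR \<Gamma>. (\<forall>n. dr_le (X n) d') \<longrightarrow> dr_le d d'))"

text \<open>The sum is \<open>\<Sum>\<^sub>n |0\<rangle>\<langle>n|\<^sub>q \<rho> |n\<rangle>\<langle>0|\<^sub>q\<close>, with \<open>n\<close> ranging over \<open>{0, 1}\<close> or \<open>\<int>\<close>.\<close>

definition init_op :: "'v qctx \<Rightarrow> 'v \<Rightarrow> ('v \<Rightarrow> int) op \<Rightarrow> ('v \<Rightarrow> int) op" where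
  "init_op \<Gamma> q \<rho> = (\<Sum>\<^sub>\<infinity>n\<in>vals (the (\<Gamma> q)).
    extend_op \<Gamma> [q] (ketbra [0] [n]) o\<^sub>L \<rho> o\<^sub>L extend_op \<Gamma> [q] (ketbra [n] [0]))"

text \<open>Semantics of the syntactic approximations \<open>W\<^sup>n\<close> of a loop whose body denotes \<open>F\<close>.\<close>

primrec loop_approx ::
    "('v \<Rightarrow> int) op \<Rightarrow> ('v \<Rightarrow> int) op \<Rightarrow> ('v dstate \<Rightarrow> 'v dstate) \<Rightarrow> nat \<Rightarrow> 'v dstate \<Rightarrow> 'v dstate" where
  "loop_approx M0 M1 F 0 = (\<lambda>(\<rho>, p). (0, p))"
| "loop_approx M0 M1 F (Suc n) = (\<lambda>(\<rho>, p).
    (conj_op M0 \<rho>, 0) + loop_approx M0 M1 F n (F (conj_op M1 \<rho>, 0)) + (0, p))"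

text \<open>
  The possibly infinite sums in \<open>init_op\<close> and in the measurement case are taken in the operator norm;
  on partial states they converge even in the (finer) trace norm.
\<close>

primrec sem :: "'v qctx \<Rightarrow> ('v, 'm) prog \<Rightarrow> 'v dstate \<Rightarrow> 'v dstate" where
  "sem \<Gamma> Skip = (\<lambda>(\<rho>, p). (\<rho>, p))"
| "sem \<Gamma> (Init q) = (\<lambda>(\<rho>, p). (init_op \<Gamma> q \<rho>, p))"
| "sem \<Gamma> (Unitary qs U) = (\<lambda>(\<rho>, p). (conj_op (extend_op \<Gamma> qs U) \<rho>, p))"
| "sem \<Gamma> (Observe qs R) = (\<lambda>(\<rho>, p).
    (conj_op (extend_op \<Gamma> qs R) \<rho>, p + tr \<rho> - tr (conj_op (extend_op \<Gamma> qs R) \<rho>)))"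
| "sem \<Gamma> (Seq S1 S2) = sem \<Gamma> S2 \<circ> sem \<Gamma> S1"
| "sem \<Gamma> (Measure qs I M Ss) = (\<lambda>(\<rho>, p).
    (\<Sum>\<^sub>\<infinity>m\<in>I. sem \<Gamma> (Ss m) (conj_op (extend_op \<Gamma> qs (M m)) \<rho>, 0)) + (0, p))"
| "sem \<Gamma> (While qs M0 M1 S) = (\<lambda>(\<rho>, p).
    dr_lub \<Gamma> (\<lambda>n. loop_approx (extend_op \<Gamma> qs M0) (extend_op \<Gamma> qs M1) (sem \<Gamma> S) n (\<rho>, p)))"

abbreviation sem_state :: "'v qctx \<Rightarrow> ('v, 'm) prog \<Rightarrow> 'v dstate \<Rightarrow> ('v \<Rightarrow> int) op" where
  "sem_state \<Gamma> S d \<equiv> fst (sem \<Gamma> S d)"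

abbreviation sem_err :: "'v qctx \<Rightarrow> ('v, 'm) prog \<Rightarrow> 'v dstate \<Rightarrow> real" where
  "sem_err \<Gamma> S d \<equiv> snd (sem \<Gamma> S d)"

definition greatest_predicate ::
    "'v qctx \<Rightarrow> (('v \<Rightarrow> int) op \<Rightarrow> bool) \<Rightarrow> ('v \<Rightarrow> int) op" where
  "greatest_predicate \<Gamma> \<Phi> = (THE Q. Q \<in> predicates (basis \<Gamma>) \<and> \<Phi> Q \<and>
    (\<forall>Q'\<in>predicates (basis \<Gamma>). \<Phi> Q' \<longrightarrow> Q' \<sqsubseteq> Q))"

definition qwp :: "'v qctx \<Rightarrow> ('v, 'm) prog \<Rightarrow> ('v \<Rightarrow> int) op \<Rightarrow> ('v \<Rightarrow> int) op" where
  "qwp \<Gamma> S P = greatest_predicate \<Gamma> (\<lambda>Q. \<forall>\<rho>\<in>partial_states (basis \<Gamma>).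
    tr (Q o\<^sub>L \<rho>) \<le> tr (P o\<^sub>L sem_state \<Gamma> S (\<rho>, 0)))"

definition qwlp :: "'v qctx \<Rightarrow> ('v, 'm) prog \<Rightarrow> ('v \<Rightarrow> int) op \<Rightarrow> ('v \<Rightarrow> int) op" where
  "qwlp \<Gamma> S P = greatest_predicate \<Gamma> (\<lambda>Q. \<forall>\<rho>\<in>partial_states (basis \<Gamma>).
    tr (Q o\<^sub>L \<rho>) \<le> tr (P o\<^sub>L sem_state \<Gamma> S (\<rho>, 0)) + tr \<rho>
      - tr (sem_state \<Gamma> S (\<rho>, 0)) - sem_err \<Gamma> S (\<rho>, 0))"

type_synonym 'v op_pair = "('v \<Rightarrow> int) op \<times> ('v \<Rightarrow> int) op"

definition qcwp :: "'v qctx \<Rightarrow> ('v, 'm) prog \<Rightarrow> 'v op_pair \<Rightarrow> 'v op_pair" where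
  "qcwp \<Gamma> S = (\<lambda>(P, Q). (qwp \<Gamma> S P, qwlp \<Gamma> S Q))"

definition qcwlp :: "'v qctx \<Rightarrow> ('v, 'm) prog \<Rightarrow> 'v op_pair \<Rightarrow> 'v op_pair" where
  "qcwlp \<Gamma> S = (\<lambda>(P, Q). (qwlp \<Gamma> S P, qwlp \<Gamma> S Q))"

definition pair_app :: "'v op_pair \<Rightarrow> ('v \<Rightarrow> int) op \<Rightarrow> 'v op_pair" where
  "pair_app = (\<lambda>(A, B) \<rho>. (A o\<^sub>L \<rho>, B o\<^sub>L \<rho>))"

text \<open>Undefined quotients are rendered as \<^const>\<open>None\<close>.\<close>

definition quot_opt :: "real \<Rightarrow> real \<Rightarrow> real option" where
  "quot_opt a b = (if b = 0 then None else Some (a / b))"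

definition tr_hat :: "'v op_pair \<Rightarrow> real option" where
  "tr_hat = (\<lambda>(X, Y). quot_opt (tr X) (tr Y))"

definition path_kernel :: "('s \<Rightarrow> 's pmf) \<Rightarrow> 's \<Rightarrow> nat \<Rightarrow> (nat \<Rightarrow> 's) \<Rightarrow> 's measure" where
  "path_kernel K s n \<omega> = measure_pmf (case n of 0 \<Rightarrow> return_pmf s | Suc k \<Rightarrow> K (\<omega> k))"

interpretation paths: Ionescu_Tulcea "path_kernel K s" "\<lambda>_. count_space UNIV" for K s
proof (rule Ionescu_Tulcea.intro)
  show "path_kernel K s n \<in> PiM {0..<n} (\<lambda>_. count_space UNIV) \<rightarrow>\<^sub>M subprob_algebra (count_space UNIV)"
    for n
  proof (cases n)
    case 0
    have "(\<lambda>_. measure_pmf (return_pmf s))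
        \<in> PiM {0..<n} (\<lambda>_. count_space UNIV) \<rightarrow>\<^sub>M subprob_algebra (count_space UNIV)"
      by (rule measurable_const) (rule measure_pmf_in_subprob_algebra)
    then show ?thesis
      unfolding path_kernel_def[abs_def] 0 nat.case .
  next
    case (Suc k)
    have "(\<lambda>x. measure_pmf (K x)) \<in> count_space UNIV \<rightarrow>\<^sub>M subprob_algebra (count_space UNIV)"
      by (simp add: measurable_count_space_eq1 measure_pmf_in_subprob_algebra)
    moreover have "(\<lambda>\<omega>. \<omega> k) \<in> PiM {0..<n} (\<lambda>_. count_space UNIV) \<rightarrow>\<^sub>M count_space UNIV"
      using Suc by (intro measurable_component_singleton) simp
    ultimately have "(\<lambda>\<omega>. measure_pmf (K (\<omega> k)))
        \<in> PiM {0..<n} (\<lambda>_. count_space UNIV) \<rightarrow>\<^sub>M subprob_algebra (count_space UNIV)"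
      by (rule measurable_compose[rotated])
    then show ?thesis
      unfolding path_kernel_def[abs_def] Suc nat.case .
  qed
  show "prob_space (path_kernel K s n \<omega>)" for n \<omega>
    by (simp add: path_kernel_def measure_pmf.prob_space_axioms)
qed

text \<open>The distribution of the infinite paths of the chain with kernel \<open>K\<close> started in \<open>s\<close>.\<close>

definition path_measure :: "('s \<Rightarrow> 's pmf) \<Rightarrow> 's \<Rightarrow> (nat \<Rightarrow> 's) measure" where
  "path_measure K s = paths.PF.lim K s"

definition reach_prob :: "('s \<Rightarrow> 's pmf) \<Rightarrow> 's \<Rightarrow> 's set \<Rightarrow> real" where
  "reach_prob K s T = measure (path_measure K s) {\<omega>. \<exists>n. \<omega> n \<in> T}"

text \<open>In \<open>Conf c \<sigma>\<close>, the value \<^const>\<open>None\<close> of \<open>c\<close> is the empty program \<open>\<down>\<close>.\<close>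

datatype ('v, 'm) conf =
    Conf "('v, 'm) prog option" "('v \<Rightarrow> int) op"
  | Viol
  | Sink

fun seq_conf :: "('v, 'm) prog \<Rightarrow> ('v, 'm) conf \<Rightarrow> ('v, 'm) conf" where
  "seq_conf S2 (Conf None \<sigma>) = Conf (Some S2) \<sigma>"
| "seq_conf S2 (Conf (Some S1) \<sigma>) = Conf (Some (Seq S1 S2)) \<sigma>"
| "seq_conf S2 Viol = Viol"
| "seq_conf S2 Sink = Sink"

definition post_state :: "('v \<Rightarrow> int) op \<Rightarrow> ('v \<Rightarrow> int) op \<Rightarrow> ('v \<Rightarrow> int) op" where
  "post_state A \<sigma> = (1 / tr (conj_op A \<sigma>)) *\<^sub>R conj_op A \<sigma>"

text \<open>
  Outcome \<open>m\<close> has probability \<open>tr (M\<^sub>m \<sigma> M\<^sub>m\<^sup>\<dagger>)\<close>.  These weights form a probability mass function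
  whenever \<open>\<sigma>\<close> is a state and \<open>M\<close> a measurement.
\<close>

definition outcome_pmf :: "'m set \<Rightarrow> ('m \<Rightarrow> ('v \<Rightarrow> int) op) \<Rightarrow> ('v \<Rightarrow> int) op \<Rightarrow> 'm pmf" where
  "outcome_pmf I M \<sigma> = embed_pmf (\<lambda>m. if m \<in> I then tr (conj_op (M m) \<sigma>) else 0)"

text \<open>
  Distinct outcomes of a measurement may lead to the same configuration; \<^const>\<open>map_pmf\<close> then adds
  up their probabilities.
\<close>

primrec prog_step :: "'v qctx \<Rightarrow> ('v, 'm) prog \<Rightarrow> ('v \<Rightarrow> int) op \<Rightarrow> ('v, 'm) conf pmf" where
  "prog_step \<Gamma> Skip \<sigma> = return_pmf (Conf None \<sigma>)"
| "prog_step \<Gamma> (Init q) \<sigma> = return_pmf (Conf None (init_op \<Gamma> q \<sigma>))"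
| "prog_step \<Gamma> (Unitary qs U) \<sigma> = return_pmf (Conf None (conj_op (extend_op \<Gamma> qs U) \<sigma>))"
| "prog_step \<Gamma> (Observe qs R) \<sigma> =
    map_pmf (\<lambda>b. if b then Conf None (post_state (extend_op \<Gamma> qs R) \<sigma>) else Viol)
      (bernoulli_pmf (tr (conj_op (extend_op \<Gamma> qs R) \<sigma>)))"
| "prog_step \<Gamma> (Seq S1 S2) \<sigma> = map_pmf (seq_conf S2) (prog_step \<Gamma> S1 \<sigma>)"
| "prog_step \<Gamma> (Measure qs I M Ss) \<sigma> =
    map_pmf (\<lambda>m. Conf (Some (Ss m)) (post_state (extend_op \<Gamma> qs (M m)) \<sigma>))
      (outcome_pmf I (\<lambda>m. extend_op \<Gamma> qs (M m)) \<sigma>)"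
| "prog_step \<Gamma> (While qs M0 M1 S) \<sigma> =
    map_pmf (\<lambda>b. if b then Conf (Some (Seq S (While qs M0 M1 S))) (post_state (extend_op \<Gamma> qs M1) \<sigma>)
                 else Conf None (post_state (extend_op \<Gamma> qs M0) \<sigma>))
      (outcome_pmf UNIV (\<lambda>b. extend_op \<Gamma> qs (if b then M1 else M0)) \<sigma>)"

fun step :: "'v qctx \<Rightarrow> ('v, 'm) conf \<Rightarrow> ('v, 'm) conf pmf" where
  "step \<Gamma> (Conf (Some S) \<sigma>) = prog_step \<Gamma> S \<sigma>"
| "step \<Gamma> (Conf None \<sigma>) = return_pmf Sink"
| "step \<Gamma> Viol = return_pmf Sink"
| "step \<Gamma> Sink = return_pmf Sink"

definition Pr_reach :: "'v qctx \<Rightarrow> ('v, 'm) prog \<Rightarrow> ('v \<Rightarrow> int) op \<Rightarrow> ('v, 'm) conf \<Rightarrow> real" where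
  "Pr_reach \<Gamma> S \<rho> c = reach_prob (step \<Gamma>) (Conf (Some S) \<rho>) {c}"

definition Pr_not_reach :: "'v qctx \<Rightarrow> ('v, 'm) prog \<Rightarrow> ('v \<Rightarrow> int) op \<Rightarrow> ('v, 'm) conf \<Rightarrow> real" where
  "Pr_not_reach \<Gamma> S \<rho> c = 1 - Pr_reach \<Gamma> S \<rho> c"

definition ER :: "'v qctx \<Rightarrow> ('v, 'm) prog \<Rightarrow> ('v \<Rightarrow> int) op \<Rightarrow> ('v \<Rightarrow> int) op \<Rightarrow> real" where
  "ER \<Gamma> S \<rho> P = (\<Sum>\<^sub>\<infinity>\<rho>'\<in>states (basis \<Gamma>). Pr_reach \<Gamma> S \<rho> (Conf None \<rho>') * tr (P o\<^sub>L \<rho>'))"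

definition LER :: "'v qctx \<Rightarrow> ('v, 'm) prog \<Rightarrow> ('v \<Rightarrow> int) op \<Rightarrow> ('v \<Rightarrow> int) op \<Rightarrow> real" where
  "LER \<Gamma> S \<rho> P = ER \<Gamma> S \<rho> P + Pr_not_reach \<Gamma> S \<rho> Sink"

definition CER :: "'v qctx \<Rightarrow> ('v, 'm) prog \<Rightarrow> ('v \<Rightarrow> int) op \<Rightarrow> ('v \<Rightarrow> int) op \<Rightarrow> real option" where
  "CER \<Gamma> S \<rho> P = quot_opt (ER \<Gamma> S \<rho> P) (Pr_not_reach \<Gamma> S \<rho> Viol)"

definition CLER :: "'v qctx \<Rightarrow> ('v, 'm) prog \<Rightarrow> ('v \<Rightarrow> int) op \<Rightarrow> ('v \<Rightarrow> int) op \<Rightarrow> real option" where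
  "CLER \<Gamma> S \<rho> P = quot_opt (LER \<Gamma> S \<rho> P) (Pr_not_reach \<Gamma> S \<rho> Viol)"

end

theory Submission
  imports Defs
begin

text \<open>
  A trace class \<open>\<rho> \<ge> 0\<close> has a Cholesky factorisation \<open>\<rho> = \<Sum>\<^sub>k |w\<^sub>k\<rangle>\<langle>w\<^sub>k|\<close> along the kets, with
  \<open>\<Sum>\<^sub>k \<parallel>w\<^sub>k\<parallel>\<^sup>2 = tr \<rho>\<close>.  It replaces the spectral theorem throughout: it gives \<open>\<parallel>\<rho>\<parallel> \<le> tr \<rho>\<close>,
  \<open>tr (A\<rho>) = \<Sum>\<^sub>k \<langle>w\<^sub>k, A w\<^sub>k\<rangle>\<close>, and the \<open>\<sigma>\<close>-additivity of every additive functional on partial states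
  that is bounded by a multiple of the trace.  Such a functional \<open>f\<close> with \<open>0 \<le> f \<le> tr\<close> is \<open>\<rho> \<mapsto> tr (Q\<rho>)\<close> for
  a predicate \<open>Q\<close>, obtained by polarising \<open>\<psi> \<mapsto> f(|\<psi>\<rangle>\<langle>\<psi>|)\<close>.  As the denotation of a program is additive
  and does not increase the trace, the inequalities that define \<open>qwp\<close> and \<open>qwlp\<close> are equalities for
  the greatest predicates.

  Operationally, let a run earn \<open>h(\<sigma>)\<close> on termination in \<open>\<sigma>\<close> and \<open>v\<close> on violation, where \<open>h\<close> is such a
  functional.  By induction on the program \<open>S\<close>, the expected payoff from \<open>\<langle>S, \<sigma>\<rangle>\<close> is \<open>h(\<rho>') + v p\<close>, where
  \<open>(\<rho>', p)\<close> is the denotation of \<open>S\<close> at \<open>(\<sigma>, 0)\<close>: a sequential composition pays its first component the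
  payoff of the second, which is again such a functional.  The payoffs \<open>(tr (P \<cdot>), 0)\<close>, \<open>(0, 1)\<close> and
  \<open>(1, 1)\<close> yield \<open>ER\<close> and the probabilities of reaching a violation and the sink.
\<close>

section \<open>The Hilbert space\<close>

text \<open>Adjoints, extended register operators, least upper bounds of loops and greatest
  predicates are all definite descriptions: each denotes something usable only after existence and
  uniqueness are proved. Existence rests on explicit constructions (bounded forms, slices, series).
  Uniqueness rests on inner products, matrix entries or antisymmetry of the Loewner order.

  Denotations are controlled only on partial states, since least upper bounds are taken inside
  \<open>DR\<close> and divergent sums default to 0. Linearity is therefore phrased within partial
  states, and functionals must be extended to the whole positive cone before they can be polarised.
  The Markov chain is likewise controlled only on states, as the weights of
  \<open>outcome_pmf\<close> need not sum to 1 elsewhere; payoff functions are constrained on states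
  alone.

  The payoff has to vary in the induction over programs, because the first part of a composition and
  the body of a loop are run with the payoff of what follows. Such payoffs may exceed the trace,
  which is why functionals carry a constant \<open>K\<close>.\<close>

lemma coord_simps [simp]:
  "coord (x + y) i = coord x i + coord y i" "coord (x - y) i = coord x i - coord y i"
  "coord (- x) i = - coord x i" "coord 0 i = 0" "coord (r *\<^sub>R x) i = of_real r * coord x i"
  "coord (c *\<^sub>C x) i = c * coord x i" "coord (restr B x) i = (if i \<in> B then coord x i else 0)"
  by (simp_all add: plus_ell2.rep_eq minus_ell2.rep_eq uminus_ell2.rep_eq zero_ell2.rep_eq
      scaleR_ell2.rep_eq scaleC.rep_eq restr.rep_eq)

lemma ell2_eqI: "(\<And>i. coord x i = coord y i) \<Longrightarrow> x = y"
  using coord_inject[of x y] by (auto simp: fun_eq_iff)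

lemma coord_sum [simp]: "coord (\<Sum>a\<in>F. f a) i = (\<Sum>a\<in>F. coord (f a) i)"
  by (induction F rule: infinite_finite_induct) auto

lemma scaleC_simps:
  "c *\<^sub>C (x + y) = c *\<^sub>C x + c *\<^sub>C y" "(c + d) *\<^sub>C x = c *\<^sub>C x + d *\<^sub>C x"
  "c *\<^sub>C (x - y) = c *\<^sub>C x - c *\<^sub>C y" "(c - d) *\<^sub>C x = c *\<^sub>C x - d *\<^sub>C x"
  "c *\<^sub>C d *\<^sub>C x = (c * d) *\<^sub>C x" "c *\<^sub>C (r *\<^sub>R x) = r *\<^sub>R (c *\<^sub>C x)"
  by (rule ell2_eqI; simp add: algebra_simps)+

lemma scaleC_neutral [simp]: "1 *\<^sub>C x = x" "0 *\<^sub>C x = 0" "c *\<^sub>C 0 = 0" "(-1) *\<^sub>C x = - x"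
  by (rule ell2_eqI; simp)+

lemma scaleR_scaleC: "r *\<^sub>R x = of_real r *\<^sub>C x"
  by (rule ell2_eqI) simp

lemma cinner_has_sum: "((\<lambda>i. cnj (coord x i) * coord y i) has_sum cinner x y) UNIV"
proof -
  have "(\<lambda>i. cnj (coord x i) * coord y i) summable_on UNIV"
    using coord[of x] coord[of y]
    by (auto intro: Infinite_Sum.abs_summable_summable[OF ell2_prod_abs_summable])
  then show ?thesis
    unfolding cinner.rep_eq by (rule has_sum_infsum)
qed

lemma cinner_commute: "cinner y x = cnj (cinner x y)"
proof -
  have "((\<lambda>i. cnj (cnj (coord x i) * coord y i)) has_sum cnj (cinner x y)) UNIV"
    using cinner_has_sum[of x y] by (subst has_sum_cnj_iff)
  then show ?thesis
    using cinner_has_sum[of y x] by (simp add: mult.commute has_sum_unique)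
qed

lemma cinner_add_right: "cinner x (y + z) = cinner x y + cinner x z"
  using has_sum_add[OF cinner_has_sum[of x y] cinner_has_sum[of x z]] cinner_has_sum[of x "y + z"]
  by (simp add: algebra_simps has_sum_unique)

lemma cinner_scaleC_right: "cinner x (c *\<^sub>C y) = c * cinner x y"
  using has_sum_cmult_right[OF cinner_has_sum[of x y], of c] cinner_has_sum[of x "c *\<^sub>C y"]
  by (simp add: algebra_simps has_sum_unique)

lemma cinner_add_left: "cinner (x + y) z = cinner x z + cinner y z"
  using cinner_add_right[of z x y] by (metis cinner_commute complex_cnj_add)

lemma cinner_scaleC_left: "cinner (c *\<^sub>C x) y = cnj c * cinner x y"
  using cinner_scaleC_right[of y c x] by (metis cinner_commute complex_cnj_mult)

lemma cinner_zero [simp]: "cinner 0 x = 0" "cinner x 0 = 0"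
  using cinner_scaleC_left[of 0 0 x] cinner_scaleC_right[of x 0 0] by simp_all

lemma cinner_minus: "cinner x (- y) = - cinner x y" "cinner (- x) y = - cinner x y"
  using cinner_scaleC_left[of "-1" x y] cinner_scaleC_right[of x "-1" y] by simp_all

lemma cinner_diff: "cinner x (y - z) = cinner x y - cinner x z" "cinner (x - y) z = cinner x z - cinner y z"
  using cinner_add_right[of x y "- z"] cinner_add_left[of x "- y" z] by (simp_all add: cinner_minus)

lemma cinner_scaleR: "cinner x (r *\<^sub>R y) = of_real r * cinner x y" "cinner (r *\<^sub>R x) y = of_real r * cinner x y"
  by (simp_all add: scaleR_scaleC cinner_scaleC_left cinner_scaleC_right)

lemmas cinner_simps = cinner_add_left cinner_add_right cinner_diff cinner_minus cinner_scaleC_left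
  cinner_scaleC_right cinner_scaleR

lemma cinner_sum_left: "cinner (\<Sum>a\<in>F. f a) y = (\<Sum>a\<in>F. cinner (f a) y)"
  by (induction F rule: infinite_finite_induct) (auto simp: cinner_simps)

lemma cinner_self: "cinner x x = of_real ((norm x)\<^sup>2)"
proof (rule complex_eqI)
  show "Re (cinner x x) = Re (of_real ((norm x)\<^sup>2))"
    by (simp add: power2_norm_eq_inner inner_ell2_def)
  show "Im (cinner x x) = Im (of_real ((norm x)\<^sup>2))"
    using cinner_commute[of x x] by (metis Im_complex_of_real Reals_cnj_iff complex_is_Real_iff)
qed

lemma norm_scaleC: "norm (c *\<^sub>C x) = cmod c * norm x"
proof -
  have "of_real ((norm (c *\<^sub>C x))\<^sup>2) = (c * cnj c) * cinner x x"
    unfolding cinner_self[symmetric] by (simp add: cinner_simps)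
  also have "\<dots> = (of_real ((cmod c * norm x)\<^sup>2) :: complex)"
    unfolding complex_norm_square[symmetric] cinner_self by (simp add: power_mult_distrib)
  finally have "of_real ((norm (c *\<^sub>C x))\<^sup>2) = (of_real ((cmod c * norm x)\<^sup>2) :: complex)" .
  then have "(norm (c *\<^sub>C x))\<^sup>2 = (cmod c * norm x)\<^sup>2"
    unfolding of_real_eq_iff .
  then show ?thesis
    by (metis abs_norm_cancel abs_of_nonneg norm_ge_zero power2_eq_iff_nonneg zero_le_mult_iff)
qed

lemma cinner_cauchy_schwarz: "cmod (cinner x y) \<le> norm x * norm y"
proof (cases "cinner x y = 0")
  case False
  let ?z = "cinner x y"
  \<comment> \<open>Rotating by this phase makes the inner product a positive real, so the
    inequality of the real inner product space applies.\<close>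
  let ?u = "cnj ?z / cmod ?z"
  have "Re (?u * ?z) = cmod ?z"
    using False cmod_power2[of ?z] by (simp add: power2_eq_square field_simps)
  then have "cmod ?z = inner x (?u *\<^sub>C y)"
    by (simp add: inner_ell2_def cinner_scaleC_right)
  also have "\<dots> \<le> norm x * norm (?u *\<^sub>C y)"
    by (rule norm_cauchy_schwarz)
  also have "\<dots> = norm x * norm y"
    using False by (simp add: norm_scaleC norm_divide)
  finally show ?thesis .
qed simp

lemma bounded_linear_cinner_right: "bounded_linear (cinner x)"
  by (rule bounded_linear_intro[where K = "norm x"])
    (auto simp: cinner_simps scaleR_conv_of_real intro: order_trans[OF cinner_cauchy_schwarz])

lemma bounded_linear_cinner_left: "bounded_linear (\<lambda>x. cinner x y)"
  by (rule bounded_linear_intro[where K = "norm y"])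
    (auto simp: cinner_simps scaleR_conv_of_real intro: order_trans[OF cinner_cauchy_schwarz])

lemma bounded_linear_scaleC: "bounded_linear (scaleC c)"
  by (rule bounded_linear_intro[where K = "cmod c"]) (auto simp: scaleC_simps norm_scaleC)

lemma norm_ket [simp]: "norm (ket x) = 1"
proof -
  have "of_real ((norm (ket x))\<^sup>2) = (1 :: complex)"
    unfolding cinner_self[symmetric] by (simp add: cinner_ket coord_ket)
  then have "(norm (ket x))\<^sup>2 = 1"
    by (metis of_real_eq_1_iff)
  then show ?thesis
    by (metis abs_norm_cancel one_power2 power2_eq_iff abs_1 abs_minus)
qed

text \<open>Coordinates converge, and the Cauchy bounds on finite sums of squares survive the limit.
  Completeness carries over to \<open>'a op\<close>, where absolutely summable families of operators
  thereby have sums.\<close>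

instance ell2 :: (type) banach
proof
  fix X :: "nat \<Rightarrow> 'a ell2"
  assume X: "Cauchy X"
  have "Cauchy (\<lambda>n. coord (X n) i)" for i
    unfolding cinner_ket[symmetric] by (rule bounded_linear.Cauchy[OF bounded_linear_cinner_right X])
  then have "\<exists>l. (\<lambda>n. coord (X n) i) \<longlonglongrightarrow> l" for i
    by (simp add: Cauchy_convergent_iff convergent_def)
  then obtain l where l: "\<And>i. (\<lambda>n. coord (X n) i) \<longlonglongrightarrow> l i"
    by metis
  have fin: "(\<Sum>i\<in>F. (cmod (coord (X n) i - l i))\<^sup>2) \<le> e\<^sup>2"
    if "finite F" and N: "\<And>m. m \<ge> N \<Longrightarrow> norm (X n - X m) \<le> e" for F n e and N :: nat
  proof (rule LIMSEQ_le_const2)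
    show "(\<lambda>m. \<Sum>i\<in>F. (cmod (coord (X n) i - coord (X m) i))\<^sup>2) \<longlonglongrightarrow>
        (\<Sum>i\<in>F. (cmod (coord (X n) i - l i))\<^sup>2)"
      by (intro tendsto_intros l)
    show "\<exists>N. \<forall>m\<ge>N. (\<Sum>i\<in>F. (cmod (coord (X n) i - coord (X m) i))\<^sup>2) \<le> e\<^sup>2"
    proof (intro exI[of _ N] allI impI)
      fix m assume "N \<le> m"
      have "(\<Sum>i\<in>F. (cmod (coord (X n - X m) i))\<^sup>2) \<le> (norm (X n - X m))\<^sup>2"
        by (rule finite_sum_le_has_sum[OF norm_ell2_square \<open>finite F\<close>]) auto
      also have "\<dots> \<le> e\<^sup>2"
        using N[OF \<open>N \<le> m\<close>] by (intro power_mono) auto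
      finally show "(\<Sum>i\<in>F. (cmod (coord (X n) i - coord (X m) i))\<^sup>2) \<le> e\<^sup>2"
        by simp
    qed
  qed
  have Cau: "\<exists>N. \<forall>n\<ge>N. \<forall>m\<ge>N. norm (X n - X m) \<le> e" if "e > 0" for e
    using X that unfolding Cauchy_altdef dist_norm
    by (metis CauchyD X less_imp_le)
  obtain N where N: "\<And>n m. n \<ge> N \<Longrightarrow> m \<ge> N \<Longrightarrow> norm (X n - X m) \<le> 1"
    using Cau[of 1] by auto
  have "(\<lambda>i. (cmod (coord (X N) i - l i))\<^sup>2) summable_on UNIV"
    by (rule nonneg_bdd_above_summable_on) (auto intro!: bdd_aboveI2 fin[where N = N and e = 1] N)
  \<comment> \<open>\<open>l\<close> is \<open>coord (X N)\<close> minus a square-summable function,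
    hence square-summable itself.\<close>
  then have "(\<lambda>i. (cmod (coord (X N) i - (coord (X N) i - l i)))\<^sup>2) summable_on UNIV"
    using coord[of "X N"] ell2_scale_summable[of "\<lambda>i. coord (X N) i - l i" "-1"]
      ell2_add_summable[of "coord (X N)" "\<lambda>i. -1 * (coord (X N) i - l i)"]
    by simp
  then obtain L :: "'a ell2" where L: "coord L = l"
    using Abs_ell2_inverse[of l] by auto
  have "X \<longlonglongrightarrow> L"
  proof (rule LIMSEQ_I)
    fix e :: real assume "e > 0"
    then obtain N where N: "\<And>n m. n \<ge> N \<Longrightarrow> m \<ge> N \<Longrightarrow> norm (X n - X m) \<le> e / 2"
      using Cau[of "e / 2"] by auto
    have "norm (X n - L) < e" if "n \<ge> N" for n
    proof -
      have "(norm (X n - L))\<^sup>2 \<le> (e / 2)\<^sup>2"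
        by (rule has_sum_le_finite_sums[OF norm_ell2_square])
          (use N that in \<open>auto simp: L intro!: fin[where N = N and e = "e / 2", simplified]\<close>)
      then have "norm (X n - L) \<le> e / 2"
        by (rule power2_le_imp_le) (use \<open>e > 0\<close> in auto)
      then show ?thesis
        using \<open>e > 0\<close> by auto
    qed
    then show "\<exists>no. \<forall>n\<ge>no. norm (X n - L) < e"
      by auto
  qed
  then show "convergent X"
    by (rule convergentI)
qed

text \<open>The truncation \<open>restr F x\<close> misses \<open>x\<close> by the square root of
  the tail of the series of squared coordinates.\<close>

lemma ket_expansion: "((\<lambda>i. coord x i *\<^sub>C ket i) has_sum x) UNIV"
proof -
  have *: "(\<Sum>i\<in>F. coord x i *\<^sub>C ket i) = restr F x" if "finite F" for F
    by (rule ell2_eqI) (use that in \<open>auto simp: coord_ket if_distrib sum.delta' cong: if_cong\<close>)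
  have "((\<lambda>F. (norm x)\<^sup>2 - (\<Sum>i\<in>F. (cmod (coord x i))\<^sup>2)) \<longlongrightarrow> (norm x)\<^sup>2 - (norm x)\<^sup>2) (finite_subsets_at_top UNIV)"
    using norm_ell2_square[of x] unfolding has_sum_def by (intro tendsto_intros)
  then have "((\<lambda>F. sqrt ((norm x)\<^sup>2 - (\<Sum>i\<in>F. (cmod (coord x i))\<^sup>2))) \<longlongrightarrow> sqrt 0) (finite_subsets_at_top UNIV)"
    by (intro tendsto_real_sqrt) simp
  moreover have "norm (restr F x - x) = sqrt ((norm x)\<^sup>2 - (\<Sum>i\<in>F. (cmod (coord x i))\<^sup>2))" if "finite F" for F
  proof -
    have "((\<lambda>i. (cmod (coord x i))\<^sup>2 - (if i \<in> F then (cmod (coord x i))\<^sup>2 else 0)) has_sum ((norm x)\<^sup>2 - (\<Sum>i\<in>F. (cmod (coord x i))\<^sup>2))) UNIV"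
    proof -
      have "((\<lambda>i. (cmod (coord x i))\<^sup>2) has_sum (\<Sum>i\<in>F. (cmod (coord x i))\<^sup>2)) F"
        using that by (rule has_sum_finite)
      then have "((\<lambda>i. (if i \<in> F then (cmod (coord x i))\<^sup>2 else 0)) has_sum (\<Sum>i\<in>F. (cmod (coord x i))\<^sup>2)) UNIV"
        by (rule has_sum_cong_neutral[THEN iffD1, rotated -1]) auto
      from has_sum_add[OF norm_ell2_square[of x] has_sum_uminusI[OF this]]
      show ?thesis by simp
    qed
    moreover have "(cmod (coord (restr F x - x) i))\<^sup>2 = (cmod (coord x i))\<^sup>2 - (if i \<in> F then (cmod (coord x i))\<^sup>2 else 0)" for i
      by simp
    ultimately have "(norm (restr F x - x))\<^sup>2 = (norm x)\<^sup>2 - (\<Sum>i\<in>F. (cmod (coord x i))\<^sup>2)"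
      using norm_ell2_square[of "restr F x - x"] by (simp add: has_sum_unique)
    then show ?thesis
      by (metis norm_ge_zero real_sqrt_unique)
  qed
  ultimately have "((\<lambda>F. norm (restr F x - x)) \<longlongrightarrow> 0) (finite_subsets_at_top UNIV)"
    by (subst tendsto_cong[where g = "\<lambda>F. sqrt ((norm x)\<^sup>2 - (\<Sum>i\<in>F. (cmod (coord x i))\<^sup>2))"])
      (auto intro: eventually_finite_subsets_at_top_weakI)
  then have "((\<lambda>F. restr F x) \<longlongrightarrow> x) (finite_subsets_at_top UNIV)"
    by (simp add: tendsto_norm_zero_iff LIM_zero_iff)
  then show ?thesis
    unfolding has_sum_def
    by (subst tendsto_cong[where g = "\<lambda>F. restr F x"])
      (auto simp: * intro: eventually_finite_subsets_at_top_weakI)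
qed

text \<open>\<open>bounded_linear\<close> means linearity over the reals, and some of the maps
  compared are conjugate-linear. Agreement is therefore required on all complex multiples of
  kets.\<close>

lemma bounded_linear_eq_on_kets:
  fixes f g :: "'a ell2 \<Rightarrow> 'b::real_normed_vector"
  assumes "bounded_linear f" "bounded_linear g" "\<And>c i. f (c *\<^sub>C ket i) = g (c *\<^sub>C ket i)"
  shows "f = g"
proof
  fix x
  from has_sum_bounded_linear[OF assms(1) ket_expansion[of x]]
    has_sum_bounded_linear[OF assms(2) ket_expansion[of x]]
  show "f x = g x"
    by (simp add: o_def assms(3) has_sum_unique)
qed

section \<open>Complex-linear operators, bounded sesquilinear forms and adjoints\<close>

definition clin :: "'a op \<Rightarrow> bool" where
  "clin A \<longleftrightarrow> (\<forall>c \<psi>. A (c *\<^sub>C \<psi>) = c *\<^sub>C A \<psi>)"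

lemma clinD: "clin A \<Longrightarrow> A (c *\<^sub>C \<psi>) = c *\<^sub>C A \<psi>"
  by (simp add: clin_def)

lemma clin_eq_on_kets:
  assumes "clin A" "clin A'" "\<And>i. A (ket i) = A' (ket i)"
  shows "A = A'"
proof (rule blinfun_eqI)
  have "blinfun_apply A = blinfun_apply A'"
    by (rule bounded_linear_eq_on_kets)
      (simp_all add: clinD assms blinfun.bounded_linear_right)
  then show "A x = A' x" for x by simp
qed

lemma clin_eq_matrix:
  assumes "clin A" "clin A'" "\<And>i j. cinner (ket i) (A (ket j)) = cinner (ket i) (A' (ket j))"
  shows "A = A'"
  using assms by (intro clin_eq_on_kets ell2_eqI) (auto simp: cinner_ket)

text \<open>The vector representing \<open>S(\<cdot>, y)\<close> has coordinates \<open>S(|i\<rangle>, y)\<close>; testing \<open>S\<close> against its own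
  finite truncations bounds its norm.\<close>

lemma sesquilinear_form_operator:
  fixes S :: "'a ell2 \<Rightarrow> 'a ell2 \<Rightarrow> complex"
  assumes add_left: "\<And>x x' y. S (x + x') y = S x y + S x' y"
    and scale_left: "\<And>c x y. S (c *\<^sub>C x) y = cnj c * S x y"
    and add_right: "\<And>x y y'. S x (y + y') = S x y + S x y'"
    and scale_right: "\<And>c x y. S x (c *\<^sub>C y) = c * S x y"
    and bound: "\<And>x y. cmod (S x y) \<le> K * norm x * norm y"
  obtains Q :: "'a op" where "clin Q" "\<And>x y. cinner x (Q y) = S x y"
proof -
  have "K \<ge> 0"
    using order_trans[OF norm_ge_zero bound[of "ket undefined" "ket undefined"]] by simp
  have zero: "S 0 y = 0" for y
    using scale_left[of 0 0 y] by simp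
  have sum_left: "S (\<Sum>i\<in>F. f i) y = (\<Sum>i\<in>F. S (f i) y)" for F and f :: "'a \<Rightarrow> 'a ell2" and y
    by (induction F rule: infinite_finite_induct) (auto simp: add_left zero)
  have fin: "(\<Sum>i\<in>F. (cmod (S (ket i) y))\<^sup>2) \<le> (K * norm y)\<^sup>2" if "finite F" for F y
  proof -
    define u where "u = (\<Sum>i\<in>F. S (ket i) y *\<^sub>C ket i)"
    let ?s = "\<Sum>i\<in>F. (cmod (S (ket i) y))\<^sup>2"
    have "cinner u u = of_real ?s"
      unfolding u_def cinner_sum_left using that
      by (auto simp: cinner_simps cinner_ket coord_ket if_distrib sum.delta' complex_norm_square
          mult.commute simp del: of_real_power cong: if_cong intro!: sum.cong)
    then have nu: "(norm u)\<^sup>2 = ?s"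
      unfolding cinner_self of_real_eq_iff .
    have "S u y = of_real ?s"
      unfolding u_def sum_left
      by (auto simp: scale_left complex_norm_square mult.commute simp del: of_real_power intro!: sum.cong)
    then have "cmod (S u y) = (norm u)\<^sup>2"
      unfolding nu[symmetric] by (simp only: norm_of_real abs_of_nonneg zero_le_power2)
    then have "(norm u)\<^sup>2 \<le> K * norm u * norm y"
      using bound[of u y] by simp
    then have "norm u \<le> K * norm y"
      using \<open>K \<ge> 0\<close> by (cases "norm u = 0") (auto simp: power2_eq_square mult.assoc mult.left_commute)
    then show ?thesis
      unfolding nu[symmetric] by (intro power_mono) auto
  qed
  have "\<exists>z. \<forall>i. coord z i = S (ket i) y" for y
  proof -
    have "(\<lambda>i. (cmod (S (ket i) y))\<^sup>2) summable_on UNIV"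
      by (rule nonneg_bdd_above_summable_on) (auto intro!: bdd_aboveI2 fin)
    then show ?thesis
      by (intro exI[of _ "Abs_ell2 (\<lambda>i. S (ket i) y)"]) (simp add: Abs_ell2_inverse)
  qed
  then obtain q where q: "\<And>y i. coord (q y) i = S (ket i) y"
    by metis
  have nq: "norm (q y) \<le> norm y * K" for y
  proof -
    have "(norm (q y))\<^sup>2 \<le> (K * norm y)\<^sup>2"
      by (rule has_sum_le_finite_sums[OF norm_ell2_square]) (auto simp: q fin)
    then have "norm (q y) \<le> K * norm y"
      by (rule power2_le_imp_le) (use \<open>K \<ge> 0\<close> in auto)
    then show ?thesis
      by (simp add: mult.commute)
  qed
  have "bounded_linear q"
    by (rule bounded_linear_intro[where K = K])
      (auto intro!: ell2_eqI nq simp: q add_right scaleR_scaleC scale_right)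
  then have Q: "blinfun_apply (Blinfun q) = q"
    by (rule bounded_linear_Blinfun_apply)
  show ?thesis
  proof (rule that[of "Blinfun q"])
    show "clin (Blinfun q)"
      unfolding clin_def Q by (auto intro!: ell2_eqI simp: q scale_right)
    fix x y
    have "bounded_linear (\<lambda>x. S x y)"
      by (rule bounded_linear_intro[where K = "K * norm y"])
        (use bound in \<open>auto simp: add_left scaleR_scaleC scale_left scaleR_conv_of_real algebra_simps\<close>)
    then have "(\<lambda>x. cinner x (q y)) = (\<lambda>x. S x y)"
      by (intro bounded_linear_eq_on_kets bounded_linear_cinner_left)
        (auto simp: cinner_simps scale_left cinner_ket q)
    then show "cinner x (Blinfun q y) = S x y"
      unfolding Q by metis
  qed
qed

lemma cinner_ext: "(\<And>x. cinner x y = cinner x z) \<Longrightarrow> y = z"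
  by (rule ell2_eqI) (metis cinner_ket)

lemma adj_unique:
  fixes A A' :: "'a op"
  assumes "\<And>x y. cinner (A x) y = cinner x (A' y)"
  shows "A\<^sup>\<dagger> = A'"
  unfolding adj_def
proof (rule the_equality)
  fix A'' :: "'a op" assume "\<forall>\<phi> \<psi>. cinner (A \<phi>) \<psi> = cinner \<phi> (A'' \<psi>)"
  then show "A'' = A'"
    using assms by (intro blinfun_eqI cinner_ext) metis
qed (use assms in auto)

text \<open>\<open>cinner (A x) y\<close> is a sesquilinear form bounded by the norm of
  \<open>A\<close>; the operator that represents it is the adjoint that the definite description in
  \<open>adj\<close> asks for.\<close>

lemma adj_exists:
  assumes "clin A"
  obtains A' :: "'a op" where "clin A'" "\<And>x y. cinner x (A' y) = cinner (A x) y"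
proof (rule sesquilinear_form_operator[where S = "\<lambda>x y. cinner (A x) y" and K = "norm A"])
  fix x y
  have "cmod (cinner (A x) y) \<le> norm (A x) * norm y"
    by (rule cinner_cauchy_schwarz)
  also have "\<dots> \<le> norm A * norm x * norm y"
    by (intro mult_right_mono norm_blinfun) auto
  finally show "cmod (cinner (A x) y) \<le> norm A * norm x * norm y" .
qed (use assms in \<open>auto simp: cinner_simps blinfun.add_right clinD\<close>)

lemma
  fixes A :: "'a op"
  assumes "clin A"
  shows cinner_adj_right: "cinner x ((A\<^sup>\<dagger>) y) = cinner (A x) y"
    and clin_adj: "clin (A\<^sup>\<dagger>)"
proof -
  obtain A' :: "'a op" where A': "clin A'" "\<And>x y. cinner x (A' y) = cinner (A x) y"
    using adj_exists[OF assms] by blast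
  have [simp]: "A\<^sup>\<dagger> = A'"
    by (rule adj_unique) (simp add: A')
  show "cinner x ((A\<^sup>\<dagger>) y) = cinner (A x) y" "clin (A\<^sup>\<dagger>)"
    by (simp_all add: A')
qed

section \<open>Positive trace class operators\<close>

text \<open>Tonelli for sums of nonnegative terms. It exchanges the diagonal sum of a trace with
  sums over rank-one terms, and sums over rank-one terms or slices with sums over outcomes.\<close>

lemma nonneg_has_sum_swap:
  fixes f :: "'i \<Rightarrow> 'x \<Rightarrow> real"
  assumes "\<And>i. i \<in> I \<Longrightarrow> ((\<lambda>x. f i x) has_sum g i) X" and "(g has_sum S) I"
    and "\<And>i x. i \<in> I \<Longrightarrow> x \<in> X \<Longrightarrow> 0 \<le> f i x"
    and "\<And>x. x \<in> X \<Longrightarrow> ((\<lambda>i. f i x) has_sum h x) I"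
  shows "(h has_sum S) X"
proof -
  have "(\<lambda>(i, x). f i x) summable_on (I \<times> X)"
    by (rule summable_on_SigmaI[where g = g]) (use assms in \<open>auto simp: has_sum_imp_summable\<close>)
  then have "((\<lambda>(i, x). f i x) has_sum S) (I \<times> X)"
    by (intro has_sum_SigmaI[where g = g]) (use assms in auto)
  then have "((\<lambda>(x, i). f i x) has_sum S) (X \<times> I)"
    by (subst (asm) has_sum_swap) (simp add: case_prod_unfold)
  then show ?thesis
    by (rule has_sum_SigmaD) (use assms in auto)
qed

lemma cinner_ket_right: "cinner x (ket i) = cnj (coord x i)"
  by (metis cinner_commute cinner_ket)

lemma idop_apply [simp]: "idop B x = restr B x"
  by (rule idop.rep_eq[THEN fun_cong])

lemma restr_restr [simp]: "restr B (restr B x) = restr B x"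
  by (rule ell2_eqI) simp

lemma restr_0 [simp]: "restr B 0 = 0"
  by (rule ell2_eqI) simp

lemma restr_scaleC: "restr B (c *\<^sub>C x) = c *\<^sub>C restr B x"
  by (rule ell2_eqI) simp

lemma cinner_restr: "cinner (restr B x) y = cinner x (restr B y)"
  unfolding cinner.rep_eq by (rule infsum_cong) simp

lemma cinner_restr_self: "cinner x (restr B x) = of_real ((norm (restr B x))\<^sup>2)"
  using cinner_self[of "restr B x"] by (simp add: cinner_restr)

lemma bounded_linear_restr: "bounded_linear (restr B)"
  using blinfun.bounded_linear_right[of "idop B"] by simp

lemma norm_restr_le: "norm (restr B x) \<le> norm x"
proof -
  have "(norm (restr B x))\<^sup>2 \<le> (norm x)\<^sup>2"
    by (rule has_sum_mono[OF norm_ell2_square norm_ell2_square]) simp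
  then show ?thesis
    by (rule power2_le_imp_le) simp
qed

text \<open>Since \<open>restr B\<close> is idempotent, the sandwich in \<open>op_on\<close> splits
  into absorption on either side, the form that rewriting can use.\<close>

lemma op_on_iff: "op_on B A \<longleftrightarrow> clin A \<and> (\<forall>x. A (restr B x) = A x) \<and> (\<forall>x. restr B (A x) = A x)"
proof
  assume "op_on B A"
  then have "clin A" and *: "idop B o\<^sub>L A o\<^sub>L idop B = A"
    by (auto simp: op_on_def clin_def)
  have **: "restr B (A (restr B x)) = A x" for x
    using arg_cong[OF *, of "\<lambda>A. blinfun_apply A x"] by simp
  then have "A (restr B x) = A x" for x
    by (metis restr_restr)
  with ** \<open>clin A\<close> show "clin A \<and> (\<forall>x. A (restr B x) = A x) \<and> (\<forall>x. restr B (A x) = A x)"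
    by metis
qed (auto simp: op_on_def clin_def intro!: blinfun_eqI)

lemma op_on_clin: "op_on B A \<Longrightarrow> clin A"
  and op_on_restr_right: "op_on B A \<Longrightarrow> A (restr B x) = A x"
  and op_on_restr_left: "op_on B A \<Longrightarrow> restr B (A x) = A x"
  by (auto simp: op_on_iff)

lemma op_on_0: "op_on B 0"
  by (auto simp: op_on_iff clin_def)

lemma restr_add: "restr B (x + y) = restr B x + restr B y"
  and restr_diff: "restr B (x - y) = restr B x - restr B y"
  and restr_scaleR: "restr B (r *\<^sub>R x) = r *\<^sub>R restr B x"
  by (rule ell2_eqI; simp)+

lemma op_on_add: "op_on B A \<Longrightarrow> op_on B A' \<Longrightarrow> op_on B (A + A')"
  and op_on_diff: "op_on B A \<Longrightarrow> op_on B A' \<Longrightarrow> op_on B (A - A')"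
  and op_on_scaleR: "op_on B A \<Longrightarrow> op_on B (r *\<^sub>R A)"
  by (auto simp: op_on_iff clin_def blinfun.bilinear_simps restr_add restr_diff restr_scaleR scaleC_simps)

lemma op_on_idop: "op_on B (idop B)"
  by (simp add: op_on_iff clin_def restr_scaleC)

lemma op_on_adj: 
  assumes "op_on B A" 
  shows "op_on B (A\<^sup>\<dagger>)"
  unfolding op_on_iff
proof (intro conjI allI)
  note A = assms[unfolded op_on_iff]
  show "clin (A\<^sup>\<dagger>)"
    using A by (simp add: clin_adj)
  show "(A\<^sup>\<dagger>) (restr B x) = (A\<^sup>\<dagger>) x" for x
    by (rule cinner_ext) (use A in \<open>simp add: cinner_adj_right cinner_restr[symmetric]\<close>)
  show "restr B ((A\<^sup>\<dagger>) x) = (A\<^sup>\<dagger>) x" for x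
    by (rule cinner_ext) (use A in \<open>simp add: cinner_restr[symmetric] cinner_adj_right\<close>)
qed

lemma has_sum_apply: "(\<rho> has_sum R) I \<Longrightarrow> ((\<lambda>i. blinfun_apply (\<rho> i) x) has_sum R x) I"
  by (rule has_sum_bounded_linear[OF blinfun.bounded_linear_left])

lemma has_sum_cinner_apply:
  fixes \<rho> :: "'i \<Rightarrow> 'a op"
  shows "(\<rho> has_sum R) I \<Longrightarrow> ((\<lambda>i. cinner y (\<rho> i x)) has_sum cinner y (R x)) I"
  by (rule has_sum_bounded_linear[OF bounded_linear_cinner_right has_sum_apply])

lemma op_on_has_sum:
  assumes "(\<rho> has_sum R) I" "\<And>i. i \<in> I \<Longrightarrow> op_on B (\<rho> i)"
  shows "op_on B R"
  unfolding op_on_iff clin_def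
proof (intro conjI allI)
  note sums = has_sum_apply[OF assms(1)]
  have eq: "u = v" if "((\<lambda>i. f i) has_sum u) I" "((\<lambda>i. g i) has_sum v) I" "\<And>i. i \<in> I \<Longrightarrow> f i = g i"
    for u v :: "'b ell2" and f g
    using that has_sum_cong[of I f g] has_sum_unique by metis
  show "R (c *\<^sub>C x) = c *\<^sub>C R x" for c x
    by (rule eq[OF sums has_sum_bounded_linear[OF bounded_linear_scaleC sums]])
      (use assms(2) in \<open>auto simp: op_on_iff clin_def\<close>)
  show "R (restr B x) = R x" for x
    by (rule eq[OF sums sums]) (use assms(2) in \<open>auto simp: op_on_iff\<close>)
  show "restr B (R x) = R x" for x
    by (rule eq[OF has_sum_bounded_linear[OF bounded_linear_restr sums] sums])
      (use assms(2) in \<open>auto simp: op_on_iff\<close>)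
qed

lemma nonneg_Reals_has_sum:
  assumes "(f has_sum (s::complex)) I" "\<And>i. i \<in> I \<Longrightarrow> f i \<in> \<real>\<^sub>\<ge>\<^sub>0"
  shows "s \<in> \<real>\<^sub>\<ge>\<^sub>0"
proof -
  have "0 \<le> Re s"
    using has_sum_Re[OF assms(1)] by (rule has_sum_nonneg) (use assms(2) in \<open>auto simp: complex_nonneg_Reals_iff\<close>)
  moreover have "((\<lambda>i. 0) has_sum Im s) I"
    using has_sum_Im[OF assms(1)] by (rule has_sum_cong[THEN iffD1, rotated]) (use assms(2) in \<open>auto simp: complex_nonneg_Reals_iff\<close>)
  then have "Im s = 0"
    using has_sum_unique has_sum_0_simp by blast
  ultimately show ?thesis
    by (simp add: complex_nonneg_Reals_iff)
qed

lemma positive_has_sum: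
  assumes "(\<rho> has_sum R) I" "\<And>i. i \<in> I \<Longrightarrow> positive (\<rho> i)"
  shows "positive R"
  unfolding positive_def
  using nonneg_Reals_has_sum[OF has_sum_cinner_apply[OF assms(1)]] assms(2) unfolding positive_def by blast

lemma positiveD: "positive A \<Longrightarrow> cinner x (A x) = of_real (Re (cinner x (A x)))"
  and positive_ge_0: "positive A \<Longrightarrow> 0 \<le> Re (cinner x (A x))"
  unfolding positive_def complex_nonneg_Reals_iff by (auto simp: complex_eq_iff)

lemma positive_0 [simp]: "positive 0"
  by (simp add: positive_def)

lemma positive_add: "positive A \<Longrightarrow> positive A' \<Longrightarrow> positive (A + A')"
  by (simp add: positive_def blinfun.bilinear_simps cinner_simps nonneg_Reals_add_I)

lemma positive_scaleR: "positive A \<Longrightarrow> 0 \<le> r \<Longrightarrow> positive (r *\<^sub>R A)"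
  by (auto simp: positive_def blinfun.bilinear_simps cinner_simps intro!: nonneg_Reals_mult_I)

text \<open>The quadratic form is real at x, y, x + y and x + \<i> y; the last two give the
  imaginary and the real part of the symmetry.\<close>

lemma positive_hermitian:
  assumes "clin A" "positive A"
  shows "cinner y (A x) = cnj (cinner x (A y))"
proof (rule complex_eqI)
  have "Im (cinner (x + y) (A (x + y))) = 0" "Im (cinner (x + \<i> *\<^sub>C y) (A (x + \<i> *\<^sub>C y))) = 0"
    "Im (cinner x (A x)) = 0" "Im (cinner y (A y)) = 0"
    using assms(2) unfolding positive_def complex_nonneg_Reals_iff by auto
  then show "Re (cinner y (A x)) = Re (cnj (cinner x (A y)))" "Im (cinner y (A x)) = Im (cnj (cinner x (A y)))"
    by (auto simp: blinfun.bilinear_simps cinner_simps clinD[OF assms(1)])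
qed

text \<open>The form \<open>cinner x (A y)\<close> is a possibly degenerate inner product. Its
  nonnegativity at x - s b y is a quadratic inequality in the real number s.\<close>

lemma positive_cauchy_schwarz:
  assumes "clin A" "positive A"
  shows "(cmod (cinner x (A y)))\<^sup>2 \<le> Re (cinner x (A x)) * Re (cinner y (A y))"
proof -
  define b where "b = cinner y (A x)"
  have b: "cinner x (A y) = cnj b"
    unfolding b_def by (rule positive_hermitian[OF assms])
  have *: "0 \<le> Re (cinner x (A x)) - 2 * s * (cmod b)\<^sup>2 + s\<^sup>2 * (cmod b)\<^sup>2 * Re (cinner y (A y))" for s :: real
  proof -
    have "cinner (x - (of_real s * b) *\<^sub>C y) (A (x - (of_real s * b) *\<^sub>C y)) =
        cinner x (A x) - of_real (2 * s) * (b * cnj b) + of_real (s\<^sup>2) * (b * cnj b) * cinner y (A y)"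
      by (simp add: blinfun.bilinear_simps cinner_simps clinD[OF assms(1)] b b_def[symmetric] 
          power2_eq_square algebra_simps)
    then show ?thesis
      using positive_ge_0[OF assms(2), of "x - (of_real s * b) *\<^sub>C y"] 
      unfolding complex_norm_square[symmetric] by simp
  qed
  show ?thesis
  proof (cases "Re (cinner y (A y)) = 0")
    case True
    have "(cmod b)\<^sup>2 = 0"
    proof (rule ccontr)
      assume nz: "(cmod b)\<^sup>2 \<noteq> 0"
      have "0 \<le> Re (cinner x (A x))"
        using positive_ge_0[OF assms(2)] .
      \<comment> \<open>The quadratic term is gone, so the inequality is affine in s with slope -2
        |b|^2 and fails for this large s.\<close>
      with *[of "(Re (cinner x (A x)) + 1) / (cmod b)\<^sup>2"] True nz show False
        by simp
    qed
    with True b show ?thesis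
      by simp
  next
    case False
    with positive_ge_0[OF assms(2), of y] have "Re (cinner y (A y)) > 0"
      by simp
    \<comment> \<open>The minimiser of the quadratic polynomial when b is nonzero.\<close>
    with *[of "1 / Re (cinner y (A y))"] b show ?thesis
      by (simp add: field_simps power2_eq_square)
  qed
qed

section \<open>Rank-one operators |w><w| (\<open>butter w\<close>) and the Cholesky
  decomposition\<close>

lift_definition butter :: "'a ell2 \<Rightarrow> 'a op" is "\<lambda>w x. cinner w x *\<^sub>C w"
proof (rule bounded_linear_intro)
  show "norm (cinner w x *\<^sub>C w) \<le> norm x * (norm w * norm w)" for w x :: "'a ell2"
    using mult_right_mono[OF cinner_cauchy_schwarz[of w x], of "norm w"]
    by (simp add: norm_scaleC algebra_simps)
qed (auto simp: cinner_simps scaleC_simps scaleR_scaleC)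

lemma butter_apply [simp]: "butter w x = cinner w x *\<^sub>C w"
  by (rule butter.rep_eq[THEN fun_cong])

lemma norm_butter_le: "norm (butter w) \<le> (norm w)\<^sup>2"
proof (rule norm_blinfun_bound)
  show "norm (butter w x) \<le> (norm w)\<^sup>2 * norm x" for x
    using mult_right_mono[OF cinner_cauchy_schwarz[of w x], of "norm w"]
    by (simp add: norm_scaleC power2_eq_square algebra_simps)
qed simp

lemma clin_butter: "clin (butter w)"
  by (simp add: clin_def cinner_simps scaleC_simps)

lemma cinner_butter: "cinner x (butter w x) = of_real ((cmod (cinner w x))\<^sup>2)"
  unfolding complex_norm_square by (simp add: cinner_simps cinner_commute[of x w])

lemma positive_butter: "positive (butter w)"
  unfolding positive_def cinner_butter by simp

lemma op_on_butter: "restr B w = w \<Longrightarrow> op_on B (butter w)"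
  by (simp add: op_on_iff clin_butter restr_scaleC cinner_restr[symmetric])

text \<open>A column of the Cholesky factor. If the diagonal entry is 0, division by zero yields the
  vector 0, which is the right value because the whole column then vanishes.\<close>

definition pivot :: "'a op \<Rightarrow> 'a \<Rightarrow> 'a ell2" where
  "pivot A x = (1 / sqrt (Re (cinner (ket x) (A (ket x))))) *\<^sub>R A (ket x)"

text \<open>The remainder is a Schur complement. It is positive because |<pivot, z>|^2 is |<x, A
  z>|^2 divided by <x, A x>, which Cauchy-Schwarz for \<open>A\<close> bounds by <z, A z>.\<close>

lemma cholesky_step:
  assumes "op_on B A" "positive A"
  shows "op_on B (A - butter (pivot A x))" "positive (A - butter (pivot A x))"
    "(A - butter (pivot A x)) (ket x) = 0"
    "A (ket y) = 0 \<Longrightarrow> (A - butter (pivot A x)) (ket y) = 0"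
    "restr B (pivot A x) = pivot A x"
proof -
  have clin: "clin A"
    using assms op_on_clin by blast
  show p: "restr B (pivot A x) = pivot A x"
    using assms by (simp add: pivot_def restr_scaleR op_on_restr_left)
  show "op_on B (A - butter (pivot A x))"
    using assms p by (intro op_on_diff op_on_butter)
  define a where "a = Re (cinner (ket x) (A (ket x)))"
  have a: "cinner (ket x) (A (ket x)) = of_real a" "0 \<le> a"
    unfolding a_def by (rule positiveD[OF assms(2)], rule positive_ge_0[OF assms(2)])
  have piv: "cinner (pivot A x) z = of_real (1 / sqrt a) * cinner (ket x) (A z)" for z
    by (simp add: pivot_def a_def[symmetric] cinner_simps)
      (metis positive_hermitian[OF clin assms(2)] cinner_commute)
  have le: "(cmod (cinner (pivot A x) z))\<^sup>2 \<le> Re (cinner z (A z))" for z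
  proof (cases "a = 0")
    case False
    have "(cmod (cinner (pivot A x) z))\<^sup>2 = (cmod (cinner (ket x) (A z)))\<^sup>2 / a"
      using a by (simp add: piv norm_mult norm_divide power_mult_distrib power_divide)
    also have "\<dots> \<le> Re (cinner z (A z))"
      using positive_cauchy_schwarz[OF clin assms(2), of "ket x" z] a False
      by (simp add: a_def[symmetric] divide_le_eq mult.commute)
    finally show ?thesis .
  qed (simp add: piv positive_ge_0[OF assms(2)])
  show "positive (A - butter (pivot A x))"
    unfolding positive_def
  proof
    fix z
    have "cinner z ((A - butter (pivot A x)) z) = of_real (Re (cinner z (A z)) - (cmod (cinner (pivot A x) z))\<^sup>2)"
      unfolding blinfun.diff_left cinner_diff cinner_butter of_real_diff
      by (metis positiveD[OF assms(2)])
    then show "cinner z ((A - butter (pivot A x)) z) \<in> \<real>\<^sub>\<ge>\<^sub>0"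
      using le[of z] by (simp only: nonneg_Reals_of_real_iff diff_ge_0_iff_ge)
  qed
  show "(A - butter (pivot A x)) (ket x) = 0"
  proof (cases "a = 0")
    case True
    have "A (ket x) = 0"
    proof (rule cinner_ext)
      fix z
      have "(cmod (cinner z (A (ket x))))\<^sup>2 \<le> 0"
        using positive_cauchy_schwarz[OF clin assms(2), of z "ket x"] True by (simp add: a_def[symmetric])
      then show "cinner z (A (ket x)) = cinner z 0"
        by simp
    qed
    then show ?thesis
      by (simp add: blinfun.diff_left pivot_def)
  next
    case False
    have "(1 / sqrt a * a) *\<^sub>R ((1 / sqrt a) *\<^sub>R A (ket x)) = A (ket x)"
      using a False by simp
    then have "of_real (1 / sqrt a * a) *\<^sub>C ((1 / sqrt a) *\<^sub>R A (ket x)) = A (ket x)"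
      by (simp add: scaleR_scaleC)
    then show ?thesis
      using a by (simp add: blinfun.diff_left piv) (simp add: pivot_def a_def[symmetric])
  qed
  show "(A - butter (pivot A x)) (ket y) = 0" if "A (ket y) = 0"
    using that by (simp add: blinfun.diff_left piv)
qed

lemma ptc_op_on: "\<rho> \<in> pos_trace_class B \<Longrightarrow> op_on B \<rho>"
  and ptc_positive: "\<rho> \<in> pos_trace_class B \<Longrightarrow> positive \<rho>"
  by (auto simp: pos_trace_class_def)

lemma ptc_tr_has_sum:
  assumes "\<rho> \<in> pos_trace_class B"
  shows "((\<lambda>x. Re (cinner (ket x) (\<rho> (ket x)))) has_sum tr \<rho>) UNIV"
  unfolding tr_def using assms by (intro has_sum_Re has_sum_infsum) (auto simp: pos_trace_class_def)

lemma ptcI: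
  assumes "op_on B \<rho>" "positive \<rho>" "((\<lambda>x. Re (cinner (ket x) (\<rho> (ket x)))) has_sum T) UNIV"
  shows "\<rho> \<in> pos_trace_class B" "tr \<rho> = T"
proof -
  have "((\<lambda>x. of_real (Re (cinner (ket x) (\<rho> (ket x))))) has_sum (of_real T :: complex)) UNIV"
    using assms(3) by (rule has_sum_of_real)
  then have *: "((\<lambda>x. cinner (ket x) (\<rho> (ket x))) has_sum (of_real T)) UNIV"
    unfolding positiveD[OF assms(2), symmetric] .
  then show "\<rho> \<in> pos_trace_class B"
    using assms unfolding pos_trace_class_def has_sum_iff by auto
  show "tr \<rho> = T"
    unfolding tr_def infsumI[OF *] by simp
qed

lemma tr_nonneg: "\<rho> \<in> pos_trace_class B \<Longrightarrow> 0 \<le> tr \<rho>"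
  by (rule has_sum_nonneg[OF ptc_tr_has_sum]) (auto intro: positive_ge_0 ptc_positive)

lemma ptc_0 [simp]: "0 \<in> pos_trace_class B"
  using ptcI[of B 0 0] by (auto simp: op_on_0)

lemma tr_0 [simp]: "tr 0 = 0"
  by (simp add: tr_def)

lemma
  assumes "\<rho> \<in> pos_trace_class B" "\<rho>' \<in> pos_trace_class B"
  shows ptc_add: "\<rho> + \<rho>' \<in> pos_trace_class B" and tr_add: "tr (\<rho> + \<rho>') = tr \<rho> + tr \<rho>'"
proof -
  have "((\<lambda>x. Re (cinner (ket x) ((\<rho> + \<rho>') (ket x)))) has_sum (tr \<rho> + tr \<rho>')) UNIV"
    using has_sum_add[OF ptc_tr_has_sum[OF assms(1)] ptc_tr_has_sum[OF assms(2)]]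
    by (simp add: blinfun.bilinear_simps cinner_simps)
  from ptcI[OF _ _ this, of B] assms
  show "\<rho> + \<rho>' \<in> pos_trace_class B" "tr (\<rho> + \<rho>') = tr \<rho> + tr \<rho>'"
    by (auto simp: op_on_add positive_add ptc_op_on ptc_positive)
qed

lemma
  assumes "\<rho> \<in> pos_trace_class B" "0 \<le> r"
  shows ptc_scaleR: "r *\<^sub>R \<rho> \<in> pos_trace_class B" and tr_scaleR: "tr (r *\<^sub>R \<rho>) = r * tr \<rho>"
proof -
  have "((\<lambda>x. Re (cinner (ket x) ((r *\<^sub>R \<rho>) (ket x)))) has_sum (r * tr \<rho>)) UNIV"
    using has_sum_cmult_right[OF ptc_tr_has_sum[OF assms(1)]]
    by (simp add: blinfun.bilinear_simps cinner_simps)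
  from ptcI[OF _ _ this, of B] assms
  show "r *\<^sub>R \<rho> \<in> pos_trace_class B" "tr (r *\<^sub>R \<rho>) = r * tr \<rho>"
    by (auto simp: op_on_scaleR positive_scaleR ptc_op_on ptc_positive)
qed

lemma ptc_sum: "(\<And>i. i \<in> F \<Longrightarrow> \<rho> i \<in> pos_trace_class B) \<Longrightarrow> sum \<rho> F \<in> pos_trace_class B"
  by (induction F rule: infinite_finite_induct) (auto simp: ptc_add)

lemma tr_sum: "(\<And>i. i \<in> F \<Longrightarrow> \<rho> i \<in> pos_trace_class B) \<Longrightarrow> tr (sum \<rho> F) = (\<Sum>i\<in>F. tr (\<rho> i))"
proof (induction F rule: infinite_finite_induct)
  case (insert i F)
  then show ?case
    using tr_add[of "\<rho> i" B "sum \<rho> F"] ptc_sum[of F \<rho> B] by auto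
qed simp_all

lemma
  assumes "restr B w = w"
  shows butter_ptc: "butter w \<in> pos_trace_class B" and tr_butter: "tr (butter w) = (norm w)\<^sup>2"
proof -
  have "((\<lambda>x. Re (cinner (ket x) (butter w (ket x)))) has_sum (norm w)\<^sup>2) UNIV"
    using norm_ell2_square[of w] unfolding cinner_butter cinner_ket[symmetric] cinner_commute[of "ket _"] by simp
  from ptcI[OF op_on_butter[OF assms] positive_butter this]
  show "butter w \<in> pos_trace_class B" "tr (butter w) = (norm w)\<^sup>2" .
qed

text \<open>Cholesky factorisation along an enumeration of the kets that \<open>\<rho>\<close> does not annihilate: after
  step \<open>n\<close> the remainder annihilates the first \<open>n\<close> of them, so every matrix entry is exhausted after
  finitely many steps.\<close>

lemma ptc_decomposition:
  assumes \<rho>: "\<rho> \<in> pos_trace_class B"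
  obtains w :: "nat \<Rightarrow> 'a ell2" where "\<And>k. restr B (w k) = w k"
    "((\<lambda>k. (norm (w k))\<^sup>2) has_sum tr \<rho>) UNIV" "((\<lambda>k. butter (w k)) has_sum \<rho>) UNIV"
proof -
  have "countable {x \<in> UNIV. cinner (ket x) (\<rho> (ket x)) \<noteq> 0}"
    using \<rho> by (intro summable_countable_complex) (auto simp: pos_trace_class_def)
  \<comment> \<open>Only an inclusion: the set is empty for the zero operator.\<close>
  then obtain e :: "nat \<Rightarrow> 'a" where e: "{x. cinner (ket x) (\<rho> (ket x)) \<noteq> 0} \<subseteq> range e"
    by (metis (no_types, lifting) Collect_cong UNIV_I empty_subsetI range_from_nat_into subset_refl)
  define R where "R = rec_nat \<rho> (\<lambda>k A. A - butter (pivot A (e k)))"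
  define w where "w k = pivot (R k) (e k)" for k
  have R0: "R 0 = \<rho>" and RS: "R (Suc k) = R k - butter (w k)" for k
    by (simp_all add: R_def w_def)
  have R: "op_on B (R k) \<and> positive (R k)" for k
    by (induction k)
      (use \<rho> in \<open>auto simp: R0 RS w_def ptc_op_on ptc_positive intro!: cholesky_step\<close>)
  have w: "restr B (w k) = w k" for k
    unfolding w_def using R by (intro cholesky_step) auto
  have R_eq: "R n = \<rho> - (\<Sum>k<n. butter (w k))" for n
    by (induction n) (auto simp: R0 RS)
  have kill: "R n (ket (e j)) = 0" if "j < n" for j n
    using that
  proof (induction n)
    case (Suc n)
    then show ?case
      using R[of n] unfolding RS w_def
      by (cases "j = n") (auto intro: cholesky_step simp del: blinfun.diff_left)
  qed simp
  \<comment> \<open>A ket outside the enumeration has diagonal entry 0, and Cauchy-Schwarz makes its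
    whole column vanish from the start.\<close>
  have ev: "\<exists>N. \<forall>n\<ge>N. R n (ket x) = 0" for x
  proof (cases "x \<in> range e")
    case True
    then obtain j where "x = e j" by auto
    then show ?thesis
      using kill by (intro exI[of _ "Suc j"]) auto
  next
    case False
    with e have x0: "cinner (ket x) (\<rho> (ket x)) = 0"
      by blast
    have "\<rho> (ket x) = 0"
    proof (rule cinner_ext)
      fix z
      have "(cmod (cinner z (\<rho> (ket x))))\<^sup>2 \<le> Re (cinner z (\<rho> z)) * 0"
        using positive_cauchy_schwarz[OF op_on_clin[OF ptc_op_on[OF \<rho>]] ptc_positive[OF \<rho>], of z "ket x"] x0 by simp
      then show "cinner z (\<rho> (ket x)) = cinner z 0"
        by simp
    qed
    then have "R n (ket x) = 0" for n
      by (induction n)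
        (use R in \<open>auto simp: R0 RS w_def simp del: blinfun.diff_left intro: cholesky_step\<close>)
    then show ?thesis by auto
  qed
  have fin: "\<exists>N. \<rho> (ket x) = (\<Sum>k<N. butter (w k) (ket x)) \<and> (\<forall>k\<ge>N. butter (w k) (ket x) = 0)" for x
  proof -
    obtain N where N: "\<And>n. n \<ge> N \<Longrightarrow> R n (ket x) = 0"
      using ev by blast
    have "butter (w k) (ket x) = 0" if "k \<ge> N" for k
      using N[OF that] N[of "Suc k"] that by (simp add: RS blinfun.diff_left)
    moreover have "\<rho> (ket x) = (\<Sum>k<N. butter (w k) (ket x))"
      using N[of N] by (simp add: R_eq blinfun.diff_left blinfun.sum_left)
    ultimately show ?thesis by blast
  qed
  have sum_ket: "((\<lambda>k. butter (w k) (ket x)) has_sum \<rho> (ket x)) UNIV" for x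
  proof -
    obtain N where N: "\<rho> (ket x) = (\<Sum>k<N. butter (w k) (ket x))" "\<And>k. k \<ge> N \<Longrightarrow> butter (w k) (ket x) = 0"
      using fin by blast
    have "((\<lambda>k. butter (w k) (ket x)) has_sum \<rho> (ket x)) {..<N}"
      unfolding N(1) by (rule has_sum_finite) simp
    then show ?thesis
      by (rule has_sum_cong_neutral[THEN iffD1, rotated -1]) (auto simp: N(2) simp del: butter_apply)
  qed
  \<comment> \<open>The diagonal entry at x is the sum of the squared coordinates of all w_k at x;
    summing over x first along k and then along x, in either order, relates the trace to the
    norms.\<close>
  have "((\<lambda>k. (cmod (coord (w k) x))\<^sup>2) has_sum Re (cinner (ket x) (\<rho> (ket x)))) UNIV" for x
    using has_sum_Re[OF has_sum_bounded_linear[OF bounded_linear_cinner_right[of "ket x"] sum_ket[of x]]]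
    unfolding cinner_butter cinner_ket[symmetric] cinner_commute[of "ket _"] by simp
  from nonneg_has_sum_swap[OF this ptc_tr_has_sum[OF \<rho>] _ norm_ell2_square]
  have tr: "((\<lambda>k. (norm (w k))\<^sup>2) has_sum tr \<rho>) UNIV"
    by simp
  \<comment> \<open>So far the series converges only on each ket. \<open>norm_butter_le\<close>
    makes it converge in the operator norm, and its limit agrees with \<rho> on kets.\<close>
  have "(\<lambda>k. butter (w k)) summable_on UNIV"
    using Infinite_Sum.abs_summable_on_comparison_test'[OF has_sum_imp_summable[OF tr] norm_butter_le]
    by (rule Infinite_Sum.abs_summable_summable)
  then obtain \<rho>' where \<rho>': "((\<lambda>k. butter (w k)) has_sum \<rho>') UNIV"
    using has_sum_infsum by blast
  have "\<rho>' (ket x) = \<rho> (ket x)" for x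
    using has_sum_apply[OF \<rho>', of "ket x"] sum_ket[of x] by (rule has_sum_unique)
  then have "\<rho>' = \<rho>"
    using op_on_has_sum[OF \<rho>' op_on_butter[OF w]] ptc_op_on[OF \<rho>]
    by (intro clin_eq_on_kets) (auto intro: op_on_clin)
  with \<rho>' w tr show ?thesis
    by (intro that) auto
qed

text \<open>The rank-one series converges absolutely, with norms at most |w_k|^2. The bound turns
  summability of traces into summability of operators.\<close>

lemma norm_le_tr: 
  assumes "\<rho> \<in> pos_trace_class B"
  shows "norm \<rho> \<le> tr \<rho>"
proof -
  obtain w :: "nat \<Rightarrow> 'a ell2" where w: "((\<lambda>k. (norm (w k))\<^sup>2) has_sum tr \<rho>) UNIV" "((\<lambda>k. butter (w k)) has_sum \<rho>) UNIV"
    using ptc_decomposition[OF assms] by metis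
  have "(\<lambda>k. norm (butter (w k))) summable_on UNIV"
    using Infinite_Sum.abs_summable_on_comparison_test'[OF has_sum_imp_summable[OF w(1)] norm_butter_le] .
  then obtain n where n: "((\<lambda>k. norm (butter (w k))) has_sum n) UNIV"
    using has_sum_infsum by blast
  have "norm \<rho> \<le> n"
    using n w(2) by (rule norm_has_sum_bound)
  also have "n \<le> tr \<rho>"
    using n w(1) by (rule has_sum_mono) (rule norm_butter_le)
  finally show ?thesis .
qed

text \<open>Traces dominate norms, so summable traces give convergence in the operator norm. The
  trace of the limit follows by exchanging the sum over \<open>I\<close> with the diagonal
  sum.\<close>

lemma
  assumes "\<And>i. i \<in> I \<Longrightarrow> \<rho> i \<in> pos_trace_class B" "((\<lambda>i. tr (\<rho> i)) has_sum T) I"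
  shows ptc_has_sum: "(\<rho> has_sum infsum \<rho> I) I"
    and ptc_infsum: "infsum \<rho> I \<in> pos_trace_class B"
    and tr_infsum: "tr (infsum \<rho> I) = T"
proof -
  have "(\<lambda>i. norm (\<rho> i)) summable_on I"
    using Infinite_Sum.abs_summable_on_comparison_test'[OF has_sum_imp_summable[OF assms(2)]] norm_le_tr assms(1) by blast
  then show *: "(\<rho> has_sum infsum \<rho> I) I"
    using Infinite_Sum.abs_summable_summable has_sum_infsum by blast
  have "((\<lambda>i. Re (cinner (ket x) (\<rho> i (ket x)))) has_sum Re (cinner (ket x) (infsum \<rho> I (ket x)))) I" for x
    by (rule has_sum_Re[OF has_sum_cinner_apply[OF *]])
  then have "((\<lambda>x. Re (cinner (ket x) (infsum \<rho> I (ket x)))) has_sum T) UNIV"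
    by (intro nonneg_has_sum_swap[OF ptc_tr_has_sum assms(2)] positive_ge_0 ptc_positive)
      (use assms(1) in auto)
  from ptcI[OF _ _ this, of B]
  show "infsum \<rho> I \<in> pos_trace_class B" "tr (infsum \<rho> I) = T"
    using op_on_has_sum[OF *] positive_has_sum[OF *] assms(1) ptc_op_on ptc_positive by metis+
qed

lemma conj_op_butter: "clin A \<Longrightarrow> conj_op A (butter w) = butter (A w)"
  by (rule blinfun_eqI) (simp add: conj_op_def clinD cinner_adj_right)

lemma bounded_linear_conj_op: "bounded_linear (conj_op A)"
  unfolding conj_op_def[abs_def]
  by (intro bounded_linear_compose[OF bounded_bilinear.bounded_linear_left[OF bounded_bilinear_blinfun_compose]
        bounded_bilinear.bounded_linear_right[OF bounded_bilinear_blinfun_compose]])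

text \<open>Conjugation by \<open>A\<close> turns the decomposition \<open>w\<close> into
  \<open>A w\<close>, whose square norms remain summable because \<open>A\<close> is
  bounded.\<close>

lemma
  assumes \<rho>: "((\<lambda>k. butter (w k)) has_sum \<rho>) UNIV" "(\<lambda>k. (norm (w k))\<^sup>2) summable_on UNIV"
    and A: "op_on B A"
  shows conj_op_decomposition_ptc: "conj_op A \<rho> \<in> pos_trace_class B"
    and tr_conj_op_decomposition: "((\<lambda>k. (norm (A (w k)))\<^sup>2) has_sum tr (conj_op A \<rho>)) UNIV"
proof -
  have *: "((\<lambda>k. butter (A (w k))) has_sum conj_op A \<rho>) UNIV"
    using has_sum_bounded_linear[OF bounded_linear_conj_op[of A] \<rho>(1)] conj_op_butter[OF op_on_clin[OF A]] by simp
  have "(\<lambda>k. (norm A)\<^sup>2 * (norm (w k))\<^sup>2) summable_on UNIV"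
    using \<rho>(2) by (rule summable_on_cmult_right)
  then have "(\<lambda>k. (norm (A (w k)))\<^sup>2) summable_on UNIV"
    by (rule summable_on_comparison_test)
      (auto simp: power_mult_distrib[symmetric] intro!: power_mono norm_blinfun)
  then obtain T where T: "((\<lambda>k. (norm (A (w k)))\<^sup>2) has_sum T) UNIV"
    using has_sum_infsum by blast
  then have T': "((\<lambda>k. tr (butter (A (w k)))) has_sum T) UNIV"
    using tr_butter[of UNIV] by (simp add: tr_butter[OF op_on_restr_left[OF A]])
  have "infsum (\<lambda>k. butter (A (w k))) UNIV = conj_op A \<rho>"
    using * by (rule infsumI)
  with ptc_infsum[OF _ T', of B] tr_infsum[OF _ T', of B] T
  show "conj_op A \<rho> \<in> pos_trace_class B" "((\<lambda>k. (norm (A (w k)))\<^sup>2) has_sum tr (conj_op A \<rho>)) UNIV"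
    using butter_ptc[OF op_on_restr_left[OF A]] by auto
qed

lemma conj_op_ptc: "\<rho> \<in> pos_trace_class B \<Longrightarrow> op_on B A \<Longrightarrow> conj_op A \<rho> \<in> pos_trace_class B"
  using ptc_decomposition[of \<rho> B] conj_op_decomposition_ptc has_sum_imp_summable by metis

lemma tr_conj_op_le:
  assumes "\<rho> \<in> pos_trace_class B" "op_on B A" "\<And>x. norm (A x) \<le> norm x"
  shows "tr (conj_op A \<rho>) \<le> tr \<rho>"
proof -
  obtain w :: "nat \<Rightarrow> 'a ell2" where w: "((\<lambda>k. (norm (w k))\<^sup>2) has_sum tr \<rho>) UNIV" "((\<lambda>k. butter (w k)) has_sum \<rho>) UNIV"
    using ptc_decomposition[OF assms(1)] by metis
  show ?thesis
    using tr_conj_op_decomposition[OF w(2) has_sum_imp_summable[OF w(1)] assms(2)] w(1)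
    by (rule has_sum_mono) (use assms(3) in \<open>auto intro!: power_mono\<close>)
qed

text \<open>The completeness relation of a Kraus family, put as an identity of square norms. In this
  form it involves no adjoints, and it can be summed over slices and over rank-one terms.\<close>

definition kraus :: "'a set \<Rightarrow> 'i set \<Rightarrow> ('i \<Rightarrow> 'a op) \<Rightarrow> bool" where
  "kraus B I M \<longleftrightarrow> (\<forall>i\<in>I. op_on B (M i)) \<and>
    (\<forall>x. ((\<lambda>i. (norm (M i x))\<^sup>2) has_sum (norm (restr B x))\<^sup>2) I)"

text \<open>For one rank-one term the completeness relation distributes |w|^2 over the outcomes;
  summing over the decomposition and exchanging sums conserves the trace.\<close>

lemma kraus_tr:
  assumes "\<rho> \<in> pos_trace_class B" "kraus B I M"
  shows "((\<lambda>i. tr (conj_op (M i) \<rho>)) has_sum tr \<rho>) I"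
proof -
  obtain w :: "nat \<Rightarrow> 'a ell2" where w: "\<And>k. restr B (w k) = w k"
    "((\<lambda>k. (norm (w k))\<^sup>2) has_sum tr \<rho>) UNIV" "((\<lambda>k. butter (w k)) has_sum \<rho>) UNIV"
    using ptc_decomposition[OF assms(1)] by metis
  show ?thesis
  proof (rule nonneg_has_sum_swap)
    show "((\<lambda>i. (norm (M i (w k)))\<^sup>2) has_sum (norm (w k))\<^sup>2) I" for k
      using assms(2) w(1)[of k] unfolding kraus_def by metis
    show "((\<lambda>k. (norm (M i (w k)))\<^sup>2) has_sum tr (conj_op (M i) \<rho>)) UNIV" if "i \<in> I" for i
      using tr_conj_op_decomposition[OF w(3) has_sum_imp_summable[OF w(2)]] assms(2) that
      by (auto simp: kraus_def)
  qed (use w in auto)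
qed

text \<open>Both series are iterated sums of one family over pairs (k, x), absolutely summable
  because |a b| is at most |a|^2 + |b|^2. The common limit \<open>s\<close> supplies the summability
  of the diagonal of \<open>A o\<^sub>L \<rho>\<close> as well, whose entries may have any sign or
  phase.\<close>

lemma tr_compose_decomposition:
  fixes w :: "'i \<Rightarrow> 'a ell2"
  assumes \<rho>: "((\<lambda>k. butter (w k)) has_sum \<rho>) UNIV" "(\<lambda>k. (norm (w k))\<^sup>2) summable_on UNIV"
    and A: "clin A"
  obtains s where "((\<lambda>x. cinner (ket x) ((A o\<^sub>L \<rho>) (ket x))) has_sum s) UNIV"
    "((\<lambda>k. cinner (w k) (A (w k))) has_sum s) UNIV"
proof -
  define f where "f = (\<lambda>(k, x). cnj (coord (w k) x) * coord (A (w k)) x)"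
  have "(\<lambda>k. (norm A)\<^sup>2 * (norm (w k))\<^sup>2) summable_on UNIV"
    using \<rho>(2) by (rule summable_on_cmult_right)
  then have "(\<lambda>k. (norm (A (w k)))\<^sup>2) summable_on UNIV"
    by (rule summable_on_comparison_test)
      (auto simp: power_mult_distrib[symmetric] intro!: power_mono norm_blinfun)
  with \<rho>(2) have "(\<lambda>k. (norm (w k))\<^sup>2 + (norm (A (w k)))\<^sup>2) summable_on UNIV"
    by (rule summable_on_add)
  then have "(\<lambda>(k, x). (cmod (coord (w k) x))\<^sup>2 + (cmod (coord (A (w k)) x))\<^sup>2) summable_on (UNIV \<times> UNIV)"
    by (intro summable_on_SigmaI[where g = "\<lambda>k. (norm (w k))\<^sup>2 + (norm (A (w k)))\<^sup>2"])
      (auto intro!: has_sum_add norm_ell2_square)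
  then have "(\<lambda>p. norm (f p)) summable_on (UNIV \<times> UNIV)"
  proof (rule Infinite_Sum.abs_summable_on_comparison_test')
    fix p :: "'i \<times> 'a"
    obtain k x where p: "p = (k, x)" by force
    show "norm (f p) \<le> (case p of (k, x) \<Rightarrow> (cmod (coord (w k) x))\<^sup>2 + (cmod (coord (A (w k)) x))\<^sup>2)"
      using sum_squares_bound[of "cmod (coord (w k) x)" "cmod (coord (A (w k)) x)"]
        mult_nonneg_nonneg[OF norm_ge_zero[of "coord (w k) x"] norm_ge_zero[of "coord (A (w k)) x"]]
      unfolding p f_def prod.case norm_mult complex_mod_cnj by linarith
  qed
  from has_sum_infsum[OF Infinite_Sum.abs_summable_summable[OF this]]
  obtain s where s: "(f has_sum s) (UNIV \<times> UNIV)"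
    by blast
  show ?thesis
  proof (rule that)
    show "((\<lambda>k. cinner (w k) (A (w k))) has_sum s) UNIV"
      using s by (rule has_sum_SigmaD) (simp add: f_def cinner_has_sum)
    have "((\<lambda>(x, k). f (k, x)) has_sum s) (UNIV \<times> UNIV)"
      using s by (subst (asm) has_sum_swap)
    then show "((\<lambda>x. cinner (ket x) ((A o\<^sub>L \<rho>) (ket x))) has_sum s) UNIV"
    proof (rule has_sum_SigmaD)
      fix x
      have "((\<lambda>k. cinner (ket x) (A (butter (w k) (ket x)))) has_sum cinner (ket x) (A (\<rho> (ket x)))) UNIV"
        using has_sum_bounded_linear[OF bounded_linear_compose[OF bounded_linear_cinner_right
              blinfun.bounded_linear_right] has_sum_apply[OF \<rho>(1)]] .
      then show "((\<lambda>y. case (x, y) of (x, k) \<Rightarrow> f (k, x)) has_sum cinner (ket x) ((A o\<^sub>L \<rho>) (ket x))) UNIV"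
        unfolding f_def prod.case butter_apply clinD[OF A] cinner_scaleC_right cinner_ket
          cinner_ket_right blinfun_apply_blinfun_compose .
    qed
  qed
qed

text \<open>Denotations are controlled on partial states only, so additivity is asked when the sum
  is again a partial state, and scaling for factors up to 1. The codomain is general so as to cover
  functionals, state maps and pairs of a state and an error.\<close>

definition ps_linear :: "'a set \<Rightarrow> ('a op \<Rightarrow> 'b::real_vector) \<Rightarrow> bool" where
  "ps_linear B f \<longleftrightarrow>
    (\<forall>\<rho>\<in>partial_states B. \<forall>\<rho>'\<in>partial_states B. \<rho> + \<rho>' \<in> partial_states B \<longrightarrow> f (\<rho> + \<rho>') = f \<rho> + f \<rho>') \<and>
    (\<forall>\<rho>\<in>partial_states B. \<forall>t\<in>{0..1}. f (t *\<^sub>R \<rho>) = t *\<^sub>R f \<rho>)"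

definition ps_functional :: "'a set \<Rightarrow> real \<Rightarrow> ('a op \<Rightarrow> real) \<Rightarrow> bool" where
  "ps_functional B K f \<longleftrightarrow> ps_linear B f \<and> (\<forall>\<rho>\<in>partial_states B. 0 \<le> f \<rho> \<and> f \<rho> \<le> K * tr \<rho>)"

lemma ps_iff: "\<rho> \<in> partial_states B \<longleftrightarrow> \<rho> \<in> pos_trace_class B \<and> tr \<rho> \<le> 1"
  by (auto simp: partial_states_def)

lemma ps_0 [simp]: "0 \<in> partial_states B"
  by (simp add: ps_iff)

lemma ps_linear_0: "ps_linear B f \<Longrightarrow> f 0 = 0"
  unfolding ps_linear_def using ps_0[of B] by (metis add_cancel_right_right add.right_neutral)

lemma ps_linear_add: "ps_linear B f \<Longrightarrow> \<rho> \<in> pos_trace_class B \<Longrightarrow> \<rho>' \<in> pos_trace_class B \<Longrightarrow>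
    tr \<rho> + tr \<rho>' \<le> 1 \<Longrightarrow> f (\<rho> + \<rho>') = f \<rho> + f \<rho>'"
  using tr_nonneg[of \<rho> B] tr_nonneg[of \<rho>' B] ptc_add[of \<rho> B \<rho>'] tr_add[of \<rho> B \<rho>']
  unfolding ps_linear_def by (auto simp: ps_iff)

lemma ps_linear_scaleR: "ps_linear B f \<Longrightarrow> \<rho> \<in> partial_states B \<Longrightarrow> 0 \<le> t \<Longrightarrow> t \<le> 1 \<Longrightarrow> f (t *\<^sub>R \<rho>) = t *\<^sub>R f \<rho>"
  unfolding ps_linear_def by auto

lemma ps_linear_sum:
  assumes "ps_linear B f" "finite F" "\<And>i. i \<in> F \<Longrightarrow> \<rho> i \<in> pos_trace_class B" "(\<Sum>i\<in>F. tr (\<rho> i)) \<le> 1"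
  shows "f (sum \<rho> F) = (\<Sum>i\<in>F. f (\<rho> i))"
  using assms(2-4)
proof (induction F rule: finite_induct)
  case (insert i F)
  then have "(\<Sum>i\<in>F. tr (\<rho> i)) \<le> 1"
    using tr_nonneg[of "\<rho> i" B] by simp
  then have IH: "f (sum \<rho> F) = (\<Sum>i\<in>F. f (\<rho> i))"
    using insert by auto
  have "f (\<rho> i + sum \<rho> F) = f (\<rho> i) + f (sum \<rho> F)"
    using insert tr_sum[of F \<rho> B] by (intro ps_linear_add[OF assms(1)] ptc_sum) auto
  with IH insert show ?case
    by simp
qed (simp add: ps_linear_0[OF assms(1)])

text \<open>Additivity splits off a finite part. The value on the rest lies between 0 and
  \<open>K\<close> times the tail of the trace series, which tends to 0.\<close>

lemma ps_functional_has_sum: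
  assumes f: "ps_functional B K f"
    and \<rho>: "\<And>i. i \<in> I \<Longrightarrow> \<rho> i \<in> pos_trace_class B" and T: "((\<lambda>i. tr (\<rho> i)) has_sum T) I" "T \<le> 1"
  shows "((\<lambda>i. f (\<rho> i)) has_sum f (infsum \<rho> I)) I"
proof -
  note f' = f[unfolded ps_functional_def]
  have R: "(\<rho> has_sum infsum \<rho> I) I" "infsum \<rho> I \<in> pos_trace_class B" "tr (infsum \<rho> I) = T"
    using ptc_has_sum[OF _ T(1)] ptc_infsum[OF _ T(1)] tr_infsum[OF _ T(1)] \<rho> by blast+
  have bound: "norm (f (infsum \<rho> I) - (\<Sum>i\<in>F. f (\<rho> i))) \<le> K * (T - (\<Sum>i\<in>F. tr (\<rho> i)))"
    if F: "finite F" "F \<subseteq> I" for F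
  proof -
    let ?S = "sum \<rho> F" and ?R = "infsum \<rho> (I - F)"
    have Tr: "((\<lambda>i. tr (\<rho> i)) has_sum (T - (\<Sum>i\<in>F. tr (\<rho> i)))) (I - F)"
      using T(1) has_sum_finite[OF F(1)] F(2) by (rule has_sum_Diff)
    have R': "?R \<in> pos_trace_class B" "tr ?R = T - (\<Sum>i\<in>F. tr (\<rho> i))"
      using ptc_infsum[OF _ Tr, of B] tr_infsum[OF _ Tr, of B] \<rho> by auto
    have S: "?S \<in> pos_trace_class B" "tr ?S = (\<Sum>i\<in>F. tr (\<rho> i))"
      using \<rho> F by (auto intro!: ptc_sum tr_sum)
    have "infsum \<rho> I = ?S + ?R"
      using has_sum_Diff[OF R(1) has_sum_finite[OF F(1)] F(2), THEN infsumI] by simp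
    then have "f (infsum \<rho> I) = f ?S + f ?R"
      using ps_linear_add[of B f ?S ?R] f' S R' T(2) by simp
    moreover have "f ?S = (\<Sum>i\<in>F. f (\<rho> i))"
      using f' F \<rho> S R' tr_nonneg[OF R'(1)] T(2) by (intro ps_linear_sum[of B]) auto
    moreover have "?R \<in> partial_states B"
      using R' S T(2) tr_nonneg[OF S(1)] by (simp add: ps_iff)
    then have "0 \<le> f ?R" "f ?R \<le> K * tr ?R"
      using f' by auto
    ultimately show ?thesis
      using R' by simp
  qed
  have "((\<lambda>F. K * (T - (\<Sum>i\<in>F. tr (\<rho> i)))) \<longlongrightarrow> K * (T - T)) (finite_subsets_at_top I)"
    using T(1) unfolding has_sum_def by (intro tendsto_intros)
  then have "((\<lambda>F. K * (T - (\<Sum>i\<in>F. tr (\<rho> i)))) \<longlongrightarrow> 0) (finite_subsets_at_top I)"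
    by simp
  then have "((\<lambda>F. f (infsum \<rho> I) - (\<Sum>i\<in>F. f (\<rho> i))) \<longlongrightarrow> 0) (finite_subsets_at_top I)"
    by (rule Lim_null_comparison[rotated]) (intro eventually_finite_subsets_at_top_weakI bound)
  then have "((\<lambda>F. f (infsum \<rho> I) - (f (infsum \<rho> I) - (\<Sum>i\<in>F. f (\<rho> i)))) \<longlongrightarrow> f (infsum \<rho> I) - 0) (finite_subsets_at_top I)"
    by (intro tendsto_intros)
  then show ?thesis
    unfolding has_sum_def by simp
qed

section \<open>Functionals on partial states are predicates\<close>

lemma tr_compose_has_sum:
  assumes "\<rho> \<in> pos_trace_class B" "clin A"
  shows "((\<lambda>x. Re (cinner (ket x) ((A o\<^sub>L \<rho>) (ket x)))) has_sum tr (A o\<^sub>L \<rho>)) UNIV"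
proof -
  obtain w :: "nat \<Rightarrow> 'a ell2" where w: "((\<lambda>k. (norm (w k))\<^sup>2) has_sum tr \<rho>) UNIV" "((\<lambda>k. butter (w k)) has_sum \<rho>) UNIV"
    using ptc_decomposition[OF assms(1)] by metis
  obtain s where s: "((\<lambda>x. cinner (ket x) ((A o\<^sub>L \<rho>) (ket x))) has_sum s) UNIV"
    using tr_compose_decomposition[OF w(2) has_sum_imp_summable[OF w(1)] assms(2)] by metis
  then show ?thesis
    unfolding tr_def infsumI[OF s] by (rule has_sum_Re)
qed

lemma tr_compose_eq:
  assumes "((\<lambda>k. butter (w k)) has_sum \<rho>) UNIV" "(\<lambda>k. (norm (w k))\<^sup>2) summable_on UNIV" "clin A"
  shows "((\<lambda>k. Re (cinner (w k) (A (w k)))) has_sum tr (A o\<^sub>L \<rho>)) UNIV"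
proof -
  obtain s where s: "((\<lambda>x. cinner (ket x) ((A o\<^sub>L \<rho>) (ket x))) has_sum s) UNIV"
    "((\<lambda>k. cinner (w k) (A (w k))) has_sum s) UNIV"
    using tr_compose_decomposition[OF assms] by metis
  show ?thesis
    unfolding tr_def infsumI[OF s(1)] using s(2) by (rule has_sum_Re)
qed

text \<open>Lets results about families be used for a single operator, taken as a family over
  \<open>unit\<close>.\<close>

lemma has_sum_unit_iff: "((\<lambda>_::unit. a) has_sum b) UNIV \<longleftrightarrow> a = (b :: 'b :: {topological_comm_monoid_add, t2_space})"
  using has_sum_finite[of "UNIV :: unit set" "\<lambda>_. a"] has_sum_unique[of "\<lambda>_::unit. a"] by (auto simp: UNIV_unit)

lemma tr_compose_butter: "clin A \<Longrightarrow> tr (A o\<^sub>L butter w) = Re (cinner w (A w))"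
  using tr_compose_eq[of "\<lambda>_::unit. w" "butter w" A] by (simp add: has_sum_unit_iff)

lemma predicatesD:
  assumes "P \<in> predicates B"
  shows "op_on B P" "positive P" "positive (idop B - P)"
  using assms by (auto simp: predicates_def loewner_def)

text \<open>Additivity is read off the diagonal in the kets. The bounds are not, as diagonal entries
  of \<open>P o\<^sub>L \<rho>\<close> can be negative; they come from the vectors of the
  decomposition, where 0 \<le> <w, P w> \<le> |w|^2.\<close>

lemma ps_functional_predicate:
  assumes P: "P \<in> predicates B"
  shows "ps_functional B 1 (\<lambda>\<rho>. tr (P o\<^sub>L \<rho>))"
  unfolding ps_functional_def ps_linear_def
proof (intro conjI ballI impI)
  note P = predicatesD[OF P]
  have clin: "clin P"
    using P(1) by (rule op_on_clin)
  fix \<rho> assume "\<rho> \<in> partial_states B"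
  then have \<rho>: "\<rho> \<in> pos_trace_class B"
    by (simp add: ps_iff)
  note sum = tr_compose_has_sum[OF _ clin]
  show "tr (P o\<^sub>L (\<rho> + \<rho>')) = tr (P o\<^sub>L \<rho>) + tr (P o\<^sub>L \<rho>')" if "\<rho>' \<in> partial_states B" for \<rho>'
  proof -
    have \<rho>': "\<rho>' \<in> pos_trace_class B"
      using that by (simp add: ps_iff)
    show ?thesis
      using sum[OF ptc_add[OF \<rho> \<rho>']] has_sum_add[OF sum[OF \<rho>] sum[OF \<rho>']]
      by (simp add: blinfun.bilinear_simps cinner_simps has_sum_unique)
  qed
  show "tr (P o\<^sub>L (t *\<^sub>R \<rho>)) = t *\<^sub>R tr (P o\<^sub>L \<rho>)" if "t \<in> {0..1}" for t
    using sum[OF ptc_scaleR[OF \<rho>, of t]] has_sum_cmult_right[OF sum[OF \<rho>], of t] that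
    by (simp add: blinfun.bilinear_simps cinner_simps has_sum_unique)
  obtain w :: "nat \<Rightarrow> 'a ell2" where w: "\<And>k. restr B (w k) = w k"
      "((\<lambda>k. (norm (w k))\<^sup>2) has_sum tr \<rho>) UNIV" "((\<lambda>k. butter (w k)) has_sum \<rho>) UNIV"
    using ptc_decomposition[OF \<rho>] by metis
  have s: "((\<lambda>k. Re (cinner (w k) (P (w k)))) has_sum tr (P o\<^sub>L \<rho>)) UNIV"
    by (rule tr_compose_eq[OF w(3) has_sum_imp_summable[OF w(2)] clin])
  show "0 \<le> tr (P o\<^sub>L \<rho>)"
    using s by (rule has_sum_nonneg) (rule positive_ge_0[OF P(2)])
  have "tr (P o\<^sub>L \<rho>) \<le> tr \<rho>"
    using s w(2)
  proof (rule has_sum_mono)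
    fix k
    show "Re (cinner (w k) (P (w k))) \<le> (norm (w k))\<^sup>2"
      using positive_ge_0[OF P(3), of "w k"] w(1)[of k] cinner_self[of "w k"]
      by (simp add: blinfun.bilinear_simps cinner_simps)
  qed
  then show "tr (P o\<^sub>L \<rho>) \<le> 1 * tr \<rho>"
    by simp
qed

lemma idop_compose: "op_on B A \<Longrightarrow> idop B o\<^sub>L A = A"
  by (rule blinfun_eqI) (simp add: op_on_restr_left)

lemma idop_predicate: "idop B \<in> predicates B"
  by (simp add: predicates_def op_on_idop loewner_def positive_def cinner_restr_self del: of_real_power)

text \<open>The homogeneous extension of a functional from partial states to all positive trace
  class operators. It is needed because the parallelogram law involves rank-one operators of
  arbitrary trace. The divisor 1 + tr \<rho> is positive even for \<rho> = 0.\<close>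

definition cone_ext :: "('a op \<Rightarrow> real) \<Rightarrow> 'a op \<Rightarrow> real" where
  "cone_ext f \<rho> = (1 + tr \<rho>) * f ((1 / (1 + tr \<rho>)) *\<^sub>R \<rho>)"

lemma ptc_scaled_ps: "\<rho> \<in> pos_trace_class B \<Longrightarrow> 0 < c \<Longrightarrow> tr \<rho> \<le> c \<Longrightarrow> (1 / c) *\<^sub>R \<rho> \<in> partial_states B"
  by (simp add: ps_iff ptc_scaleR tr_scaleR)

text \<open>By homogeneity every constant dominating the trace gives the same value, so two
  operators and their sum can be scaled by a common constant.\<close>

lemma cone_ext_eq:
  assumes f: "ps_linear B f" and \<rho>: "\<rho> \<in> pos_trace_class B" and c: "0 < c" "tr \<rho> \<le> c"
  shows "cone_ext f \<rho> = c * f ((1 / c) *\<^sub>R \<rho>)"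
proof -
  have le: "c * f ((1 / c) *\<^sub>R \<rho>) = d * f ((1 / d) *\<^sub>R \<rho>)" if "0 < c" "tr \<rho> \<le> c" "c \<le> d" for c d
  proof -
    have "(1 / d) *\<^sub>R \<rho> = (c / d) *\<^sub>R ((1 / c) *\<^sub>R \<rho>)"
      using that by simp
    also have "f \<dots> = (c / d) *\<^sub>R f ((1 / c) *\<^sub>R \<rho>)"
      using that by (intro ps_linear_scaleR[OF f] ptc_scaled_ps[OF \<rho>]) auto
    finally show ?thesis
      using that by simp
  qed
  have "0 \<le> tr \<rho>"
    using \<rho> by (rule tr_nonneg)
  then have "0 < 1 + tr \<rho>" "tr \<rho> \<le> 1 + tr \<rho>"
    by auto
  then show ?thesis
    unfolding cone_ext_def using le[OF c, of "1 + tr \<rho>"] le[of "1 + tr \<rho>" c]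
    by (cases "c \<le> 1 + tr \<rho>") (simp_all only: not_le less_imp_le)
qed

lemma
  assumes f: "ps_linear B f" and \<rho>: "\<rho> \<in> pos_trace_class B"
  shows cone_ext_add: "\<rho>' \<in> pos_trace_class B \<Longrightarrow> cone_ext f (\<rho> + \<rho>') = cone_ext f \<rho> + cone_ext f \<rho>'"
    and cone_ext_scaleR: "0 \<le> r \<Longrightarrow> cone_ext f (r *\<^sub>R \<rho>) = r * cone_ext f \<rho>"
    and cone_ext_ps: "tr \<rho> \<le> 1 \<Longrightarrow> cone_ext f \<rho> = f \<rho>"
proof -
  note ge = tr_nonneg[OF \<rho>]
  show "cone_ext f (\<rho> + \<rho>') = cone_ext f \<rho> + cone_ext f \<rho>'" if \<rho>': "\<rho>' \<in> pos_trace_class B"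
  proof -
    define c where "c = 1 + tr \<rho> + tr \<rho>'"
    have c: "0 < c" "tr \<rho> \<le> c" "tr \<rho>' \<le> c" "tr (\<rho> + \<rho>') \<le> c" "tr \<rho> + tr \<rho>' \<le> c"
      using ge tr_nonneg[OF \<rho>'] by (auto simp: c_def tr_add[OF \<rho> \<rho>'])
    have "f ((1 / c) *\<^sub>R \<rho> + (1 / c) *\<^sub>R \<rho>') = f ((1 / c) *\<^sub>R \<rho>) + f ((1 / c) *\<^sub>R \<rho>')"
      using \<rho> \<rho>' c by (intro ps_linear_add[OF f])
        (auto simp: ptc_scaleR tr_scaleR[of _ B] add_divide_distrib[symmetric])
    then show ?thesis
      using cone_ext_eq[OF f \<rho>, of c] cone_ext_eq[OF f \<rho>', of c] cone_ext_eq[OF f ptc_add[OF \<rho> \<rho>'], of c] c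
      by (simp add: scaleR_add_right distrib_left)
  qed
  show "cone_ext f (r *\<^sub>R \<rho>) = r * cone_ext f \<rho>" if "0 \<le> r"
  proof (cases "r = 0")
    case True
    then show ?thesis by (simp add: cone_ext_def ps_linear_0[OF f])
  next
    case False
    with that have "0 < r" by simp
    then show ?thesis
      using cone_ext_eq[OF f ptc_scaleR[OF \<rho> that], of "r * (1 + tr \<rho>)"] ge
      by (simp add: tr_scaleR[OF \<rho>] cone_ext_def)
  qed
  show "cone_ext f \<rho> = f \<rho>" if "tr \<rho> \<le> 1"
    using cone_ext_eq[OF f \<rho>, of 1] that by simp
qed

lemma cone_ext_bounds:
  assumes f: "ps_functional B 1 f" and \<rho>: "\<rho> \<in> pos_trace_class B"
  shows "0 \<le> cone_ext f \<rho>" "cone_ext f \<rho> \<le> tr \<rho>"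
proof -
  note ge = tr_nonneg[OF \<rho>]
  have "(1 / (1 + tr \<rho>)) *\<^sub>R \<rho> \<in> partial_states B"
    using ge by (intro ptc_scaled_ps[OF \<rho>]) auto
  then have "0 \<le> f ((1 / (1 + tr \<rho>)) *\<^sub>R \<rho>)" "f ((1 / (1 + tr \<rho>)) *\<^sub>R \<rho>) \<le> tr \<rho> / (1 + tr \<rho>)"
    using f ge unfolding ps_functional_def by (auto simp: tr_scaleR[OF \<rho>])
  then show "0 \<le> cone_ext f \<rho>" "cone_ext f \<rho> \<le> tr \<rho>"
    unfolding cone_ext_def using ge by (auto simp: field_simps)
qed

lemma butter_scaleC: "butter (c *\<^sub>C x) = (cmod c)\<^sup>2 *\<^sub>R butter x"
  by (rule blinfun_eqI) 
    (simp add: blinfun.bilinear_simps cinner_simps scaleC_simps scaleR_scaleC complex_norm_square 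
      mult_ac del: of_real_power)

lemma butter_parallelogram: "butter (x + y) + butter (x - y) = 2 *\<^sub>R butter x + 2 *\<^sub>R butter y"
  by (rule blinfun_eqI, rule ell2_eqI) (simp add: blinfun.bilinear_simps cinner_simps algebra_simps)

text \<open>Both sides equal (t^2 + t) |x><x| + (1 + t) |y><y|. For t \<ge> 0 only nonnegative
  coefficients occur, so a functional on the cone can be applied; this gives real homogeneity of the
  polar form directly, with no approximation by rational factors.\<close>

lemma butter_homogeneity:
  "butter (t *\<^sub>R x + y) + t *\<^sub>R butter (x - y) = butter (t *\<^sub>R x - y) + t *\<^sub>R butter (x + y)"
  by (rule blinfun_eqI, rule ell2_eqI) (simp add: blinfun.bilinear_simps cinner_simps algebra_simps)

text \<open>The quadratic form \<open>q(x) = f(|x\<rangle>\<langle>x|)\<close> satisfies the parallelogram law because \<open>f\<close> is additive,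
  so polarisation yields a bounded sesquilinear form.\<close>

lemma ps_functional_representation:
  assumes f: "ps_functional B 1 f"
  obtains Q where "Q \<in> predicates B" "\<And>\<rho>. \<rho> \<in> partial_states B \<Longrightarrow> tr (Q o\<^sub>L \<rho>) = f \<rho>"
proof -
  have lin: "ps_linear B f"
    using f by (simp add: ps_functional_def)
  define q where "q x = cone_ext f (butter (restr B x))" for x
  have ptc: "butter (restr B x) \<in> pos_trace_class B" for x
    by (rule butter_ptc) simp
  have q_ge: "0 \<le> q x" and q_le: "q x \<le> (norm (restr B x))\<^sup>2" for x
    using cone_ext_bounds[OF f ptc, of x] by (simp_all add: q_def tr_butter[of B])
  have q_le': "q x \<le> (norm x)\<^sup>2" for x
    using q_le[of x] power_mono[OF norm_restr_le[of B x] norm_ge_zero, of 2] by (rule order_trans)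
  have q_scale: "q (c *\<^sub>C x) = (cmod c)\<^sup>2 * q x" for c x
    by (simp add: q_def restr_scaleC butter_scaleC cone_ext_scaleR[OF lin ptc])
  have q_par: "q (x + y) + q (x - y) = 2 * q x + 2 * q y" for x y
  proof -
    have "q (x + y) + q (x - y) = cone_ext f (butter (restr B (x + y)) + butter (restr B (x - y)))"
      by (simp only: q_def cone_ext_add[OF lin ptc ptc])
    also have "\<dots> = cone_ext f (2 *\<^sub>R butter (restr B x) + 2 *\<^sub>R butter (restr B y))"
      by (simp only: restr_add restr_diff butter_parallelogram)
    also have "\<dots> = 2 * q x + 2 * q y"
      by (simp add: q_def cone_ext_add[OF lin] ptc_scaleR ptc cone_ext_scaleR[OF lin ptc])
    finally show ?thesis .
  qed
  have q_hom: "q (t *\<^sub>R x + y) + t * q (x - y) = q (t *\<^sub>R x - y) + t * q (x + y)" if "0 \<le> t" for t x y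
  proof -
    have "q (t *\<^sub>R x + y) + t * q (x - y) = 
        cone_ext f (butter (restr B (t *\<^sub>R x + y)) + t *\<^sub>R butter (restr B (x - y)))"
      using that by (simp only: q_def cone_ext_add[OF lin ptc ptc_scaleR[OF ptc]] cone_ext_scaleR[OF lin ptc])
    also have "\<dots> = cone_ext f (butter (restr B (t *\<^sub>R x - y)) + t *\<^sub>R butter (restr B (x + y)))"
      by (simp only: restr_add restr_diff restr_scaleR butter_homogeneity)
    also have "\<dots> = q (t *\<^sub>R x - y) + t * q (x + y)"
      using that by (simp only: q_def cone_ext_add[OF lin ptc ptc_scaleR[OF ptc]] cone_ext_scaleR[OF lin ptc])
    finally show ?thesis .
  qed
  have q_minus: "q (- x) = q x" and q_i: "q (\<i> *\<^sub>C x) = q x" for x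
    using q_scale[of "-1" x] q_scale[of \<i> x] by simp_all
  define b where "b x y = (q (x + y) - q (x - y)) / 4" for x y
  have b_sym: "b x y = b y x" for x y
    using q_minus[of "x - y"] by (simp add: b_def add.commute)
  have b_minus: "b (- x) y = - b x y" for x y
  proof -
    have "q (- x + y) = q (x - y)" "q (- x - y) = q (x + y)"
      using q_minus[of "x + y"] q_minus[of "x - y"] by (simp_all add: add.commute)
    then show ?thesis
      unfolding b_def by (simp only: minus_divide_left minus_diff_eq)
  qed
  have b_0: "b 0 y = 0" for y
    by (simp add: b_def q_minus)
  \<comment> \<open>Parallelogram laws around x + y and x - y; the contribution of x' cancels in
    their difference.\<close>
  have b_pair: "b (x + x') y + b (x - x') y = 2 * b x y" for x x' y
  proof -
    have e: "x + x' + y = x + y + x'" "x - x' + y = x + y - x'"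
      "x + x' - y = x - y + x'" "x - x' - y = x - y - x'"
      by (simp_all add: algebra_simps)
    have "\<And>a b c d p q r :: real. a + b = 2 * p + 2 * r \<Longrightarrow> c + d = 2 * q + 2 * r \<Longrightarrow>
        (a - c) / 4 + (b - d) / 4 = 2 * ((p - q) / 4)"
      by (simp add: field_simps)
    from this[OF q_par[of "x + y" x'] q_par[of "x - y" x']] show ?thesis
      unfolding b_def e .
  qed
  have b_double: "b (2 *\<^sub>R x) y = 2 * b x y" for x y
    using b_pair[of x x y] b_0[of y] by (simp add: scaleR_2)
  \<comment> \<open>u and v are the sum and the difference of (u + v)/2 and (u - v)/2, which turns
    the previous two identities into additivity.\<close>
  have b_add: "b (u + v) y = b u y + b v y" for u v y
  proof -
    have uv: "(1/2) *\<^sub>R (u + v) + (1/2) *\<^sub>R (u - v) = u" "(1/2) *\<^sub>R (u + v) - (1/2) *\<^sub>R (u - v) = v"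
      by (rule ell2_eqI; simp add: field_simps)+
    show ?thesis
      using b_pair[of "(1/2) *\<^sub>R (u + v)" "(1/2) *\<^sub>R (u - v)" y] b_double[of "(1/2) *\<^sub>R (u + v)" y]
      unfolding uv by simp
  qed
  have b_scaleR: "b (t *\<^sub>R x) y = t * b x y" for t x y
  proof -
    have pos: "b (t *\<^sub>R x) y = t * b x y" if "0 \<le> t" for t
    proof -
      have "q (t *\<^sub>R x + y) - q (t *\<^sub>R x - y) = t * (q (x + y) - q (x - y))"
        using q_hom[OF that, of x y] by (simp add: right_diff_distrib)
      then show ?thesis
        unfolding b_def by (simp only: times_divide_eq_right)
    qed
    show ?thesis
      using pos[of t] pos[of "- t"] b_minus[of "t *\<^sub>R x" y] by (cases "0 \<le> t") auto
  qed
  have b_add': "b x (u + v) = b x u + b x v" and b_scaleR': "b x (t *\<^sub>R u) = t * b x u" 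
    and b_minus': "b x (- u) = - b x u" for x u v t
    using b_add b_scaleR b_minus b_sym by metis+
  have b_ii: "b (\<i> *\<^sub>C x) (\<i> *\<^sub>C y) = b x y" for x y
    unfolding b_def scaleC_simps(1,3)[symmetric] q_i ..
  have b_i: "b (\<i> *\<^sub>C x) y = - b x (\<i> *\<^sub>C y)" for x y
  proof -
    have "b (\<i> *\<^sub>C x) y = b (\<i> *\<^sub>C x) (\<i> *\<^sub>C (- (\<i> *\<^sub>C y)))"
      by (rule arg_cong[where f = "b _"], rule ell2_eqI) (simp add: mult.assoc[symmetric])
    then show ?thesis
      unfolding b_ii b_minus' .
  qed
  have b_self: "b x x = q x" for x
  proof -
    have "x + x = 2 *\<^sub>C x"
      by (rule ell2_eqI) simp
    then show ?thesis
      using q_scale[of 2 x] q_scale[of 0 x] by (simp add: b_def)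
  qed
  have b_i_self: "b x (\<i> *\<^sub>C x) = 0" for x
    using b_i[of x x] b_sym[of "\<i> *\<^sub>C x" x] by simp
  have b_bound: "\<bar>b x y\<bar> \<le> norm x * norm y" for x y
  proof (cases "x = 0 \<or> y = 0")
    case True
    then show ?thesis
      using b_0[of y] b_0[of x] b_sym[of x 0] by auto
  next
    case False
    \<comment> \<open>On unit vectors the parallelogram law of the norm bounds the polar form by 1;
      homogeneity extends the bound.\<close>
    define x' y' where "x' = (1 / norm x) *\<^sub>R x" and "y' = (1 / norm y) *\<^sub>R y"
    have xy: "norm x' = 1" "norm y' = 1" "x = norm x *\<^sub>R x'" "y = norm y *\<^sub>R y'"
      using False by (simp_all add: x'_def y'_def)
    have "\<bar>q (x' + y') - q (x' - y')\<bar> \<le> (norm (x' + y'))\<^sup>2 + (norm (x' - y'))\<^sup>2"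
      using q_ge[of "x' + y'"] q_ge[of "x' - y'"] q_le'[of "x' + y'"] q_le'[of "x' - y'"] by linarith
    then have "\<bar>b x' y'\<bar> \<le> ((norm (x' + y'))\<^sup>2 + (norm (x' - y'))\<^sup>2) / 4"
      unfolding b_def abs_divide by (simp add: divide_right_mono)
    also have "(norm (x' + y'))\<^sup>2 + (norm (x' - y'))\<^sup>2 = 2 * (norm x')\<^sup>2 + 2 * (norm y')\<^sup>2"
      by (simp add: power2_norm_eq_inner inner_simps inner_commute)
    finally have "\<bar>b x' y'\<bar> \<le> 1"
      using xy by simp
    moreover have "b x y = norm x * norm y * b x' y'"
      by (subst xy(3), subst xy(4)) (simp only: b_scaleR b_scaleR' mult_ac)
    ultimately show ?thesis
      by (simp add: abs_mult mult_left_le)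
  qed
  \<comment> \<open>With \<open>b\<close> as the real part, linearity in the second argument forces
    Im S(x, y) = - Re S(x, \<i> y).\<close>
  define S where "S x y = Complex (b x y) (- b x (\<i> *\<^sub>C y))" for x y
  have b_scaleC: "b (c *\<^sub>C x) y = Re c * b x y - Im c * b x (\<i> *\<^sub>C y)" for c x y
  proof -
    have "c *\<^sub>C x = Re c *\<^sub>R x + Im c *\<^sub>R (\<i> *\<^sub>C x)"
    proof (rule ell2_eqI)
      fix i
      have "c = of_real (Re c) + of_real (Im c) * \<i>"
        by (simp add: complex_eq_iff)
      then have "c * coord x i = (of_real (Re c) + of_real (Im c) * \<i>) * coord x i"
        by simp
      then show "coord (c *\<^sub>C x) i = coord (Re c *\<^sub>R x + Im c *\<^sub>R (\<i> *\<^sub>C x)) i"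
        by (simp add: distrib_right mult.assoc)
    qed
    then show ?thesis
      by (simp add: b_add b_scaleR b_i)
  qed
  have b_scaleC': "b x (c *\<^sub>C y) = Re c * b x y + Im c * b x (\<i> *\<^sub>C y)" for c x y
    using b_scaleC[of c y x] b_i[of x y] b_sym by (metis add.inverse_inverse diff_minus_eq_add mult_minus_right)
  have i_i: "\<i> *\<^sub>C \<i> *\<^sub>C y = - y" for y :: "'a ell2"
    by (simp add: scaleC_simps(5))
  have b_ic: "b x (\<i> *\<^sub>C c *\<^sub>C y) = Re c * b x (\<i> *\<^sub>C y) - Im c * b x y" for x c y
  proof -
    have "\<i> *\<^sub>C c *\<^sub>C y = c *\<^sub>C \<i> *\<^sub>C y"
      by (simp only: scaleC_simps(5) mult.commute)
    then show ?thesis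
      using b_scaleC'[of x c "\<i> *\<^sub>C y"] by (simp add: i_i b_minus')
  qed
  obtain Q :: "'a op" where Q: "clin Q" "\<And>x y. cinner x (Q y) = S x y"
  \<comment> \<open>The constant 2 comes from bounding the real and the imaginary part
    separately.\<close>
  proof (rule sesquilinear_form_operator[where S = S and K = 2])
    show "S (c *\<^sub>C x) y = cnj c * S x y" for c x y
      by (rule complex_eqI) (simp_all add: S_def b_scaleC[of c x] i_i b_minus' algebra_simps)
    show "S x (c *\<^sub>C y) = c * S x y" for c x y
      by (rule complex_eqI) (simp_all add: S_def b_scaleC'[of x c y] b_ic[of x c y] algebra_simps)
    show "cmod (S x y) \<le> 2 * norm x * norm y" for x y
      using cmod_le[of "S x y"] b_bound[of x y] b_bound[of x "\<i> *\<^sub>C y"]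
      by (simp add: S_def norm_scaleC)
  qed (auto simp: S_def b_add b_add' scaleC_simps complex_eq_iff)
  have Qq: "cinner x (Q x) = of_real (q x)" for x
    by (simp add: Q S_def b_self b_i_self complex_eq_iff)
  have q_restr: "q (x + restr B y) = q (x + y)" "q (x - restr B y) = q (x - y)" for x y
    by (simp_all add: q_def restr_add restr_diff)
  have b_restr: "b x (restr B y) = b x y" for x y
    by (simp add: b_def q_restr)
  have S_restr: "S x (restr B y) = S x y" "S (restr B x) y = S x y" for x y
    using b_restr b_sym by (auto simp: S_def restr_scaleC[symmetric]) metis+
  have op: "op_on B Q"
    unfolding op_on_iff using Q by (auto intro!: cinner_ext simp: cinner_restr[symmetric] S_restr)
  have pred: "Q \<in> predicates B"
  proof -
    have "cinner x ((idop B - Q) x) = of_real ((norm (restr B x))\<^sup>2 - q x)" for x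
      by (simp add: blinfun.bilinear_simps cinner_simps Qq cinner_restr_self)
    then have "positive (idop B - Q)"
      unfolding positive_def using q_le by (simp only: nonneg_Reals_of_real_iff diff_ge_0_iff_ge simp_thms)
    then show ?thesis
      using q_ge op by (simp add: predicates_def loewner_def positive_def Qq)
  qed
  show ?thesis
  proof (rule that[OF pred])
    fix \<rho> assume "\<rho> \<in> partial_states B"
    then have \<rho>: "\<rho> \<in> pos_trace_class B" "tr \<rho> \<le> 1"
      by (auto simp: ps_iff)
    obtain w :: "nat \<Rightarrow> 'a ell2" where w: "\<And>k. restr B (w k) = w k"
        "((\<lambda>k. (norm (w k))\<^sup>2) has_sum tr \<rho>) UNIV" "((\<lambda>k. butter (w k)) has_sum \<rho>) UNIV"
      using ptc_decomposition[OF \<rho>(1)] by metis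
    have T: "((\<lambda>k. tr (butter (w k))) has_sum tr \<rho>) UNIV"
      using w(2) by (simp add: tr_butter[OF w(1)])
    have "((\<lambda>k. f (butter (w k))) has_sum f \<rho>) UNIV"
      using ps_functional_has_sum[OF f butter_ptc[OF w(1)] T \<rho>(2)] unfolding infsumI[OF w(3)] .
    \<comment> \<open>Each rank-one term has trace at most tr \<rho>, hence at most 1, where
      \<open>cone_ext f\<close> agrees with \<open>f\<close>.\<close>
    moreover have "f (butter (w k)) = q (w k)" for k
    proof -
      have "tr (butter (w k)) \<le> tr \<rho>"
        using finite_sum_le_has_sum[OF T, of "{k}"] tr_nonneg[OF butter_ptc[OF w(1)]] by simp
      then show ?thesis
        using \<rho> cone_ext_ps[OF lin butter_ptc[OF w(1)[of k]]] by (simp add: q_def w(1))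
    qed
    ultimately have "((\<lambda>k. q (w k)) has_sum f \<rho>) UNIV"
      by simp
    moreover have "((\<lambda>k. q (w k)) has_sum tr (Q o\<^sub>L \<rho>)) UNIV"
      using tr_compose_eq[OF w(3) has_sum_imp_summable[OF w(2)] Q(1)] by (simp add: Qq)
    ultimately show "tr (Q o\<^sub>L \<rho>) = f \<rho>"
      by (metis has_sum_unique)
  qed
qed

section \<open>The Loewner order and greatest predicates\<close>

lemma positive_antisym:
  assumes "clin A" "positive A" "positive (- A)"
  shows "A = 0"
proof -
  have "cinner x (A x) = 0" for x
    using assms(2,3) positiveD[OF assms(2), of x] positive_ge_0[OF assms(2), of x] positive_ge_0[OF assms(3), of x]
    by (simp add: blinfun.bilinear_simps cinner_simps)
  then have "cmod (cinner x (A y)) = 0" for x y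
    using positive_cauchy_schwarz[OF assms(1,2), of x y] by simp
  then show ?thesis
    by (intro blinfun_eqI cinner_ext) simp
qed

lemma loewner_antisym: "op_on B A \<Longrightarrow> op_on B A' \<Longrightarrow> A \<sqsubseteq> A' \<Longrightarrow> A' \<sqsubseteq> A \<Longrightarrow> A = A'"
  using positive_antisym[of "A' - A"] op_on_clin[OF op_on_diff[of B A' A]] by (simp add: loewner_def)

text \<open>Rank-one partial states suffice as tests, because on them the trace is the quadratic
  form of the predicate.\<close>

lemma predicate_le:
  assumes Q: "Q \<in> predicates B" "Q' \<in> predicates B"
    and le: "\<And>\<rho>. \<rho> \<in> partial_states B \<Longrightarrow> tr (Q o\<^sub>L \<rho>) \<le> tr (Q' o\<^sub>L \<rho>)"
  shows "Q \<sqsubseteq> Q'"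
proof -
  note Q1 = predicatesD[OF Q(1)] and Q2 = predicatesD[OF Q(2)]
  have "0 \<le> Re (cinner x (Q' x)) - Re (cinner x (Q x))" for x
  proof -
    define z where "z = restr B x"
    have eq: "cinner x (A x) = cinner z (A z)" if "op_on B A" for A
      unfolding z_def using that by (simp add: cinner_restr op_on_restr_left op_on_restr_right)
    \<comment> \<open>Scales z to norm at most 1, so that its rank-one operator is a partial state;
      the summand 1 covers z = 0.\<close>
    define t where "t = 1 / (1 + norm z)"
    have t: "0 < t" "norm (t *\<^sub>R z) \<le> 1"
      by (auto simp: t_def divide_le_eq_1 add_pos_nonneg)
    have "butter (t *\<^sub>R z) \<in> partial_states B"
      using butter_ptc[of B "t *\<^sub>R z"] tr_butter[of B "t *\<^sub>R z"] power_mono[OF t(2), of 2]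
      by (simp add: ps_iff z_def restr_scaleR)
    from le[OF this] have "t * (t * Re (cinner z (Q z))) \<le> t * (t * Re (cinner z (Q' z)))"
      using Q1(1) Q2(1) by (simp add: tr_compose_butter op_on_clin blinfun.bilinear_simps cinner_simps)
    then show ?thesis
      using t eq[OF Q1(1)] eq[OF Q2(1)] by simp
  qed
  then have "0 \<le> Re (cinner x ((Q' - Q) x)) \<and> Im (cinner x ((Q' - Q) x)) = 0" for x
    using Q1(2) Q2(2) by (auto simp: blinfun.bilinear_simps cinner_simps positive_def complex_nonneg_Reals_iff)
  then show ?thesis
    by (simp add: loewner_def positive_def complex_nonneg_Reals_iff)
qed

text \<open>The predicate that represents \<open>f\<close> meets the bound with equality and so
  dominates every competitor; antisymmetry then settles the definite description.\<close>

lemma tr_greatest_predicate: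
  assumes f: "ps_functional (basis \<Gamma>) 1 f" and \<rho>: "\<rho> \<in> partial_states (basis \<Gamma>)"
  shows "tr (greatest_predicate \<Gamma> (\<lambda>Q. \<forall>\<rho>\<in>partial_states (basis \<Gamma>). tr (Q o\<^sub>L \<rho>) \<le> f \<rho>) o\<^sub>L \<rho>) = f \<rho>"
proof -
  obtain Q where Q: "Q \<in> predicates (basis \<Gamma>)" "\<And>\<rho>. \<rho> \<in> partial_states (basis \<Gamma>) \<Longrightarrow> tr (Q o\<^sub>L \<rho>) = f \<rho>"
    using ps_functional_representation[OF f] by blast
  have "greatest_predicate \<Gamma> (\<lambda>Q. \<forall>\<rho>\<in>partial_states (basis \<Gamma>). tr (Q o\<^sub>L \<rho>) \<le> f \<rho>) = Q"
    unfolding greatest_predicate_def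
  proof (rule the_equality)
    show "Q \<in> predicates (basis \<Gamma>) \<and> (\<forall>\<rho>\<in>partial_states (basis \<Gamma>). tr (Q o\<^sub>L \<rho>) \<le> f \<rho>) \<and>
      (\<forall>Q'\<in>predicates (basis \<Gamma>). (\<forall>\<rho>\<in>partial_states (basis \<Gamma>). tr (Q' o\<^sub>L \<rho>) \<le> f \<rho>) \<longrightarrow> Q' \<sqsubseteq> Q)"
      using Q by (auto intro!: predicate_le)
    fix Q' assume Q': "Q' \<in> predicates (basis \<Gamma>) \<and> (\<forall>\<rho>\<in>partial_states (basis \<Gamma>). tr (Q' o\<^sub>L \<rho>) \<le> f \<rho>) \<and>
      (\<forall>Q''\<in>predicates (basis \<Gamma>). (\<forall>\<rho>\<in>partial_states (basis \<Gamma>). tr (Q'' o\<^sub>L \<rho>) \<le> f \<rho>) \<longrightarrow> Q'' \<sqsubseteq> Q')"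
    then have "Q \<sqsubseteq> Q'" "Q' \<sqsubseteq> Q"
      using Q by (auto intro!: predicate_le)
    then show "Q' = Q"
      using Q Q' loewner_antisym predicatesD(1) by blast
  qed
  then show ?thesis
    using Q \<rho> by simp
qed

section \<open>Extending register operators\<close>

lemma norm_restr_has_sum: "((\<lambda>x. (cmod (coord \<psi> x))\<^sup>2) has_sum (norm (restr B \<psi>))\<^sup>2) B"
  using norm_ell2_square[of "restr B \<psi>"]
  by (rule has_sum_cong_neutral[THEN iffD1, rotated -1]) auto

lemma restr_ket: "restr B (ket x) = (if x \<in> B then ket x else 0)"
  by (rule ell2_eqI) (auto simp: coord_ket)

text \<open>A bijection of \<open>B\<close> with \<open>R \<times> C\<close> cuts every vector of \<open>\<ell>\<^sup>2(B)\<close> into an \<open>R\<close>-indexed family of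
  vectors of \<open>\<ell>\<^sup>2(C)\<close>, on which \<open>A \<otimes> I\<close> acts componentwise.\<close>

locale slicing =
  fixes B :: "'a set" and C :: "'c set" and R :: "'r set" and \<tau> :: "'a \<Rightarrow> 'r" and \<pi> :: "'a \<Rightarrow> 'c"
  assumes bij: "bij_betw (\<lambda>f. (\<tau> f, \<pi> f)) B (R \<times> C)"
begin

definition join :: "'r \<times> 'c \<Rightarrow> 'a" where
  "join = inv_into B (\<lambda>f. (\<tau> f, \<pi> f))"

lemma join_in: "r \<in> R \<Longrightarrow> c \<in> C \<Longrightarrow> join (r, c) \<in> B"
  unfolding join_def using bij by (metis bij_betw_imp_surj_on inv_into_into mem_Sigma_iff)

lemma split_join: 
  assumes "r \<in> R" "c \<in> C" 
  shows "\<tau> (join (r, c)) = r" "\<pi> (join (r, c)) = c"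
proof -
  have "(\<tau> (join (r, c)), \<pi> (join (r, c))) = (r, c)"
    unfolding join_def using bij assms
    by (metis (mono_tags, lifting) bij_betw_imp_surj_on f_inv_into_f mem_Sigma_iff)
  then show "\<tau> (join (r, c)) = r" "\<pi> (join (r, c)) = c"
    by auto
qed

lemma join_split: "f \<in> B \<Longrightarrow> join (\<tau> f, \<pi> f) = f"
  unfolding join_def using bij bij_betw_inv_into_left by force

lemma split_in: "f \<in> B \<Longrightarrow> \<tau> f \<in> R" "f \<in> B \<Longrightarrow> \<pi> f \<in> C"
  using bij bij_betwE by fastforce+

lemma bij_join: "bij_betw join (R \<times> C) B"
  unfolding join_def by (rule bij_betw_inv_into[OF bij])

lemma join_has_sum:
  "((\<lambda>(r, c). (cmod (coord \<psi> (join (r, c))))\<^sup>2) has_sum (norm (restr B \<psi>))\<^sup>2) (R \<times> C)"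
  using has_sum_reindex_bij_betw[OF bij_join, of "\<lambda>x. (cmod (coord \<psi> x))\<^sup>2"] norm_restr_has_sum[of \<psi> B]
  by (simp add: case_prod_unfold)

definition slice :: "'r \<Rightarrow> 'a ell2 \<Rightarrow> 'c ell2" where
  "slice r \<psi> = Abs_ell2 (\<lambda>c. if c \<in> C then coord \<psi> (join (r, c)) else 0)"

lemma coord_slice: 
  assumes "r \<in> R" 
  shows "coord (slice r \<psi>) c = (if c \<in> C then coord \<psi> (join (r, c)) else 0)"
proof -
  have "(\<lambda>(r, c). (cmod (coord \<psi> (join (r, c))))\<^sup>2) summable_on (R \<times> C)"
    using join_has_sum[of \<psi>] by (rule has_sum_imp_summable)
  then have "(\<lambda>c. (cmod (coord \<psi> (join (r, c))))\<^sup>2) summable_on C"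
    using assms by (rule summable_on_SigmaD1)
  then have "(\<lambda>c. (cmod (if c \<in> C then coord \<psi> (join (r, c)) else 0))\<^sup>2) summable_on UNIV"
    by (rule summable_on_cong_neutral[THEN iffD1, rotated -1]) auto
  then show ?thesis
    unfolding slice_def by (simp add: Abs_ell2_inverse)
qed

lemma restr_slice: "r \<in> R \<Longrightarrow> restr C (slice r \<psi>) = slice r \<psi>"
  by (rule ell2_eqI) (simp add: coord_slice)

lemma slice_norm: "((\<lambda>r. (norm (slice r \<psi>))\<^sup>2) has_sum (norm (restr B \<psi>))\<^sup>2) R"
proof (rule has_sum_SigmaD[OF join_has_sum])
  fix r assume r: "r \<in> R"
  show "((\<lambda>c. case (r, c) of (r, c) \<Rightarrow> (cmod (coord \<psi> (join (r, c))))\<^sup>2) has_sum (norm (slice r \<psi>))\<^sup>2) C"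
    using norm_restr_has_sum[of "slice r \<psi>" C] unfolding restr_slice[OF r]
    by (rule has_sum_cong[THEN iffD1, rotated]) (simp add: coord_slice[OF r])
qed

definition tens_fun :: "'c op \<Rightarrow> 'a ell2 \<Rightarrow> 'a ell2" where
  "tens_fun A \<psi> = Abs_ell2 (\<lambda>f. if f \<in> B then coord (A (slice (\<tau> f) \<psi>)) (\<pi> f) else 0)"

lemma tens_summable:
  fixes A :: "'c op"
  shows "(\<lambda>(r, c). (cmod (coord (A (slice r \<psi>)) c))\<^sup>2) summable_on (R \<times> C)"
proof (rule summable_on_SigmaI)
  show "((\<lambda>c. case (r, c) of (r, c) \<Rightarrow> (cmod (coord (A (slice r \<psi>)) c))\<^sup>2) has_sum
      (norm (restr C (A (slice r \<psi>))))\<^sup>2) C" for r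
    using norm_restr_has_sum by simp
  have "(\<lambda>r. (norm A)\<^sup>2 * (norm (slice r \<psi>))\<^sup>2) summable_on R"
    using slice_norm by (intro summable_on_cmult_right) (rule has_sum_imp_summable)
  then show "(\<lambda>r. (norm (restr C (A (slice r \<psi>))))\<^sup>2) summable_on R"
    by (rule summable_on_comparison_test)
      (auto simp: power_mult_distrib[symmetric] intro!: power_mono order_trans[OF norm_restr_le] norm_blinfun)
qed auto

lemma coord_tens_fun:
  "coord (tens_fun A \<psi>) f = (if f \<in> B then coord (A (slice (\<tau> f) \<psi>)) (\<pi> f) else 0)"
proof -
  have "(\<lambda>f. (cmod (coord (A (slice (\<tau> f) \<psi>)) (\<pi> f)))\<^sup>2) summable_on B"
    using summable_on_reindex_bij_betw[OF bij, of "\<lambda>(r, c). (cmod (coord (A (slice r \<psi>)) c))\<^sup>2"] tens_summable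
    by simp
  then have "(\<lambda>f. (cmod (if f \<in> B then coord (A (slice (\<tau> f) \<psi>)) (\<pi> f) else 0))\<^sup>2) summable_on UNIV"
    by (rule summable_on_cong_neutral[THEN iffD1, rotated -1]) auto
  then show ?thesis
    unfolding tens_fun_def by (simp add: Abs_ell2_inverse)
qed

lemma slice_tens_fun: "op_on C A \<Longrightarrow> r \<in> R \<Longrightarrow> slice r (tens_fun A \<psi>) = A (slice r \<psi>)"
proof (rule ell2_eqI)
  fix c assume A: "op_on C A" and r: "r \<in> R"
  have "c \<notin> C \<Longrightarrow> coord (A (slice r \<psi>)) c = 0"
    using arg_cong[OF op_on_restr_left[OF A, of "slice r \<psi>"], of "\<lambda>x. coord x c"] by simp
  then show "coord (slice r (tens_fun A \<psi>)) c = coord (A (slice r \<psi>)) c"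
    using r by (simp add: coord_slice coord_tens_fun join_in split_join)
qed

lemma restr_tens_fun: "restr B (tens_fun A \<psi>) = tens_fun A \<psi>"
  by (rule ell2_eqI) (simp add: coord_tens_fun)

lemma tens_fun_norm: "op_on C A \<Longrightarrow> ((\<lambda>r. (norm (A (slice r \<psi>)))\<^sup>2) has_sum (norm (tens_fun A \<psi>))\<^sup>2) R"
  using slice_norm[of "tens_fun A \<psi>"] unfolding restr_tens_fun
  by (rule has_sum_cong[THEN iffD1, rotated]) (simp add: slice_tens_fun)

lemma slice_linear:
  assumes "r \<in> R"
  shows "slice r (x + y) = slice r x + slice r y" "slice r (c *\<^sub>C x) = c *\<^sub>C slice r x"
    "slice r (restr B x) = slice r x"
  using assms by (auto intro!: ell2_eqI simp: coord_slice join_in)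

lemma tens_exists:
  assumes A: "op_on C A"
  obtains T :: "'a op" where "op_on B T" "\<And>\<psi>. T \<psi> = tens_fun A \<psi>"
proof -
  have add: "tens_fun A (x + y) = tens_fun A x + tens_fun A y" for x y
    by (rule ell2_eqI) (simp add: coord_tens_fun slice_linear split_in blinfun.bilinear_simps)
  have scale: "tens_fun A (c *\<^sub>C x) = c *\<^sub>C tens_fun A x" for c x
    by (rule ell2_eqI) (simp add: coord_tens_fun slice_linear split_in clinD[OF op_on_clin[OF A]])
  have bound: "norm (tens_fun A x) \<le> norm x * norm A" for x
  proof -
    have "((\<lambda>r. (norm A)\<^sup>2 * (norm (slice r x))\<^sup>2) has_sum ((norm A)\<^sup>2 * (norm (restr B x))\<^sup>2)) R"
      by (intro has_sum_cmult_right slice_norm)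
    from has_sum_mono[OF tens_fun_norm[OF A, of x] this]
    have "(norm (tens_fun A x))\<^sup>2 \<le> (norm A * norm (restr B x))\<^sup>2"
      by (auto simp: power_mult_distrib[symmetric] intro!: power_mono norm_blinfun)
    then have "norm (tens_fun A x) \<le> norm A * norm (restr B x)"
      by (rule power2_le_imp_le) simp
    also have "\<dots> \<le> norm A * norm x"
      by (intro mult_left_mono norm_restr_le) simp
    finally show ?thesis
      by (simp add: mult.commute)
  qed
  have "bounded_linear (tens_fun A)"
    by (rule bounded_linear_intro[where K = "norm A"]) (auto simp: add scale scaleR_scaleC bound)
  then have T: "blinfun_apply (Blinfun (tens_fun A)) = tens_fun A"
    by (rule bounded_linear_Blinfun_apply)
  show ?thesis
  proof (rule that[of "Blinfun (tens_fun A)"])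
    have "tens_fun A (restr B x) = tens_fun A x" for x
      by (rule ell2_eqI) (simp add: coord_tens_fun slice_linear split_in)
    then show "op_on B (Blinfun (tens_fun A))"
      by (simp add: op_on_iff clin_def T scale restr_tens_fun)
  qed (simp add: T)
qed

text \<open>The link with \<open>extend_op\<close>, which is specified by matrix entries: a slice of
  a basis vector is a basis vector or 0.\<close>

lemma tens_fun_matrix:
  assumes "f \<in> B" "g \<in> B"
  shows "cinner (ket f) (tens_fun A (ket g)) = (if \<tau> f = \<tau> g then cinner (ket (\<pi> f)) (A (ket (\<pi> g))) else 0)"
proof -
  have "slice (\<tau> f) (ket g) = (if \<tau> f = \<tau> g then ket (\<pi> g) else 0)"
  proof (rule ell2_eqI)
    fix c
    show "coord (slice (\<tau> f) (ket g)) c = coord (if \<tau> f = \<tau> g then ket (\<pi> g) else 0) c"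
    proof (cases "c \<in> C")
      case True
      then have "join (\<tau> f, c) = g \<longleftrightarrow> \<tau> f = \<tau> g \<and> c = \<pi> g"
        using assms split_in split_join join_split by metis
      with True assms show ?thesis
        by (simp add: coord_slice split_in coord_ket)
    next
      case False
      with assms show ?thesis
        by (auto simp: coord_slice split_in coord_ket)
    qed
  qed
  then show ?thesis
    using assms by (simp add: cinner_ket coord_tens_fun)
qed

text \<open>Completeness holds on each slice, and square norms add up over the slices; it remains to
  exchange the sums over slices and outcomes.\<close>

lemma tens_kraus:
  assumes M: "kraus C I M" and T: "\<And>i. i \<in> I \<Longrightarrow> op_on B (T i)" "\<And>i \<psi>. i \<in> I \<Longrightarrow> T i \<psi> = tens_fun (M i) \<psi>"
  shows "kraus B I T"
  unfolding kraus_def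
proof (intro conjI ballI allI)
  fix \<psi>
  show "((\<lambda>i. (norm (T i \<psi>))\<^sup>2) has_sum (norm (restr B \<psi>))\<^sup>2) I"
  proof (rule nonneg_has_sum_swap[OF _ slice_norm])
    show "((\<lambda>i. (norm (M i (slice r \<psi>)))\<^sup>2) has_sum (norm (slice r \<psi>))\<^sup>2) I" if "r \<in> R" for r
      using M restr_slice[OF that, of \<psi>] unfolding kraus_def by metis
    show "((\<lambda>r. (norm (M i (slice r \<psi>)))\<^sup>2) has_sum (norm (T i \<psi>))\<^sup>2) R" if "i \<in> I" for i
      using M that by (simp add: T kraus_def tens_fun_norm)
  qed simp
qed (rule T)

lemma tens_contraction:
  assumes "op_on C A" "\<And>x. norm (A x) \<le> norm x"
  shows "norm (tens_fun A \<psi>) \<le> norm \<psi>"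
proof -
  have "(norm (tens_fun A \<psi>))\<^sup>2 \<le> (norm (restr B \<psi>))\<^sup>2"
    using tens_fun_norm[OF assms(1)] slice_norm by (rule has_sum_mono) (auto intro!: power_mono assms)
  then have "norm (tens_fun A \<psi>) \<le> norm (restr B \<psi>)"
    by (rule power2_le_imp_le) simp
  with norm_restr_le[of B \<psi>] show ?thesis
    by simp
qed

end

text \<open>\<open>restrict\<close> makes the part outside the register canonical, so equal
  remainders mean agreement on all other variables, which is the side condition in
  \<open>extend_op\<close>.\<close>

lemma register_slicing:
  assumes "register \<Gamma> qs"
  shows "slicing (basis \<Gamma>) (reg_basis \<Gamma> qs) ((\<lambda>f. restrict f (dom \<Gamma> - set qs)) ` basis \<Gamma>)
    (\<lambda>f. restrict f (dom \<Gamma> - set qs)) (\<lambda>f. map f qs)"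
proof
  have qs: "distinct qs" "set qs \<subseteq> dom \<Gamma>"
    using assms by (auto simp: register_def)
  let ?t = "\<lambda>f :: 'a \<Rightarrow> int. restrict f (dom \<Gamma> - set qs)"
  show "bij_betw (\<lambda>f. (?t f, map f qs)) (basis \<Gamma>) (?t ` basis \<Gamma> \<times> reg_basis \<Gamma> qs)"
  proof (rule bij_betwI')
    fix f g assume fg: "f \<in> basis \<Gamma>" "g \<in> basis \<Gamma>"
    have "f = g" if "?t f = ?t g" "map f qs = map g qs"
    proof
      fix q
      consider "q \<in> set qs" | "q \<in> dom \<Gamma> - set qs" | "q \<notin> dom \<Gamma>"
        using qs by blast
      then show "f q = g q"
      proof cases
        case 1
        then show ?thesis using that(2) by simp
      next
        case 2
        then show ?thesis using fun_cong[OF that(1), of q] by simp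
      next
        case 3
        then show ?thesis using fg by (auto simp: basis_def PiE_def extensional_def)
      qed
    qed
    then show "(?t f, map f qs) = (?t g, map g qs) \<longleftrightarrow> f = g"
      by auto
  next
    fix f assume f: "f \<in> basis \<Gamma>"
    have "map f qs \<in> reg_basis \<Gamma> qs"
      using f qs unfolding reg_basis_def basis_def by (auto simp: list_all2_conv_all_nth PiE_iff subset_iff)
    with f show "(?t f, map f qs) \<in> ?t ` basis \<Gamma> \<times> reg_basis \<Gamma> qs"
      by simp
  next
    fix p assume "p \<in> ?t ` basis \<Gamma> \<times> reg_basis \<Gamma> qs"
    then obtain f xs where p: "p = (?t f, xs)" "f \<in> basis \<Gamma>" "xs \<in> reg_basis \<Gamma> qs"
      by auto
    then have len: "length qs = length xs" and xs: "\<And>i. i < length qs \<Longrightarrow> xs ! i \<in> vals (the (\<Gamma> (qs ! i)))"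
      by (auto simp: reg_basis_def list_all2_conv_all_nth)
    \<comment> \<open>The preimage: \<open>f\<close> overwritten on the register by
      \<open>xs\<close>. As \<open>qs\<close> is distinct, each variable has one position to be
      looked up.\<close>
    define g where "g q = (if q \<in> set qs then the (map_of (zip qs xs) q) else f q)" for q
    have g_nth: "g (qs ! i) = xs ! i" if "i < length qs" for i
      using that qs len by (simp add: g_def map_of_zip_nth)
    have "g \<in> basis \<Gamma>"
      unfolding basis_def PiE_iff extensional_def
    proof (intro conjI ballI CollectI allI impI)
      fix q assume "q \<in> dom \<Gamma>"
      show "g q \<in> vals (the (\<Gamma> q))"
      proof (cases "q \<in> set qs")
        case True
        then obtain i where "i < length qs" "q = qs ! i"
          by (metis in_set_conv_nth)
        then show ?thesis
          using g_nth xs by simp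
      next
        case False
        then show ?thesis
          using p(2) \<open>q \<in> dom \<Gamma>\<close> by (auto simp: g_def basis_def)
      qed
    next
      fix q assume "q \<notin> dom \<Gamma>"
      then show "g q = undefined"
        using p(2) qs by (auto simp: g_def basis_def PiE_def extensional_def)
    qed
    moreover have "?t g = ?t f"
      by (auto simp: g_def restrict_def fun_eq_iff)
    moreover have "map g qs = xs"
      using g_nth len by (intro nth_equalityI) auto
    ultimately show "\<exists>g\<in>basis \<Gamma>. p = (?t g, map g qs)"
      using p(1) by metis
  qed
qed

lemma op_on_eq_matrix:
  assumes "op_on B T" "op_on B T'"
    and "\<And>f g. f \<in> B \<Longrightarrow> g \<in> B \<Longrightarrow> cinner (ket f) (T (ket g)) = cinner (ket f) (T' (ket g))"
  shows "T = T'"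
proof (rule clin_eq_matrix)
  have restr: "cinner (ket f) (X (ket g)) = cinner (restr B (ket f)) (X (restr B (ket g)))" if "op_on B X" for f g X
    using that by (simp add: cinner_restr op_on_restr_left op_on_restr_right)
  fix f g
  show "cinner (ket f) (T (ket g)) = cinner (ket f) (T' (ket g))"
    unfolding restr[OF assms(1)] restr[OF assms(2)] using assms(3) by (simp add: restr_ket blinfun.bilinear_simps)
qed (use assms op_on_clin in blast)+

lemma extend_op_eqI:
  fixes T :: "('v \<Rightarrow> int) op" and A :: "int list op"
  assumes "op_on (basis \<Gamma>) T"
    and "\<And>f g. f \<in> basis \<Gamma> \<Longrightarrow> g \<in> basis \<Gamma> \<Longrightarrow> cinner (ket f) (T (ket g)) =
      (if \<forall>q\<in>dom \<Gamma> - set qs. f q = g q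
       then cinner (ket (map f qs)) (A (ket (map g qs))) else 0)"
  shows "extend_op \<Gamma> qs A = T"
  unfolding extend_op_def
proof (rule the_equality)
  fix T' :: "('v \<Rightarrow> int) op"
  assume T': "op_on (basis \<Gamma>) T' \<and> (\<forall>f\<in>basis \<Gamma>. \<forall>g\<in>basis \<Gamma>. cinner (ket f) (T' (ket g)) =
      (if \<forall>q\<in>dom \<Gamma> - set qs. f q = g q
       then cinner (ket (map f qs)) (A (ket (map g qs))) else 0))"
  then show "T' = T"
    using assms by (intro op_on_eq_matrix[of "basis \<Gamma>"]) auto
qed (use assms in auto)

lemma restrict_eq_iff: "restrict f A = restrict g A \<longleftrightarrow> (\<forall>x\<in>A. f x = g x)"
  by (auto simp: fun_eq_iff restrict_def)

context
  fixes \<Gamma> :: "'v qctx" and qs :: "'v list"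
  assumes reg: "register \<Gamma> qs"
begin

interpretation slicing "basis \<Gamma>" "reg_basis \<Gamma> qs" "(\<lambda>f. restrict f (dom \<Gamma> - set qs)) ` basis \<Gamma>"
    "\<lambda>f. restrict f (dom \<Gamma> - set qs)" "\<lambda>f. map f qs"
  by (rule register_slicing[OF reg])

lemma extend_op_tens:
  assumes "op_on (reg_basis \<Gamma> qs) A"
  shows "op_on (basis \<Gamma>) (extend_op \<Gamma> qs A)" "extend_op \<Gamma> qs A \<psi> = tens_fun A \<psi>"
proof -
  obtain T where T: "op_on (basis \<Gamma>) T" "\<And>\<psi>. T \<psi> = tens_fun A \<psi>"
    using tens_exists[OF assms] by blast
  have "extend_op \<Gamma> qs A = T"
    by (rule extend_op_eqI[OF T(1)]) (simp add: T(2) tens_fun_matrix restrict_eq_iff)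
  with T show "op_on (basis \<Gamma>) (extend_op \<Gamma> qs A)" "extend_op \<Gamma> qs A \<psi> = tens_fun A \<psi>"
    by auto
qed

lemma extend_op_on: "op_on (reg_basis \<Gamma> qs) A \<Longrightarrow> op_on (basis \<Gamma>) (extend_op \<Gamma> qs A)"
  by (rule extend_op_tens)

lemma extend_op_kraus: "kraus (reg_basis \<Gamma> qs) I M \<Longrightarrow> kraus (basis \<Gamma>) I (\<lambda>i. extend_op \<Gamma> qs (M i))"
  by (rule tens_kraus) (auto simp: kraus_def extend_op_tens)

lemma extend_op_contraction:
  assumes "op_on (reg_basis \<Gamma> qs) A" "\<And>x. norm (A x) \<le> norm x"
  shows "norm (extend_op \<Gamma> qs A \<psi>) \<le> norm \<psi>"
  using assms by (simp add: extend_op_tens tens_contraction)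

text \<open>Bridges \<open>init_op\<close>, which multiplies on the right by the extension of
  |n><0|, and \<open>conj_op\<close>, which uses the adjoint of the extension of |0><n|.\<close>

lemma extend_op_adj:
  assumes A: "op_on (reg_basis \<Gamma> qs) A"
  shows "extend_op \<Gamma> qs (A\<^sup>\<dagger>) = (extend_op \<Gamma> qs A)\<^sup>\<dagger>"
proof (rule extend_op_eqI)
  note T = extend_op_tens[OF A]
  show "op_on (basis \<Gamma>) ((extend_op \<Gamma> qs A)\<^sup>\<dagger>)"
    by (rule op_on_adj[OF T(1)])
  fix f g assume fg: "f \<in> basis \<Gamma>" "g \<in> basis \<Gamma>"
  have "cinner (ket f) (((extend_op \<Gamma> qs A)\<^sup>\<dagger>) (ket g)) = cnj (cinner (ket g) (extend_op \<Gamma> qs A (ket f)))"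
    by (simp add: cinner_adj_right op_on_clin[OF T(1)] cinner_commute[of "ket g"])
  also have "\<dots> = (if \<forall>q\<in>dom \<Gamma> - set qs. f q = g q
      then cnj (cinner (ket (map g qs)) (A (ket (map f qs)))) else 0)"
    using fg by (auto simp: T(2) tens_fun_matrix restrict_eq_iff)
  also have "cnj (cinner (ket (map g qs)) (A (ket (map f qs)))) = cinner (ket (map f qs)) ((A\<^sup>\<dagger>) (ket (map g qs)))"
    by (simp add: cinner_adj_right op_on_clin[OF A] cinner_commute[of "ket (map g qs)"])
  finally show "cinner (ket f) (((extend_op \<Gamma> qs A)\<^sup>\<dagger>) (ket g)) = (if \<forall>q\<in>dom \<Gamma> - set qs. f q = g q
      then cinner (ket (map f qs)) ((A\<^sup>\<dagger>) (ket (map g qs))) else 0)" .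
qed

end

section \<open>Kraus families of the program constructs\<close>

lemma norm_square_adj: "clin A \<Longrightarrow> of_real ((norm (A x))\<^sup>2) = cinner x ((A\<^sup>\<dagger> o\<^sub>L A) x)"
  unfolding cinner_self[symmetric] by (simp add: cinner_adj_right)

lemma measurement_kraus:
  assumes "measurement_on B I M"
  shows "kraus B I M"
  unfolding kraus_def
proof (intro conjI ballI allI)
  show op: "op_on B (M i)" if "i \<in> I" for i
    using assms that by (auto simp: measurement_on_def)
  fix x
  have "((\<lambda>i. ((M i)\<^sup>\<dagger> o\<^sub>L M i) x) has_sum restr B x) I"
    using assms by (auto simp: measurement_on_def)
  from has_sum_Re[OF has_sum_bounded_linear[OF bounded_linear_cinner_right[of x] this]]
  have "((\<lambda>i. Re (cinner x (((M i)\<^sup>\<dagger> o\<^sub>L M i) x))) has_sum (norm (restr B x))\<^sup>2) I"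
    unfolding cinner_restr_self by simp
  then show "((\<lambda>i. (norm (M i x))\<^sup>2) has_sum (norm (restr B x))\<^sup>2) I"
    by (rule has_sum_cong[THEN iffD1, rotated])
      (metis norm_square_adj op op_on_clin Re_complex_of_real)
qed

lemma unitary_kraus:
  assumes "unitary_on B U"
  shows "kraus B (UNIV :: unit set) (\<lambda>_. U)"
proof -
  have "op_on B U" "U\<^sup>\<dagger> o\<^sub>L U = idop B"
    using assms by (auto simp: unitary_on_def)
  then have "of_real ((norm (U x))\<^sup>2) = (of_real ((norm (restr B x))\<^sup>2) :: complex)" for x
    unfolding norm_square_adj[OF op_on_clin[OF \<open>op_on B U\<close>]] by (simp add: cinner_restr_self)
  then have "(norm (U x))\<^sup>2 = (norm (restr B x))\<^sup>2" for x
    unfolding of_real_eq_iff .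
  with \<open>op_on B U\<close> show ?thesis
    by (simp add: kraus_def has_sum_unit_iff)
qed

lemma projection_contraction:
  assumes "projection_on B R"
  shows "norm (R x) \<le> norm x"
proof -
  have R: "op_on B R" "R\<^sup>\<dagger> o\<^sub>L R = R"
    using assms by (auto simp: projection_on_def)
  have "of_real ((norm (R x))\<^sup>2) = cinner x (R x)"
    using norm_square_adj[OF op_on_clin[OF R(1)], of x] unfolding R(2) .
  then have "(norm (R x))\<^sup>2 = cmod (cinner x (R x))"
    by (metis norm_of_real abs_of_nonneg zero_le_power2)
  also have "\<dots> \<le> norm x * norm (R x)"
    by (rule cinner_cauchy_schwarz)
  finally show ?thesis
    by (cases "norm (R x) = 0") (auto simp: power2_eq_square)
qed

lemma ketbra_apply: "ketbra x y \<psi> = coord \<psi> y *\<^sub>C ket x"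
  using ketbra.rep_eq[THEN fun_cong, of x y \<psi>] by (simp add: cinner_ket)

lemma adj_ketbra: "(ketbra x y)\<^sup>\<dagger> = ketbra y x"
  by (rule adj_unique) (simp add: ketbra_apply cinner_simps cinner_ket cinner_ket_right mult.commute)

lemma ketbra_op_on: "x \<in> B \<Longrightarrow> y \<in> B \<Longrightarrow> op_on B (ketbra x y)"
  by (auto simp: op_on_iff clin_def ketbra_apply scaleC_simps restr_scaleC restr_ket)

text \<open>|0><n| maps x to a vector whose norm is the modulus of the n-th coordinate of x, so
  completeness is the expansion of |x|^2 in coordinates.\<close>

lemma init_kraus: "kraus (reg_basis \<Gamma> [q]) (vals (the (\<Gamma> q))) (\<lambda>n. ketbra [0] [n])"
proof -
  let ?V = "vals (the (\<Gamma> q))"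
  have C: "reg_basis \<Gamma> [q] = (\<lambda>n. [n]) ` ?V"
    by (auto simp: reg_basis_def list_all2_Cons1)
  have "0 \<in> ?V"
    by (cases "the (\<Gamma> q)") auto
  moreover have "((\<lambda>n. (norm (ketbra [0] [n] x))\<^sup>2) has_sum (norm (restr (reg_basis \<Gamma> [q]) x))\<^sup>2) ?V" for x
  proof -
    have "((\<lambda>c. (cmod (coord x c))\<^sup>2) has_sum (norm (restr (reg_basis \<Gamma> [q]) x))\<^sup>2) ((\<lambda>n. [n]) ` ?V)"
      using norm_restr_has_sum[of x "reg_basis \<Gamma> [q]"] unfolding C .
    then show ?thesis
      by (subst (asm) has_sum_reindex) (auto simp: inj_on_def o_def ketbra_apply norm_scaleC)
  qed
  ultimately show ?thesis
    by (auto simp: kraus_def C intro!: ketbra_op_on)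
qed

lemma register_single: "q \<in> dom \<Gamma> \<Longrightarrow> register \<Gamma> [q]"
  by (simp add: register_def)

lemma init_op_eq:
  assumes "q \<in> dom \<Gamma>"
  shows "init_op \<Gamma> q \<rho> = (\<Sum>\<^sub>\<infinity>n\<in>vals (the (\<Gamma> q)). conj_op (extend_op \<Gamma> [q] (ketbra [0] [n])) \<rho>)"
proof -
  have "extend_op \<Gamma> [q] (ketbra [n] [0]) = (extend_op \<Gamma> [q] (ketbra [0] [n]))\<^sup>\<dagger>" if "n \<in> vals (the (\<Gamma> q))" for n
    unfolding adj_ketbra[of "[0]" "[n]", symmetric]
    using init_kraus[of \<Gamma> q] that by (intro extend_op_adj register_single[OF assms]) (auto simp: kraus_def)
  then show ?thesis
    unfolding init_op_def conj_op_def by (intro infsum_cong) simp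
qed

section \<open>Denotational semantics\<close>

text \<open>All that is retained of a denotation at error 0. The final inequality says that
  terminated and violating mass do not exceed the input; the deficit is the probability of
  divergence, which \<open>qwlp\<close> adds to its bound.\<close>

definition qop :: "'a set \<Rightarrow> ('a op \<Rightarrow> 'a op \<times> real) \<Rightarrow> bool" where
  "qop B D \<longleftrightarrow> ps_linear B D \<and> (\<forall>\<rho>\<in>partial_states B.
    fst (D \<rho>) \<in> pos_trace_class B \<and> 0 \<le> snd (D \<rho>) \<and> tr (fst (D \<rho>)) + snd (D \<rho>) \<le> tr \<rho>)"

lemma qopD:
  assumes "qop B D" "\<rho> \<in> partial_states B"
  shows "fst (D \<rho>) \<in> pos_trace_class B" "0 \<le> snd (D \<rho>)" "tr (fst (D \<rho>)) + snd (D \<rho>) \<le> tr \<rho>"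
    "fst (D \<rho>) \<in> partial_states B"
proof -
  show *: "fst (D \<rho>) \<in> pos_trace_class B" "0 \<le> snd (D \<rho>)" "tr (fst (D \<rho>)) + snd (D \<rho>) \<le> tr \<rho>"
    using assms by (auto simp: qop_def)
  then show "fst (D \<rho>) \<in> partial_states B"
    using assms(2) by (auto simp: ps_iff)
qed

lemma ps_scaleR: "\<rho> \<in> partial_states B \<Longrightarrow> 0 \<le> t \<Longrightarrow> t \<le> 1 \<Longrightarrow> t *\<^sub>R \<rho> \<in> partial_states B"
  using mult_mono[of t 1 "tr \<rho>" 1] tr_nonneg[of \<rho> B] by (auto simp: ps_iff ptc_scaleR tr_scaleR[of _ B])

text \<open>The series formulas for denotations hold on partial states only, so replacing a
  denotation by its formula needs a congruence of this strength.\<close>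

lemma qop_cong:
  assumes "\<And>\<rho>. \<rho> \<in> partial_states B \<Longrightarrow> D \<rho> = D' \<rho>" "qop B D'"
  shows "qop B D"
  using assms unfolding qop_def ps_linear_def by (simp add: ps_scaleR)

definition ps_map :: "'a set \<Rightarrow> ('a op \<Rightarrow> 'a op) \<Rightarrow> bool" where
  "ps_map B F \<longleftrightarrow> ps_linear B F \<and>
    (\<forall>\<rho>\<in>partial_states B. F \<rho> \<in> pos_trace_class B \<and> tr (F \<rho>) \<le> tr \<rho>)"

lemma ps_map_ps: "ps_map B F \<Longrightarrow> \<rho> \<in> partial_states B \<Longrightarrow> F \<rho> \<in> partial_states B"
  using ps_iff[of \<rho> B] ps_iff[of "F \<rho>" B] unfolding ps_map_def by (meson order_trans)

lemma ps_linear_compose: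
  assumes "ps_map B F" "ps_linear B D"
  shows "ps_linear B (\<lambda>\<rho>. D (F \<rho>))"
proof -
  have lin: "ps_linear B F"
    using assms by (simp add: ps_map_def)
  note ps = ps_map_ps[OF assms(1)]
  show ?thesis
    unfolding ps_linear_def
  proof (intro conjI ballI impI)
    fix \<rho> \<rho>' assume *: "\<rho> \<in> partial_states B" "\<rho>' \<in> partial_states B" "\<rho> + \<rho>' \<in> partial_states B"
    then have "F (\<rho> + \<rho>') = F \<rho> + F \<rho>'"
      using lin by (auto simp: ps_linear_def)
    with ps[OF *(1)] ps[OF *(2)] ps[OF *(3)] show "D (F (\<rho> + \<rho>')) = D (F \<rho>) + D (F \<rho>')"
      using assms(2) by (auto simp: ps_linear_def)
  next
    fix \<rho> and t :: real assume "\<rho> \<in> partial_states B" "t \<in> {0..1}"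
    with ps lin assms(2) show "D (F (t *\<^sub>R \<rho>)) = t *\<^sub>R D (F \<rho>)"
      by (auto simp: ps_linear_def)
  qed
qed

lemma ps_map_compose: "ps_map B F \<Longrightarrow> ps_map B G \<Longrightarrow> ps_map B (\<lambda>\<rho>. G (F \<rho>))"
  using ps_linear_compose[of B F G] ps_map_ps[of B F] unfolding ps_map_def by (meson order_trans)

lemma ps_map_id: "ps_map B (\<lambda>\<rho>. \<rho>)"
  by (auto simp: ps_map_def ps_linear_def ps_iff)

lemma ps_map_funpow: "ps_map B G \<Longrightarrow> ps_map B (G ^^ k)"
proof (induction k)
  case (Suc k)
  then show ?case
    using ps_map_compose[of B "G ^^ k" G] by (simp add: o_def)
qed (use ps_map_id in \<open>simp add: id_def\<close>)

lemma ps_map_conj_op: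
  assumes "op_on B A" "\<And>x. norm (A x) \<le> norm x"
  shows "ps_map B (conj_op A)"
  using assms bounded_linear.linear[OF bounded_linear_conj_op[of A]]
  by (auto simp: ps_map_def ps_linear_def ps_iff conj_op_ptc tr_conj_op_le linear_add linear_scale)

lemma kraus_contraction:
  assumes "kraus B I M" "i \<in> I"
  shows "norm (M i x) \<le> norm x"
proof -
  have "((\<lambda>i. (norm (M i x))\<^sup>2) has_sum (norm (restr B x))\<^sup>2) I"
    using assms by (auto simp: kraus_def)
  from finite_sum_le_has_sum[OF this, of "{i}"] assms(2)
  have "(norm (M i x))\<^sup>2 \<le> (norm (restr B x))\<^sup>2"
    by simp
  then have "norm (M i x) \<le> norm (restr B x)"
    by (rule power2_le_imp_le) simp
  with norm_restr_le[of B x] show ?thesis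
    by simp
qed

lemma ps_map_kraus: "kraus B I M \<Longrightarrow> i \<in> I \<Longrightarrow> ps_map B (conj_op (M i))"
  by (rule ps_map_conj_op) (auto simp: kraus_def intro: kraus_contraction)

lemma ps_map_qop: "qop B D \<Longrightarrow> ps_map B (\<lambda>\<rho>. fst (D \<rho>))"
  using tr_nonneg unfolding ps_map_def qop_def ps_linear_def by force

lemma qop_compose: "ps_map B F \<Longrightarrow> qop B D \<Longrightarrow> qop B (\<lambda>\<rho>. D (F \<rho>))"
  using ps_linear_compose[of B F D] ps_map_ps[of B F] unfolding qop_def ps_map_def by (meson order_trans)

lemma qop_seq:
  assumes "qop B D1" "qop B D2"
  shows "qop B (\<lambda>\<rho>. D2 (fst (D1 \<rho>)) + (0, snd (D1 \<rho>)))"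
proof -
  have lin: "ps_linear B D1" "ps_linear B (\<lambda>\<rho>. D2 (fst (D1 \<rho>)))"
    using assms ps_linear_compose[OF ps_map_qop[OF assms(1)]] by (auto simp: qop_def)
  then have "ps_linear B (\<lambda>\<rho>. D2 (fst (D1 \<rho>)) + (0, snd (D1 \<rho>)))"
    unfolding ps_linear_def by (auto simp: prod_eq_iff scaleR_add_right algebra_simps)
  moreover have "fst (D2 (fst (D1 \<rho>)) + (0, snd (D1 \<rho>))) \<in> pos_trace_class B \<and>
      0 \<le> snd (D2 (fst (D1 \<rho>)) + (0, snd (D1 \<rho>))) \<and>
      tr (fst (D2 (fst (D1 \<rho>)) + (0, snd (D1 \<rho>)))) + snd (D2 (fst (D1 \<rho>)) + (0, snd (D1 \<rho>))) \<le> tr \<rho>"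
    if "\<rho> \<in> partial_states B" for \<rho>
    using qopD[OF assms(1) that] qopD[OF assms(2) qopD(4)[OF assms(1) that]] by auto
  ultimately show ?thesis
    by (auto simp: qop_def)
qed

section \<open>Summable families of denotations\<close>

lemma has_sum_Pair:
  fixes f :: "'i \<Rightarrow> 'a :: real_normed_vector" and g :: "'i \<Rightarrow> 'b :: real_normed_vector"
  assumes "(f has_sum a) I" "(g has_sum b) I"
  shows "((\<lambda>i. (f i, g i)) has_sum (a, b)) I"
  using has_sum_add[OF has_sum_bounded_linear[OF bounded_linear_Pair[OF bounded_linear_ident bounded_linear_zero] assms(1)]
      has_sum_bounded_linear[OF bounded_linear_Pair[OF bounded_linear_zero bounded_linear_ident] assms(2)]]
  by simp

text \<open>The common pattern behind the branches of a measurement, the terms of an initialisation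
  and the rounds of a loop. All terms are nonnegative, so bounding the finite sums by the trace is
  what makes the family summable.\<close>

definition qop_family :: "'a set \<Rightarrow> 'i set \<Rightarrow> ('i \<Rightarrow> 'a op \<Rightarrow> 'a op \<times> real) \<Rightarrow> bool" where
  "qop_family B I D \<longleftrightarrow> (\<forall>i\<in>I. ps_linear B (D i)) \<and>
    (\<forall>i\<in>I. \<forall>\<rho>\<in>partial_states B. fst (D i \<rho>) \<in> pos_trace_class B \<and> 0 \<le> snd (D i \<rho>)) \<and>
    (\<forall>\<rho>\<in>partial_states B. \<forall>F. finite F \<longrightarrow> F \<subseteq> I \<longrightarrow> (\<Sum>i\<in>F. tr (fst (D i \<rho>)) + snd (D i \<rho>)) \<le> tr \<rho>)"

definition reward :: "('a op \<Rightarrow> real) \<Rightarrow> real \<Rightarrow> 'a op \<times> real \<Rightarrow> real" where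
  "reward g v d = g (fst d) + v * snd d"

text \<open>Bounded finite sums make traces and errors summable separately, and summable traces give
  convergence of the operators. The claim about \<open>reward\<close> is the \<sigma>-additivity of
  \<open>g\<close>.\<close>

lemma qop_family_sums:
  assumes D: "qop_family B I D" and \<rho>: "\<rho> \<in> partial_states B"
  defines "S \<equiv> \<Sum>\<^sub>\<infinity>i\<in>I. D i \<rho>"
  shows qop_family_has_sum: "((\<lambda>i. D i \<rho>) has_sum S) I"
    and "fst S \<in> pos_trace_class B" "0 \<le> snd S" "tr (fst S) + snd S \<le> tr \<rho>"
    and qop_family_reward: "ps_functional B K g \<Longrightarrow> ((\<lambda>i. reward g v (D i \<rho>)) has_sum reward g v S) I"
proof -
  have d: "fst (D i \<rho>) \<in> pos_trace_class B" "0 \<le> snd (D i \<rho>)" "0 \<le> tr (fst (D i \<rho>))" if "i \<in> I" for i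
    using D \<rho> that tr_nonneg[of "fst (D i \<rho>)" B] by (auto simp: qop_family_def)
  have bound: "(\<Sum>i\<in>F. tr (fst (D i \<rho>)) + snd (D i \<rho>)) \<le> tr \<rho>" if "finite F" "F \<subseteq> I" for F
    using D \<rho> that by (auto simp: qop_family_def)
  have sub: "(\<Sum>i\<in>F. tr (fst (D i \<rho>))) \<le> tr \<rho>" "(\<Sum>i\<in>F. snd (D i \<rho>)) \<le> tr \<rho>" if "finite F" "F \<subseteq> I" for F
    using bound[OF that] sum_nonneg[of F "\<lambda>i. snd (D i \<rho>)"] sum_nonneg[of F "\<lambda>i. tr (fst (D i \<rho>))"] d that
    by (auto simp: sum.distrib subset_iff)
  have "(\<lambda>i. tr (fst (D i \<rho>))) summable_on I" "(\<lambda>i. snd (D i \<rho>)) summable_on I"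
    by (auto intro!: nonneg_bdd_above_summable_on bdd_aboveI2[where M = "tr \<rho>"] d sub)
  then obtain T p where T: "((\<lambda>i. tr (fst (D i \<rho>))) has_sum T) I" and p: "((\<lambda>i. snd (D i \<rho>)) has_sum p) I"
    using has_sum_infsum by blast
  define R where "R = (\<Sum>\<^sub>\<infinity>i\<in>I. fst (D i \<rho>))"
  have R: "((\<lambda>i. fst (D i \<rho>)) has_sum R) I" "R \<in> pos_trace_class B" "tr R = T"
    unfolding R_def using d(1) by (auto intro: ptc_has_sum[OF _ T] ptc_infsum[OF _ T] tr_infsum[OF _ T])
  have has: "((\<lambda>i. D i \<rho>) has_sum (R, p)) I"
    using has_sum_Pair[OF R(1) p] by simp
  then have S: "S = (R, p)"
    unfolding S_def by (rule infsumI)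
  show "((\<lambda>i. D i \<rho>) has_sum S) I"
    using has unfolding S .
  show "fst S \<in> pos_trace_class B"
    using R S by simp
  show "0 \<le> snd S"
    using has_sum_nonneg[OF p] d S by simp
  show "tr (fst S) + snd S \<le> tr \<rho>"
    using has_sum_le_finite_sums[OF has_sum_add[OF T p]] bound S R by simp
  assume g: "ps_functional B K g"
  have "T \<le> 1"
    using has_sum_le_finite_sums[OF T, of "tr \<rho>"] sub \<rho> by (force simp: ps_iff)
  then have "((\<lambda>i. g (fst (D i \<rho>))) has_sum g R) I"
    unfolding R_def by (intro ps_functional_has_sum[OF g d(1) T])
  then show "((\<lambda>i. reward g v (D i \<rho>)) has_sum reward g v S) I"
    unfolding reward_def S by (auto intro!: has_sum_add has_sum_cmult_right p)
qed

lemma qop_family_qop: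
  assumes D: "qop_family B I D"
  shows "qop B (\<lambda>\<rho>. \<Sum>\<^sub>\<infinity>i\<in>I. D i \<rho>)"
proof -
  note sums = qop_family_sums[OF D]
  have "ps_linear B (\<lambda>\<rho>. \<Sum>\<^sub>\<infinity>i\<in>I. D i \<rho>)"
    unfolding ps_linear_def
  proof (intro conjI ballI impI)
    fix \<rho> \<rho>' assume *: "\<rho> \<in> partial_states B" "\<rho>' \<in> partial_states B" "\<rho> + \<rho>' \<in> partial_states B"
    have "(\<Sum>\<^sub>\<infinity>i\<in>I. D i (\<rho> + \<rho>')) = (\<Sum>\<^sub>\<infinity>i\<in>I. D i \<rho> + D i \<rho>')"
      using D * by (intro infsum_cong) (auto simp: qop_family_def ps_linear_def)
    also have "\<dots> = (\<Sum>\<^sub>\<infinity>i\<in>I. D i \<rho>) + (\<Sum>\<^sub>\<infinity>i\<in>I. D i \<rho>')"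
      using sums(1)[OF *(1)] sums(1)[OF *(2)] by (intro infsum_add) (auto intro: has_sum_imp_summable)
    finally show "(\<Sum>\<^sub>\<infinity>i\<in>I. D i (\<rho> + \<rho>')) = (\<Sum>\<^sub>\<infinity>i\<in>I. D i \<rho>) + (\<Sum>\<^sub>\<infinity>i\<in>I. D i \<rho>')" .
  next
    fix \<rho> and t :: real assume *: "\<rho> \<in> partial_states B" "t \<in> {0..1}"
    have "(\<Sum>\<^sub>\<infinity>i\<in>I. D i (t *\<^sub>R \<rho>)) = (\<Sum>\<^sub>\<infinity>i\<in>I. t *\<^sub>R D i \<rho>)"
      using D * by (intro infsum_cong) (auto simp: qop_family_def ps_linear_def)
    also have "\<dots> = t *\<^sub>R (\<Sum>\<^sub>\<infinity>i\<in>I. D i \<rho>)"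
      using has_sum_scaleR[OF sums(1)[OF *(1)], of t] by (rule infsumI)
    finally show "(\<Sum>\<^sub>\<infinity>i\<in>I. D i (t *\<^sub>R \<rho>)) = t *\<^sub>R (\<Sum>\<^sub>\<infinity>i\<in>I. D i \<rho>)" .
  qed
  then show ?thesis
    using sums(2-4) by (auto simp: qop_def)
qed

lemma qop_family_kraus:
  assumes M: "kraus B I M" and D: "\<And>i. i \<in> I \<Longrightarrow> qop B (D i)"
  shows "qop_family B I (\<lambda>i \<rho>. D i (conj_op (M i) \<rho>))"
  unfolding qop_family_def
proof (intro conjI ballI allI impI)
  fix i assume i: "i \<in> I"
  note q = qop_compose[OF ps_map_kraus[OF M i] D[OF i]]
  show "ps_linear B (\<lambda>\<rho>. D i (conj_op (M i) \<rho>))"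
    using q by (simp add: qop_def)
  show "fst (D i (conj_op (M i) \<rho>)) \<in> pos_trace_class B" "0 \<le> snd (D i (conj_op (M i) \<rho>))"
    if "\<rho> \<in> partial_states B" for \<rho>
    using qopD[OF q that] by auto
next
  fix \<rho> F assume \<rho>: "\<rho> \<in> partial_states B" and F: "finite F" "F \<subseteq> I"
  then have ptc: "\<rho> \<in> pos_trace_class B"
    by (simp add: ps_iff)
  have "(\<Sum>i\<in>F. tr (fst (D i (conj_op (M i) \<rho>))) + snd (D i (conj_op (M i) \<rho>))) \<le> (\<Sum>i\<in>F. tr (conj_op (M i) \<rho>))"
    using F by (intro sum_mono qopD(3)[OF D] ps_map_ps[OF ps_map_kraus[OF M] \<rho>]) auto
  also have "\<dots> \<le> tr \<rho>"
    using M ptc by (intro finite_sum_le_has_sum[OF kraus_tr[OF ptc M] F] tr_nonneg[of _ B] conj_op_ptc)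
      (auto simp: kraus_def)
  finally show "(\<Sum>i\<in>F. tr (fst (D i (conj_op (M i) \<rho>))) + snd (D i (conj_op (M i) \<rho>))) \<le> tr \<rho>" .
qed

section \<open>Loops as series over their rounds\<close>

definition loop_body :: "'a op \<Rightarrow> ('a op \<times> real \<Rightarrow> 'a op \<times> real) \<Rightarrow> 'a op \<Rightarrow> 'a op" where
  "loop_body M1 F \<rho> = fst (F (conj_op M1 \<rho>, 0))"

text \<open>What round \<open>k\<close> contributes: the state that leaves after exactly
  \<open>k\<close> executions of the body, and the error raised by execution
  \<open>k + 1\<close>.\<close>

definition loop_term :: "'a op \<Rightarrow> 'a op \<Rightarrow> ('a op \<times> real \<Rightarrow> 'a op \<times> real) \<Rightarrow> nat \<Rightarrow> 'a op \<Rightarrow> 'a op \<times> real" where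
  "loop_term M0 M1 F k \<rho> = (conj_op M0 ((loop_body M1 F ^^ k) \<rho>),
    snd (F (conj_op M1 ((loop_body M1 F ^^ k) \<rho>), 0)))"

text \<open>The recursion hands the error of the first execution to the remaining rounds, where it
  is merely added at the end. Unfolded from the outside, an approximation is thus a partial sum, and
  a least upper bound becomes a series.\<close>

lemma loop_approx_eq: "loop_approx M0 M1 F n (\<rho>, p) = (\<Sum>k<n. loop_term M0 M1 F k \<rho>) + (0, p)"
proof (induction n arbitrary: \<rho> p)
  case (Suc n)
  let ?e = "snd (F (conj_op M1 \<rho>, 0))" and ?G = "loop_body M1 F"
  have shift: "loop_term M0 M1 F k (?G \<rho>) = loop_term M0 M1 F (Suc k) \<rho>" for k
    by (simp add: loop_term_def funpow_swap1)
  have "loop_approx M0 M1 F (Suc n) (\<rho>, p) = (conj_op M0 \<rho>, 0) + loop_approx M0 M1 F n (?G \<rho>, ?e) + (0, p)"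
    by (simp add: loop_body_def)
  also have "\<dots> = loop_term M0 M1 F 0 \<rho> + (\<Sum>k<n. loop_term M0 M1 F (Suc k) \<rho>) + (0, p)"
    by (simp add: Suc shift) (simp add: loop_term_def prod_eq_iff)
  finally show ?case
    unfolding sum.lessThan_Suc_shift .
qed (simp add: zero_prod_def)

lemma qop_family_loop:
  assumes M: "kraus B UNIV (\<lambda>b. if b then M1 else M0)" and F: "qop B (\<lambda>\<rho>. F (\<rho>, 0))"
  shows "qop_family B UNIV (loop_term M0 M1 F)"
proof -
  have M0: "ps_map B (conj_op M0)" and M1: "ps_map B (conj_op M1)"
    using ps_map_kraus[OF M, of False] ps_map_kraus[OF M, of True] by auto
  have G: "ps_map B (loop_body M1 F)"
    unfolding loop_body_def[abs_def] by (rule ps_map_qop[OF qop_compose[OF M1 F]])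
  \<comment> \<open>The balance of one round: exiting, violating and continuing mass do not exceed
    the mass that enters.\<close>
  have step: "tr (conj_op M0 \<rho>) + snd (F (conj_op M1 \<rho>, 0)) + tr (loop_body M1 F \<rho>) \<le> tr \<rho>"
    if \<rho>: "\<rho> \<in> partial_states B" for \<rho>
  proof -
    have ptc: "\<rho> \<in> pos_trace_class B"
      using \<rho> by (simp add: ps_iff)
    have "tr (conj_op M0 \<rho>) + tr (conj_op M1 \<rho>) = tr \<rho>"
      using has_sum_unique[OF kraus_tr[OF ptc M] has_sum_finite] by (simp add: UNIV_bool add.commute)
    then show ?thesis
      using qopD(3)[OF F ps_map_ps[OF M1 \<rho>]] by (simp add: loop_body_def)
  qed
  let ?G = "loop_body M1 F" and ?L = "loop_term M0 M1 F"
  note Gk = ps_map_ps[OF ps_map_funpow[OF G]]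
  \<comment> \<open>Invariant: the mass that has left in the first \<open>n\<close> rounds, plus the
    mass still in the loop, stays below the initial trace.\<close>
  have partial: "(\<Sum>k<n. tr (fst (?L k \<rho>)) + snd (?L k \<rho>)) + tr ((?G ^^ n) \<rho>) \<le> tr \<rho>"
    if \<rho>: "\<rho> \<in> partial_states B" for n \<rho>
  proof (induction n)
    case (Suc n)
    then show ?case
      using step[OF Gk[OF \<rho>], of n] by (simp add: loop_term_def)
  qed simp
  note q = qop_compose[OF ps_map_compose[OF ps_map_funpow[OF G] M1] F]
  have valid: "fst (?L k \<rho>) \<in> pos_trace_class B" "0 \<le> snd (?L k \<rho>)" if \<rho>: "\<rho> \<in> partial_states B" for k \<rho>
    using qopD(2)[OF q \<rho>] ps_map_ps[OF M0 Gk[OF \<rho>]] by (simp_all add: loop_term_def ps_iff)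
  show "qop_family B UNIV ?L"
    unfolding qop_family_def
  proof (intro conjI ballI allI impI)
    fix k
    have "ps_linear B (\<lambda>\<rho>. conj_op M0 ((?G ^^ k) \<rho>))" "ps_linear B (\<lambda>\<rho>. F (conj_op M1 ((?G ^^ k) \<rho>), 0))"
      using ps_map_compose[OF ps_map_funpow[OF G] M0] q by (auto simp: ps_map_def qop_def)
    then show "ps_linear B (?L k)"
      unfolding loop_term_def[abs_def] ps_linear_def by auto
  next
    fix \<rho> and N :: "nat set" assume \<rho>: "\<rho> \<in> partial_states B" and N: "finite N"
    obtain n where n: "N \<subseteq> {..<n}"
      using N finite_nat_iff_bounded by blast
    have "(\<Sum>k\<in>N. tr (fst (?L k \<rho>)) + snd (?L k \<rho>)) \<le> (\<Sum>k<n. tr (fst (?L k \<rho>)) + snd (?L k \<rho>))"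
      using n valid[OF \<rho>] by (intro sum_mono2) (auto intro!: add_nonneg_nonneg tr_nonneg[of _ B])
    also have "\<dots> \<le> tr \<rho>"
      using partial[OF \<rho>, of n] Gk[OF \<rho>, of n] tr_nonneg[of _ B] by (force simp: ps_iff)
    finally show "(\<Sum>k\<in>N. tr (fst (?L k \<rho>)) + snd (?L k \<rho>)) \<le> tr \<rho>" .
  qed (use valid in auto)
qed

lemma DR_iff: "d \<in> DR \<Gamma> \<longleftrightarrow> fst d \<in> partial_states (basis \<Gamma>) \<and> 0 \<le> snd d \<and> tr (fst d) + snd d \<le> 1"
  by (cases d) (simp add: DR_def)

text \<open>The remainders of the series are positive, so it is an upper bound. It is the least one
  because nonnegativity of every quadratic form survives the limit. Antisymmetry settles the
  definite description.\<close>

lemma dr_lub_sums: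
  assumes \<rho>: "\<rho> \<in> partial_states (basis \<Gamma>)" and p: "0 \<le> p" "tr \<rho> + p \<le> 1"
    and L: "qop_family (basis \<Gamma>) UNIV L"
  shows "dr_lub \<Gamma> (\<lambda>n. (\<Sum>k<n. L k \<rho>) + (0, p)) = (\<Sum>\<^sub>\<infinity>k. L k \<rho>) + (0, p)"
proof -
  let ?B = "basis \<Gamma>" and ?S = "\<Sum>\<^sub>\<infinity>k. L k \<rho>"
  let ?X = "\<lambda>n. (\<Sum>k<n. L k \<rho>) + (0, p)" and ?d = "?S + (0, p)"
  note sums = qop_family_sums[OF L \<rho>]
  have valid: "fst (L k \<rho>) \<in> pos_trace_class ?B" "0 \<le> snd (L k \<rho>)" for k
    using L \<rho> by (auto simp: qop_family_def)
  have fst: "((\<lambda>k. fst (L k \<rho>)) has_sum fst ?S) UNIV" and snd: "((\<lambda>k. snd (L k \<rho>)) has_sum snd ?S) UNIV"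
    using has_sum_bounded_linear[OF bounded_linear_fst sums(1)] has_sum_bounded_linear[OF bounded_linear_snd sums(1)] .
  have d_DR: "?d \<in> DR \<Gamma>"
    using sums(2-4) p \<rho> tr_nonneg[OF sums(2)] by (auto simp: DR_iff ps_iff)
  have upper: "dr_le (?X n) ?d" for n
  proof -
    have "positive (fst ?S - (\<Sum>k<n. fst (L k \<rho>)))"
      by (rule positive_has_sum[OF has_sum_Diff[OF fst has_sum_finite]]) (auto intro: ptc_positive valid)
    moreover have "(\<Sum>k<n. snd (L k \<rho>)) \<le> snd ?S"
      by (rule finite_sum_le_has_sum[OF snd]) (auto intro: valid)
    ultimately show ?thesis
      by (simp add: dr_le_def loewner_def fst_sum snd_sum)
  qed
  have least: "dr_le ?d d'" if "\<forall>n. dr_le (?X n) d'" for d'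
  proof -
    have "positive (fst d' - (\<Sum>k<n. fst (L k \<rho>)))" and le: "(\<Sum>k<n. snd (L k \<rho>)) + p \<le> snd d'" for n
      using that by (auto simp: dr_le_def loewner_def fst_sum snd_sum)
    then have pos: "cinner x ((fst d' - (\<Sum>k<n. fst (L k \<rho>))) x) \<in> \<real>\<^sub>\<ge>\<^sub>0" for n x
      by (auto simp: positive_def)
    have "cinner x ((fst d' - fst ?S) x) \<in> \<real>\<^sub>\<ge>\<^sub>0" for x
    proof (rule Lim_in_closed_set)
      show "closed (\<real>\<^sub>\<ge>\<^sub>0 :: complex set)"
        by (rule closed_nonneg_Reals_complex)
      show "\<forall>\<^sub>F n in sequentially. cinner x ((fst d' - (\<Sum>k<n. fst (L k \<rho>))) x) \<in> \<real>\<^sub>\<ge>\<^sub>0"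
        using pos by simp
      have "(\<lambda>n. fst d' - (\<Sum>k<n. fst (L k \<rho>))) \<longlonglongrightarrow> fst d' - fst ?S"
        using has_sum_imp_sums[OF fst] unfolding sums_def by (intro tendsto_intros)
      then show "(\<lambda>n. cinner x ((fst d' - (\<Sum>k<n. fst (L k \<rho>))) x)) \<longlonglongrightarrow> cinner x ((fst d' - fst ?S) x)"
        by (intro bounded_linear.tendsto[OF bounded_linear_cinner_right]
            bounded_linear.tendsto[OF blinfun.bounded_linear_left])
    qed simp
    moreover have "snd ?S + p \<le> snd d'"
      using has_sum_imp_sums[OF snd] le unfolding sums_def
      by (intro LIMSEQ_le_const2[OF tendsto_add[OF _ tendsto_const]]) auto
    ultimately show ?thesis
      by (simp add: dr_le_def loewner_def positive_def)
  qed
  show ?thesis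
    unfolding dr_lub_def
  proof (rule the_equality)
    show "?d \<in> DR \<Gamma> \<and> (\<forall>n. dr_le (?X n) ?d) \<and> (\<forall>d'\<in>DR \<Gamma>. (\<forall>n. dr_le (?X n) d') \<longrightarrow> dr_le ?d d')"
      using d_DR upper least by blast
    fix d assume d: "d \<in> DR \<Gamma> \<and> (\<forall>n. dr_le (?X n) d) \<and> (\<forall>d'\<in>DR \<Gamma>. (\<forall>n. dr_le (?X n) d') \<longrightarrow> dr_le d d')"
    then have "dr_le d ?d" "dr_le ?d d"
      using d_DR upper least by blast+
    moreover have "op_on ?B (fst d)" "op_on ?B (fst ?d)"
      using d d_DR by (auto simp: DR_iff ps_iff dest!: ptc_op_on)
    ultimately show "d = ?d"
      using loewner_antisym[of ?B "fst d" "fst ?d"] by (auto simp: dr_le_def prod_eq_iff)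
  qed
qed

lemma loop_family:
  assumes "wf_prog \<Gamma> (While qs M0 M1 S)" "qop (basis \<Gamma>) (\<lambda>\<rho>. sem \<Gamma> S (\<rho>, 0))"
  shows "qop_family (basis \<Gamma>) UNIV (loop_term (extend_op \<Gamma> qs M0) (extend_op \<Gamma> qs M1) (sem \<Gamma> S))"
proof -
  have "kraus (basis \<Gamma>) UNIV (\<lambda>b. extend_op \<Gamma> qs (if b then M1 else M0))"
    using assms by (auto intro: extend_op_kraus[OF _ measurement_kraus])
  then have "kraus (basis \<Gamma>) UNIV (\<lambda>b. if b then extend_op \<Gamma> qs M1 else extend_op \<Gamma> qs M0)"
    by (simp add: if_distrib cong: if_cong)
  from qop_family_loop[OF this assms(2)] show ?thesis .
qed

lemma sem_While:
  assumes "wf_prog \<Gamma> (While qs M0 M1 S)" "qop (basis \<Gamma>) (\<lambda>\<rho>. sem \<Gamma> S (\<rho>, 0))"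
    and "\<rho> \<in> partial_states (basis \<Gamma>)" "0 \<le> p" "tr \<rho> + p \<le> 1"
  shows "sem \<Gamma> (While qs M0 M1 S) (\<rho>, p) =
    (\<Sum>\<^sub>\<infinity>k. loop_term (extend_op \<Gamma> qs M0) (extend_op \<Gamma> qs M1) (sem \<Gamma> S) k \<rho>) + (0, p)"
  using dr_lub_sums[OF assms(3-5) loop_family[OF assms(1,2)]] by (simp add: loop_approx_eq)

text \<open>The second claim is proved along with the first because a sequential composition hands a
  nonzero error to its second component. It is confined to tr \<rho> + p \<le> 1, where the series
  of a loop stays in \<open>DR\<close> and can be its least upper bound there.\<close>

lemma sem_qop:
  assumes "wf_prog \<Gamma> S"
  shows "qop (basis \<Gamma>) (\<lambda>\<rho>. sem \<Gamma> S (\<rho>, 0)) \<and>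
    (\<forall>\<rho>\<in>partial_states (basis \<Gamma>). \<forall>p. 0 \<le> p \<longrightarrow> tr \<rho> + p \<le> 1 \<longrightarrow> sem \<Gamma> S (\<rho>, p) = sem \<Gamma> S (\<rho>, 0) + (0, p))"
  using assms
proof (induction S)
  case Skip
  show ?case
    by (auto simp: qop_def ps_linear_def ps_iff)
next
  case (Init q)
  then have q: "q \<in> dom \<Gamma>"
    by simp
  have skip: "qop (basis \<Gamma>) (\<lambda>\<rho>. (\<rho>, 0))"
    by (auto simp: qop_def ps_linear_def ps_iff)
  note fam = qop_family_kraus[OF extend_op_kraus[OF register_single[OF q] init_kraus] skip]
  have "init_op \<Gamma> q \<rho> = fst (\<Sum>\<^sub>\<infinity>n\<in>vals (the (\<Gamma> q)). (conj_op (extend_op \<Gamma> [q] (ketbra [0] [n])) \<rho>, 0 :: real))"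
    "snd (\<Sum>\<^sub>\<infinity>n\<in>vals (the (\<Gamma> q)). (conj_op (extend_op \<Gamma> [q] (ketbra [0] [n])) \<rho>, 0 :: real)) = 0"
    if "\<rho> \<in> partial_states (basis \<Gamma>)" for \<rho>
    using has_sum_bounded_linear[OF bounded_linear_fst qop_family_has_sum[OF fam that], THEN infsumI]
      has_sum_bounded_linear[OF bounded_linear_snd qop_family_has_sum[OF fam that], THEN infsumI]
    by (simp_all add: init_op_eq[OF q])
  then have eq: "sem \<Gamma> (Init q) (\<rho>, p) =
      (\<Sum>\<^sub>\<infinity>n\<in>vals (the (\<Gamma> q)). (conj_op (extend_op \<Gamma> [q] (ketbra [0] [n])) \<rho>, 0)) + (0, p)"
    if "\<rho> \<in> partial_states (basis \<Gamma>)" for \<rho> p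
    using that by (simp add: prod_eq_iff)
  have "qop (basis \<Gamma>) (\<lambda>\<rho>. sem \<Gamma> (Init q) (\<rho>, 0))"
    by (rule qop_cong[OF _ qop_family_qop[OF fam]]) (simp add: eq zero_prod_def[symmetric] del: sem.simps)
  then show ?case
    by simp
next
  case (Unitary qs U)
  then have "kraus (basis \<Gamma>) (UNIV :: unit set) (\<lambda>_. extend_op \<Gamma> qs U)"
    by (auto intro: extend_op_kraus[OF _ unitary_kraus])
  from ps_map_kraus[OF this UNIV_I] have "ps_map (basis \<Gamma>) (conj_op (extend_op \<Gamma> qs U))" .
  then show ?case
    by (auto simp: qop_def ps_map_def ps_linear_def)
next
  case (Observe qs R)
  then have reg: "register \<Gamma> qs" and R: "projection_on (reg_basis \<Gamma> qs) R"
    by auto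
  then have "op_on (reg_basis \<Gamma> qs) R"
    by (simp add: projection_on_def)
  then have m: "ps_map (basis \<Gamma>) (conj_op (extend_op \<Gamma> qs R))"
    using reg projection_contraction[OF R]
    by (intro ps_map_conj_op extend_op_on extend_op_contraction) auto
  then show ?case
    by (auto simp: qop_def ps_map_def ps_linear_def ps_iff tr_add[of _ "basis \<Gamma>"] tr_scaleR[of _ "basis \<Gamma>"] algebra_simps)
next
  case (Seq S1 S2)
  let ?B = "basis \<Gamma>"
  have 1: "qop ?B (\<lambda>\<rho>. sem \<Gamma> S1 (\<rho>, 0))" and 2: "qop ?B (\<lambda>\<rho>. sem \<Gamma> S2 (\<rho>, 0))"
    and shift1: "\<And>\<rho> p. \<rho> \<in> partial_states ?B \<Longrightarrow> 0 \<le> p \<Longrightarrow> tr \<rho> + p \<le> 1 \<Longrightarrow> sem \<Gamma> S1 (\<rho>, p) = sem \<Gamma> S1 (\<rho>, 0) + (0, p)"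
    and shift2: "\<And>\<rho> p. \<rho> \<in> partial_states ?B \<Longrightarrow> 0 \<le> p \<Longrightarrow> tr \<rho> + p \<le> 1 \<Longrightarrow> sem \<Gamma> S2 (\<rho>, p) = sem \<Gamma> S2 (\<rho>, 0) + (0, p)"
    using Seq.prems conjunct1[OF Seq.IH(1)] conjunct1[OF Seq.IH(2)] conjunct2[OF Seq.IH(1)] conjunct2[OF Seq.IH(2)]
    unfolding wf_prog.simps by blast+
  have eq: "sem \<Gamma> (Seq S1 S2) (\<rho>, p) = sem \<Gamma> S2 (fst (sem \<Gamma> S1 (\<rho>, 0)), 0) + (0, snd (sem \<Gamma> S1 (\<rho>, 0))) + (0, p)"
    if \<rho>: "\<rho> \<in> partial_states ?B" "0 \<le> p" "tr \<rho> + p \<le> 1" for \<rho> p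
  proof -
    note d = qopD[OF 1 \<rho>(1)]
    have "sem \<Gamma> (Seq S1 S2) (\<rho>, p) = sem \<Gamma> S2 (fst (sem \<Gamma> S1 (\<rho>, 0)), snd (sem \<Gamma> S1 (\<rho>, 0)) + p)"
      using shift1[OF \<rho>] by (simp add: plus_prod_def)
    also have "\<dots> = sem \<Gamma> S2 (fst (sem \<Gamma> S1 (\<rho>, 0)), 0) + (0, snd (sem \<Gamma> S1 (\<rho>, 0)) + p)"
      using d \<rho> by (intro shift2) auto
    finally show ?thesis
      by (simp add: prod_eq_iff)
  qed
  have "qop ?B (\<lambda>\<rho>. sem \<Gamma> (Seq S1 S2) (\<rho>, 0))"
    by (rule qop_cong[OF _ qop_seq[OF 1 2]]) (simp add: eq ps_iff zero_prod_def[symmetric] del: sem.simps)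
  then show ?case
    by (auto simp: eq ps_iff zero_prod_def[symmetric] simp del: sem.simps)
next
  case (Measure qs I M Ss)
  have kr: "kraus (basis \<Gamma>) I (\<lambda>m. extend_op \<Gamma> qs (M m))"
    using Measure.prems by (auto intro: extend_op_kraus[OF _ measurement_kraus])
  have "qop (basis \<Gamma>) (\<lambda>\<rho>. sem \<Gamma> (Ss m) (\<rho>, 0))" if "m \<in> I" for m
    using Measure.prems that by (intro conjunct1[OF Measure.IH]) auto
  from qop_family_qop[OF qop_family_kraus[OF kr this]]
  have "qop (basis \<Gamma>) (\<lambda>\<rho>. \<Sum>\<^sub>\<infinity>m\<in>I. sem \<Gamma> (Ss m) (conj_op (extend_op \<Gamma> qs (M m)) \<rho>, 0))" .
  then show ?case
    by (simp add: zero_prod_def[symmetric])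
next
  case (While qs M0 M1 S)
  let ?B = "basis \<Gamma>" and ?M0 = "extend_op \<Gamma> qs M0" and ?M1 = "extend_op \<Gamma> qs M1"
  have S: "qop ?B (\<lambda>\<rho>. sem \<Gamma> S (\<rho>, 0))"
    using While.prems by (intro conjunct1[OF While.IH]) simp
  note fam = loop_family[OF While.prems S] and eq = sem_While[OF While.prems S]
  have "qop ?B (\<lambda>\<rho>. sem \<Gamma> (While qs M0 M1 S) (\<rho>, 0))"
    by (rule qop_cong[OF _ qop_family_qop[OF fam]]) (simp add: eq ps_iff zero_prod_def[symmetric] del: sem.simps)
  then show ?case
    by (auto simp: eq ps_iff zero_prod_def[symmetric] simp del: sem.simps)
qed

section \<open>Expected payoffs of the Markov chain\<close>

text \<open>Unlike \<open>step\<close>, this chain rests in terminated and violating configurations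
  instead of moving on to the sink, so the outcome of a run can be read off the configuration after
  \<open>n\<close> steps.\<close>

primrec run :: "'v qctx \<Rightarrow> nat \<Rightarrow> ('v, 'm) conf \<Rightarrow> ('v, 'm) conf pmf" where
  "run \<Gamma> 0 c = return_pmf c"
| "run \<Gamma> (Suc n) c = (case c of
      Conf (Some S) \<sigma> \<Rightarrow> bind_pmf (prog_step \<Gamma> S \<sigma>) (run \<Gamma> n)
    | _ \<Rightarrow> return_pmf c)"

text \<open>Values in \<open>ennreal\<close> allow \<open>h\<close> to be infinite on operators
  about which nothing is known, and make suprema and integrals meaningful without integrability
  conditions.\<close>

fun payoff :: "(('v \<Rightarrow> int) op \<Rightarrow> ennreal) \<Rightarrow> ennreal \<Rightarrow> ('v, 'm) conf \<Rightarrow> ennreal" where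
  "payoff h v (Conf None \<sigma>) = h \<sigma>"
| "payoff h v (Conf (Some S) \<sigma>) = 0"
| "payoff h v Viol = v"
| "payoff h v Sink = 0"

definition exp_payoff :: "'v qctx \<Rightarrow> (('v \<Rightarrow> int) op \<Rightarrow> ennreal) \<Rightarrow> ennreal \<Rightarrow> nat \<Rightarrow> ('v, 'm) conf \<Rightarrow> ennreal" where
  "exp_payoff \<Gamma> h v n c = (\<integral>\<^sup>+c'. payoff h v c' \<partial>measure_pmf (run \<Gamma> n c))"

lemma exp_payoff_simps [simp]:
  "exp_payoff \<Gamma> h v n (Conf None \<sigma>) = h \<sigma>" "exp_payoff \<Gamma> h v n Viol = v" "exp_payoff \<Gamma> h v n Sink = 0"
  "exp_payoff \<Gamma> h v 0 (Conf (Some S) \<sigma>) = 0"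
  "exp_payoff \<Gamma> h v (Suc n) (Conf (Some S) \<sigma>) =
    (\<integral>\<^sup>+c. exp_payoff \<Gamma> h v n c \<partial>measure_pmf (prog_step \<Gamma> S \<sigma>))"
  by (cases n; simp add: exp_payoff_def)+

lemma exp_payoff_mono:
  assumes "\<And>\<sigma>. h \<sigma> \<le> h' \<sigma>"
  shows "exp_payoff \<Gamma> h v n c \<le> exp_payoff \<Gamma> h' v n c"
proof -
  have "payoff h v c' \<le> payoff h' v c'" for c'
    by (cases "(h, v, c')" rule: payoff.cases) (use assms in auto)
  then show ?thesis
    unfolding exp_payoff_def by (intro nn_integral_mono) auto
qed

lemma conf_cases [case_names Run Done Viol Sink]:
  obtains S \<sigma> where "c = Conf (Some S) \<sigma>" | \<sigma> where "c = Conf None \<sigma>" | "c = Viol" | "c = Sink"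
  by (cases c; cases "case c of Conf x _ \<Rightarrow> x | _ \<Rightarrow> None") auto

lemma exp_payoff_Suc: "exp_payoff \<Gamma> h v n c \<le> exp_payoff \<Gamma> h v (Suc n) c"
proof (induction n arbitrary: c)
  case 0
  show ?case
    by (cases c rule: conf_cases) auto
next
  case (Suc n)
  show ?case
    by (cases c rule: conf_cases) (auto intro!: nn_integral_mono Suc)
qed

lemma incseq_exp_payoff: "incseq (\<lambda>n. exp_payoff \<Gamma> h v n c)"
  by (rule incseq_SucI) (rule exp_payoff_Suc)

definition total_payoff :: "'v qctx \<Rightarrow> (('v \<Rightarrow> int) op \<Rightarrow> ennreal) \<Rightarrow> ennreal \<Rightarrow> ('v, 'm) conf \<Rightarrow> ennreal" where
  "total_payoff \<Gamma> h v c = (SUP n. exp_payoff \<Gamma> h v n c)"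

lemma exp_le_total_payoff: "exp_payoff \<Gamma> h v n c \<le> total_payoff \<Gamma> h v c"
  unfolding total_payoff_def by (rule SUP_upper) simp

lemma exp_payoff_LIMSEQ: "(\<lambda>n. exp_payoff \<Gamma> h v n c) \<longlonglongrightarrow> total_payoff \<Gamma> h v c"
  unfolding total_payoff_def by (rule LIMSEQ_SUP[OF incseq_exp_payoff])

lemma total_payoff_simps [simp]:
  "total_payoff \<Gamma> h v (Conf None \<sigma>) = h \<sigma>" "total_payoff \<Gamma> h v Viol = v" "total_payoff \<Gamma> h v Sink = 0"
  by (simp_all add: total_payoff_def)

lemma total_payoff_step:
  "total_payoff \<Gamma> h v (Conf (Some S) \<sigma>) = (\<integral>\<^sup>+c. total_payoff \<Gamma> h v c \<partial>measure_pmf (prog_step \<Gamma> S \<sigma>))"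
proof -
  have "(\<lambda>n. exp_payoff \<Gamma> h v (Suc n) (Conf (Some S) \<sigma>)) \<longlonglongrightarrow> total_payoff \<Gamma> h v (Conf (Some S) \<sigma>)"
    using exp_payoff_LIMSEQ by (rule LIMSEQ_Suc)
  moreover have "(\<lambda>n. exp_payoff \<Gamma> h v (Suc n) (Conf (Some S) \<sigma>)) \<longlonglongrightarrow>
      (\<integral>\<^sup>+c. total_payoff \<Gamma> h v c \<partial>measure_pmf (prog_step \<Gamma> S \<sigma>))"
  proof -
    have "(\<integral>\<^sup>+c. total_payoff \<Gamma> h v c \<partial>measure_pmf (prog_step \<Gamma> S \<sigma>)) =
        (SUP n. \<integral>\<^sup>+c. exp_payoff \<Gamma> h v n c \<partial>measure_pmf (prog_step \<Gamma> S \<sigma>))"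
      unfolding total_payoff_def
      by (rule nn_integral_monotone_convergence_SUP)
        (auto intro!: incseq_SucI le_funI exp_payoff_Suc simp del: exp_payoff_simps(5))
    also have "\<dots> = (SUP n. exp_payoff \<Gamma> h v (Suc n) (Conf (Some S) \<sigma>))"
      by simp
    finally show ?thesis
      by (simp only:) (rule LIMSEQ_SUP[OF incseq_SucI], rule exp_payoff_Suc)
  qed
  ultimately show ?thesis
    by (rule LIMSEQ_unique)
qed

lemma total_payoff_mono: "(\<And>\<sigma>. h \<sigma> \<le> h' \<sigma>) \<Longrightarrow> total_payoff \<Gamma> h v c \<le> total_payoff \<Gamma> h' v c"
  unfolding total_payoff_def by (intro SUP_mono) (auto intro: exp_payoff_mono)

text \<open>The two components share the \<open>n\<close> steps. Granting \<open>n\<close> steps to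
  each gives an upper bound, which is tight only in the limit.\<close>

lemma exp_payoff_seq_le:
  "exp_payoff \<Gamma> h v n (seq_conf S2 c) \<le> exp_payoff \<Gamma> (\<lambda>\<sigma>. exp_payoff \<Gamma> h v n (Conf (Some S2) \<sigma>)) v n c"
proof (induction n arbitrary: c)
  case 0
  show ?case
    by (cases c rule: conf_cases) auto
next
  case (Suc n)
  show ?case
  proof (cases c rule: conf_cases)
    case (Run S1 \<sigma>)
    have "exp_payoff \<Gamma> h v n (seq_conf S2 c') \<le>
        exp_payoff \<Gamma> (\<lambda>\<sigma>. exp_payoff \<Gamma> h v (Suc n) (Conf (Some S2) \<sigma>)) v n c'" for c'
      by (rule order_trans[OF Suc exp_payoff_mono[OF exp_payoff_Suc]])
    then show ?thesis
      unfolding Run seq_conf.simps exp_payoff_simps(5)[of \<Gamma> _ v n "Seq S1 S2"]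
        exp_payoff_simps(5)[of \<Gamma> _ v n S1] prog_step.simps nn_integral_map_pmf
      by (intro nn_integral_mono)
  qed auto
qed

text \<open>\<open>n + m\<close> steps suffice for runs with at most \<open>n\<close> steps in the
  first and \<open>m\<close> in the second component; together with the previous bound this
  determines the limit.\<close>

lemma exp_payoff_seq_ge:
  "exp_payoff \<Gamma> (\<lambda>\<sigma>. exp_payoff \<Gamma> h v m (Conf (Some S2) \<sigma>)) v n c \<le> exp_payoff \<Gamma> h v (n + m) (seq_conf S2 c)"
proof (induction n arbitrary: c)
  case 0
  show ?case
    by (cases c rule: conf_cases) auto
next
  case (Suc n)
  show ?case
  proof (cases c rule: conf_cases)
    case (Run S1 \<sigma>)
    then show ?thesis
      by (auto intro!: nn_integral_mono Suc)
  next
    case (Done \<sigma>)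
    show ?thesis
      using Done incseqD[OF incseq_exp_payoff, of m "Suc n + m"] by (simp del: exp_payoff_simps(5))
  qed auto
qed

text \<open>The two step-indexed bounds meet in the limit. For the lower one, monotone convergence
  moves the supremum over the steps of \<open>S2\<close> through the expectation over the runs of
  \<open>S1\<close>.\<close>

lemma total_payoff_seq:
  "total_payoff \<Gamma> h v (Conf (Some (Seq S1 S2)) \<sigma>) =
    total_payoff \<Gamma> (\<lambda>\<sigma>. total_payoff \<Gamma> h v (Conf (Some S2) \<sigma>)) v (Conf (Some S1) \<sigma>)"
proof (rule antisym)
  show "total_payoff \<Gamma> h v (Conf (Some (Seq S1 S2)) \<sigma>) \<le>
    total_payoff \<Gamma> (\<lambda>\<sigma>. total_payoff \<Gamma> h v (Conf (Some S2) \<sigma>)) v (Conf (Some S1) \<sigma>)"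
    unfolding total_payoff_def[of \<Gamma> h v "Conf (Some (Seq S1 S2)) \<sigma>"]
  proof (rule SUP_least)
    fix n
    have "exp_payoff \<Gamma> h v n (Conf (Some (Seq S1 S2)) \<sigma>) \<le>
        exp_payoff \<Gamma> (\<lambda>\<sigma>. exp_payoff \<Gamma> h v n (Conf (Some S2) \<sigma>)) v n (Conf (Some S1) \<sigma>)"
      using exp_payoff_seq_le[of \<Gamma> h v n S2 "Conf (Some S1) \<sigma>"] by simp
    also have "\<dots> \<le> exp_payoff \<Gamma> (\<lambda>\<sigma>. total_payoff \<Gamma> h v (Conf (Some S2) \<sigma>)) v n (Conf (Some S1) \<sigma>)"
      by (rule exp_payoff_mono) (rule exp_le_total_payoff)
    also have "\<dots> \<le> total_payoff \<Gamma> (\<lambda>\<sigma>. total_payoff \<Gamma> h v (Conf (Some S2) \<sigma>)) v (Conf (Some S1) \<sigma>)"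
      by (rule exp_le_total_payoff)
    finally show "exp_payoff \<Gamma> h v n (Conf (Some (Seq S1 S2)) \<sigma>) \<le> \<dots>" .
  qed
  show "total_payoff \<Gamma> (\<lambda>\<sigma>. total_payoff \<Gamma> h v (Conf (Some S2) \<sigma>)) v (Conf (Some S1) \<sigma>) \<le>
    total_payoff \<Gamma> h v (Conf (Some (Seq S1 S2)) \<sigma>)"
    unfolding total_payoff_def[of \<Gamma> "\<lambda>\<sigma>. total_payoff \<Gamma> h v (Conf (Some S2) \<sigma>)"]
  proof (rule SUP_least)
    fix n
    have eq: "payoff (\<lambda>\<sigma>. total_payoff \<Gamma> h v (Conf (Some S2) \<sigma>)) v c =
        (SUP m. payoff (\<lambda>\<sigma>. exp_payoff \<Gamma> h v m (Conf (Some S2) \<sigma>)) v c)" for c :: "('a, 'b) conf"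
      by (cases c rule: conf_cases) (auto simp: total_payoff_def)
    have inc: "incseq (\<lambda>m (c :: ('a, 'b) conf). payoff (\<lambda>\<sigma>. exp_payoff \<Gamma> h v m (Conf (Some S2) \<sigma>)) v c)"
    proof (intro incseq_SucI le_funI)
      fix m c
      show "payoff (\<lambda>\<sigma>. exp_payoff \<Gamma> h v m (Conf (Some S2) \<sigma>)) v c \<le>
          payoff (\<lambda>\<sigma>. exp_payoff \<Gamma> h v (Suc m) (Conf (Some S2) \<sigma>)) v c"
        by (cases c rule: conf_cases) (auto simp del: exp_payoff_simps(5) intro: exp_payoff_Suc)
    qed
    have "exp_payoff \<Gamma> (\<lambda>\<sigma>. total_payoff \<Gamma> h v (Conf (Some S2) \<sigma>)) v n (Conf (Some S1) \<sigma>) =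
        (\<integral>\<^sup>+c. (SUP m. payoff (\<lambda>\<sigma>. exp_payoff \<Gamma> h v m (Conf (Some S2) \<sigma>)) v c)
          \<partial>measure_pmf (run \<Gamma> n (Conf (Some S1) \<sigma>)))"
      by (simp only: exp_payoff_def[of _ _ _ n] eq)
    also have "\<dots> = (SUP m. exp_payoff \<Gamma> (\<lambda>\<sigma>. exp_payoff \<Gamma> h v m (Conf (Some S2) \<sigma>)) v n (Conf (Some S1) \<sigma>))"
      unfolding exp_payoff_def[of _ _ _ n] by (rule nn_integral_monotone_convergence_SUP[OF inc]) simp
    also have "\<dots> \<le> total_payoff \<Gamma> h v (Conf (Some (Seq S1 S2)) \<sigma>)"
    proof (rule SUP_least)
      fix m
      show "exp_payoff \<Gamma> (\<lambda>\<sigma>. exp_payoff \<Gamma> h v m (Conf (Some S2) \<sigma>)) v n (Conf (Some S1) \<sigma>) \<le>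
          total_payoff \<Gamma> h v (Conf (Some (Seq S1 S2)) \<sigma>)"
        using exp_payoff_seq_ge[of \<Gamma> h v m S2 n "Conf (Some S1) \<sigma>"] exp_le_total_payoff order_trans
        unfolding seq_conf.simps by blast
    qed
    finally show "exp_payoff \<Gamma> (\<lambda>\<sigma>. total_payoff \<Gamma> h v (Conf (Some S2) \<sigma>)) v n (Conf (Some S1) \<sigma>) \<le>
      total_payoff \<Gamma> h v (Conf (Some (Seq S1 S2)) \<sigma>)" .
  qed
qed

section \<open>Expected payoffs of a single probabilistic step\<close>

lemma nn_integral_has_sum:
  assumes "(G has_sum s) I" "\<And>i. i \<in> I \<Longrightarrow> 0 \<le> G i"
  shows "(\<integral>\<^sup>+i. ennreal (if i \<in> I then G i else 0) \<partial>count_space UNIV) = ennreal s"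
proof -
  have "(\<lambda>i. norm (G i)) summable_on I"
    using assms has_sum_imp_summable[OF assms(1)] by (subst summable_on_cong[of _ _ G]) auto
  then have "Infinite_Set_Sum.abs_summable_on G I"
    by (rule abs_summable_equivalent[THEN iffD1])
  then have "(\<integral>\<^sup>+i. ennreal (G i) \<partial>count_space I) = ennreal s"
    using assms by (simp add: nn_integral_conv_infsetsum infsetsum_infsum infsumI)
  moreover have "(\<integral>\<^sup>+i. ennreal (if i \<in> I then G i else 0) \<partial>count_space UNIV) = (\<integral>\<^sup>+i. ennreal (G i) \<partial>count_space I)"
    by (auto simp: nn_integral_count_space_indicator[of I] intro!: nn_integral_cong split: split_indicator)
  ultimately show ?thesis
    by simp
qed

lemma states_ptc: "\<sigma> \<in> states B \<Longrightarrow> \<sigma> \<in> pos_trace_class B" and states_tr: "\<sigma> \<in> states B \<Longrightarrow> tr \<sigma> = 1"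
  and states_ps: "\<sigma> \<in> states B \<Longrightarrow> \<sigma> \<in> partial_states B"
  by (auto simp: states_def ps_iff)

text \<open>The completeness relation makes the weights sum to 1, so \<open>embed_pmf\<close> has
  the intended masses. The assumption on \<open>\<phi>\<close> concerns its product with the weight,
  which leaves it free at outcomes of probability 0.\<close>

lemma nn_integral_outcome:
  assumes \<sigma>: "\<sigma> \<in> states B" and M: "kraus B I M" and G: "(G has_sum s) I" "\<And>m. m \<in> I \<Longrightarrow> 0 \<le> G m"
    and \<phi>: "\<And>m. m \<in> I \<Longrightarrow> ennreal (tr (conj_op (M m) \<sigma>)) * \<phi> m = ennreal (G m)"
  shows "(\<integral>\<^sup>+m. \<phi> m \<partial>measure_pmf (outcome_pmf I M \<sigma>)) = ennreal s"
proof -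
  have nonneg: "0 \<le> tr (conj_op (M m) \<sigma>)" if "m \<in> I" for m
    using M that by (intro tr_nonneg[OF conj_op_ptc[OF states_ptc[OF \<sigma>]]]) (simp add: kraus_def)
  have "pmf (outcome_pmf I M \<sigma>) m = (if m \<in> I then tr (conj_op (M m) \<sigma>) else 0)" for m
    unfolding outcome_pmf_def
    using nn_integral_has_sum[OF kraus_tr[OF states_ptc[OF \<sigma>] M] nonneg] states_tr[OF \<sigma>]
    by (intro pmf_embed_pmf) (auto simp: nonneg)
  then have "(\<integral>\<^sup>+m. \<phi> m \<partial>measure_pmf (outcome_pmf I M \<sigma>)) =
      (\<integral>\<^sup>+m. ennreal (if m \<in> I then G m else 0) \<partial>count_space UNIV)"
    unfolding nn_integral_measure_pmf by (intro nn_integral_cong) (simp add: \<phi>)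
  also have "\<dots> = ennreal s"
    by (rule nn_integral_has_sum[OF G])
  finally show ?thesis .
qed

lemma ptc_tr_0: "\<rho> \<in> pos_trace_class B \<Longrightarrow> tr \<rho> = 0 \<Longrightarrow> \<rho> = 0"
  using norm_le_tr[of \<rho> B] by simp

text \<open>Homogeneity of \<open>f\<close> cancels the normalisation of the state after a
  measurement. At probability 0 the unnormalised operator is itself 0, so the quotient by 0 does no
  harm.\<close>

lemma post_state_scaled:
  assumes "ps_map B (conj_op A)" "\<sigma> \<in> states B" "ps_linear B f"
  shows "tr (conj_op A \<sigma>) *\<^sub>R f (post_state A \<sigma>) = f (conj_op A \<sigma>)"
    and "tr (conj_op A \<sigma>) \<noteq> 0 \<Longrightarrow> post_state A \<sigma> \<in> states B"
    and "0 \<le> tr (conj_op A \<sigma>)" "tr (conj_op A \<sigma>) \<le> 1"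
proof -
  let ?x = "conj_op A \<sigma>"
  have x: "?x \<in> partial_states B" "?x \<in> pos_trace_class B"
    using ps_map_ps[OF assms(1) states_ps[OF assms(2)]] by (auto simp: ps_iff)
  show t: "0 \<le> tr ?x" "tr ?x \<le> 1"
    using x tr_nonneg by (auto simp: ps_iff)
  show post: "post_state A \<sigma> \<in> states B" if "tr ?x \<noteq> 0"
    using that x t by (auto simp: post_state_def states_def ptc_scaleR tr_scaleR[of _ B])
  show "tr ?x *\<^sub>R f (post_state A \<sigma>) = f ?x"
  proof (cases "tr ?x = 0")
    case True
    then show ?thesis
      using ptc_tr_0[OF x(2)] ps_linear_0[OF assms(3)] by simp
  next
    case False
    have "f ?x = f (tr ?x *\<^sub>R post_state A \<sigma>)"
      using False by (simp add: post_state_def)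
    also have "\<dots> = tr ?x *\<^sub>R f (post_state A \<sigma>)"
      by (rule ps_linear_scaleR[OF assms(3) states_ps[OF post[OF False]] t])
    finally show ?thesis ..
  qed
qed

lemma post_state_payoff:
  assumes "ps_map B (conj_op A)" "\<sigma> \<in> states B" "ps_functional B K f"
    and "post_state A \<sigma> \<in> states B \<Longrightarrow> x = ennreal (f (post_state A \<sigma>))"
  shows "ennreal (tr (conj_op A \<sigma>)) * x = ennreal (f (conj_op A \<sigma>))"
proof -
  have "ps_linear B f"
    using assms(3) by (simp add: ps_functional_def)
  note post = post_state_scaled[OF assms(1,2) this]
  show ?thesis
  proof (cases "tr (conj_op A \<sigma>) = 0")
    case True
    then show ?thesis
      using post(1) by simp
  next
    case False
    then show ?thesis
      using post assms(4) by (simp add: ennreal_mult'[symmetric])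
  qed
qed

lemma ps_functional_mono_const:
  assumes "ps_functional B K g" "0 \<le> v" "\<rho> \<in> pos_trace_class B" "0 \<le> p" "tr \<rho> \<le> 1"
  shows "0 \<le> reward g v (\<rho>, p)" "reward g v (\<rho>, p) \<le> max K v * (tr \<rho> + p)"
proof -
  have "0 \<le> g \<rho>" "g \<rho> \<le> K * tr \<rho>"
    using assms by (auto simp: ps_functional_def ps_iff)
  moreover have "K * tr \<rho> \<le> max K v * tr \<rho>" "v * p \<le> max K v * p" "0 \<le> v * p"
    using assms tr_nonneg[of \<rho> B] by (auto intro!: mult_right_mono)
  ultimately show "0 \<le> reward g v (\<rho>, p)" "reward g v (\<rho>, p) \<le> max K v * (tr \<rho> + p)"
    by (auto simp: reward_def distrib_left)
qed

lemma ps_linear_reward: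
  assumes "ps_functional B K g" "ps_linear B D"
    and "\<And>\<rho>. \<rho> \<in> partial_states B \<Longrightarrow> fst (D \<rho>) \<in> pos_trace_class B \<and> tr (fst (D \<rho>)) \<le> tr \<rho>"
  shows "ps_linear B (\<lambda>\<rho>. reward g v (D \<rho>))"
proof -
  have "ps_map B (\<lambda>\<rho>. fst (D \<rho>))"
    using assms(2,3) by (auto simp: ps_map_def ps_linear_def)
  then have "ps_linear B (\<lambda>\<rho>. g (fst (D \<rho>)))"
    using assms(1) by (intro ps_linear_compose[of B "\<lambda>\<rho>. fst (D \<rho>)" g]) (auto simp: ps_functional_def)
  with assms(2) show ?thesis
    unfolding ps_linear_def reward_def by (simp add: distrib_left mult.left_commute)
qed

text \<open>The mass of \<rho> that ends up as a state or as an error is worth at most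
  \<open>K\<close> or \<open>v\<close> per unit, whence the constant. This makes the payoff of a
  continuation admissible for the program before it.\<close>

lemma reward_functional:
  assumes g: "ps_functional B K g" and D: "qop B D" and v: "0 \<le> v"
  shows "ps_functional B (max K v) (\<lambda>\<rho>. reward g v (D \<rho>))"
  unfolding ps_functional_def
proof (intro conjI ballI)
  show "ps_linear B (\<lambda>\<rho>. reward g v (D \<rho>))"
    using D qopD[OF D] by (intro ps_linear_reward[OF g]) (force simp: qop_def)+
  fix \<rho> assume \<rho>: "\<rho> \<in> partial_states B"
  note d = qopD[OF D \<rho>]
  have "tr (fst (D \<rho>)) \<le> 1"
    using d(4) by (simp add: ps_iff)
  note m = ps_functional_mono_const[OF g v d(1,2) this]
  from m show "0 \<le> reward g v (D \<rho>)"
    by simp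
  have "max K v * (tr (fst (D \<rho>)) + snd (D \<rho>)) \<le> max K v * tr \<rho>"
    using v d by (intro mult_left_mono) auto
  with m show "reward g v (D \<rho>) \<le> max K v * tr \<rho>"
    by simp
qed

text \<open>The counterpart for finitely many rounds of a loop: the body is run with the reward of
  the remaining rounds as its payoff.\<close>

lemma reward_family_functional:
  assumes g: "ps_functional B K g" and L: "qop_family B I L" and v: "0 \<le> v" and N: "finite N" "N \<subseteq> I"
  shows "ps_functional B (max K v) (\<lambda>\<rho>. \<Sum>k\<in>N. reward g v (L k \<rho>))"
  unfolding ps_functional_def
proof (intro conjI ballI)
  have valid: "fst (L k \<rho>) \<in> pos_trace_class B" "0 \<le> snd (L k \<rho>)" "tr (fst (L k \<rho>)) \<le> tr \<rho>"
    if "k \<in> N" "\<rho> \<in> partial_states B" for k \<rho>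
  proof -
    have *: "fst (L k \<rho>) \<in> pos_trace_class B" "0 \<le> snd (L k \<rho>)"
      using L that N by (auto simp: qop_family_def)
    moreover have "\<forall>F. finite F \<longrightarrow> F \<subseteq> I \<longrightarrow> (\<Sum>i\<in>F. tr (fst (L i \<rho>)) + snd (L i \<rho>)) \<le> tr \<rho>"
      using L that(2) by (simp add: qop_family_def)
    then have "(\<Sum>i\<in>{k}. tr (fst (L i \<rho>)) + snd (L i \<rho>)) \<le> tr \<rho>"
      using that(1) N by blast
    ultimately show "fst (L k \<rho>) \<in> pos_trace_class B" "0 \<le> snd (L k \<rho>)" "tr (fst (L k \<rho>)) \<le> tr \<rho>"
      by auto
  qed
  have lin: "ps_linear B (\<lambda>\<rho>. reward g v (L k \<rho>))" if "k \<in> N" for k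
    using L N that valid by (intro ps_linear_reward[OF g]) (auto simp: qop_family_def)
  show "ps_linear B (\<lambda>\<rho>. \<Sum>k\<in>N. reward g v (L k \<rho>))"
    unfolding ps_linear_def
  proof (intro conjI ballI impI)
    fix \<rho> \<rho>' assume *: "\<rho> \<in> partial_states B" "\<rho>' \<in> partial_states B" "\<rho> + \<rho>' \<in> partial_states B"
    have "(\<Sum>k\<in>N. reward g v (L k (\<rho> + \<rho>'))) = (\<Sum>k\<in>N. reward g v (L k \<rho>) + reward g v (L k \<rho>'))"
      using lin * unfolding ps_linear_def by (intro sum.cong refl) blast
    then show "(\<Sum>k\<in>N. reward g v (L k (\<rho> + \<rho>'))) = (\<Sum>k\<in>N. reward g v (L k \<rho>)) + (\<Sum>k\<in>N. reward g v (L k \<rho>'))"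
      by (simp add: sum.distrib)
  next
    fix \<rho> and t :: real assume *: "\<rho> \<in> partial_states B" "t \<in> {0..1}"
    have "(\<Sum>k\<in>N. reward g v (L k (t *\<^sub>R \<rho>))) = (\<Sum>k\<in>N. t *\<^sub>R reward g v (L k \<rho>))"
      using lin * unfolding ps_linear_def by (intro sum.cong refl) blast
    then show "(\<Sum>k\<in>N. reward g v (L k (t *\<^sub>R \<rho>))) = t *\<^sub>R (\<Sum>k\<in>N. reward g v (L k \<rho>))"
      by (simp add: sum_distrib_left)
  qed
  fix \<rho> assume \<rho>: "\<rho> \<in> partial_states B"
  have m: "0 \<le> reward g v (L k \<rho>)" "reward g v (L k \<rho>) \<le> max K v * (tr (fst (L k \<rho>)) + snd (L k \<rho>))" if "k \<in> N" for k
  proof -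
    have "tr (fst (L k \<rho>)) \<le> 1"
      using valid(3)[OF that \<rho>] \<rho> by (simp add: ps_iff)
    from ps_functional_mono_const[OF g v valid(1,2)[OF that \<rho>] this]
    show "0 \<le> reward g v (L k \<rho>)" "reward g v (L k \<rho>) \<le> max K v * (tr (fst (L k \<rho>)) + snd (L k \<rho>))"
      by auto
  qed
  then show "0 \<le> (\<Sum>k\<in>N. reward g v (L k \<rho>))"
    by (intro sum_nonneg) auto
  have "(\<Sum>k\<in>N. reward g v (L k \<rho>)) \<le> max K v * (\<Sum>k\<in>N. tr (fst (L k \<rho>)) + snd (L k \<rho>))"
    unfolding sum_distrib_left by (intro sum_mono m)
  also have "\<dots> \<le> max K v * tr \<rho>"
    using v L \<rho> N by (intro mult_left_mono) (auto simp: qop_family_def)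
  finally show "(\<Sum>k\<in>N. reward g v (L k \<rho>)) \<le> max K v * tr \<rho>" .
qed

lemma kraus_states:
  assumes "kraus B (UNIV :: unit set) (\<lambda>_. A)" "\<sigma> \<in> states B"
  shows "conj_op A \<sigma> \<in> states B"
  using assms kraus_tr[OF states_ptc[OF assms(2)] assms(1)]
  by (simp add: states_def has_sum_unit_iff conj_op_ptc kraus_def)

lemma init_op_states:
  assumes "q \<in> dom \<Gamma>" "\<sigma> \<in> states (basis \<Gamma>)"
  shows "init_op \<Gamma> q \<sigma> \<in> states (basis \<Gamma>)"
proof -
  note kr = extend_op_kraus[OF register_single[OF assms(1)] init_kraus]
  note tr = kraus_tr[OF states_ptc[OF assms(2)] kr]
  have "conj_op (extend_op \<Gamma> [q] (ketbra [0] [n])) \<sigma> \<in> pos_trace_class (basis \<Gamma>)" if "n \<in> vals (the (\<Gamma> q))" for n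
    using kr that by (intro conj_op_ptc states_ptc assms) (auto simp: kraus_def)
  from ptc_infsum[OF this tr] tr_infsum[OF this tr] show ?thesis
    using assms(2) by (simp add: states_def init_op_eq[OF assms(1)])
qed

text \<open>For loops, both the expected payoff of \<open>n\<close> steps and the reward of the first \<open>n\<close> unfoldings are
  monotone in \<open>n\<close>, and the latter is squeezed between the former and its supremum.\<close>

lemma total_payoff_sem:
  fixes \<Gamma> :: "'v qctx" and S :: "('v, 'm) prog" and h :: "('v \<Rightarrow> int) op \<Rightarrow> ennreal"
  assumes "wf_prog \<Gamma> S" "ps_functional (basis \<Gamma>) K g" "\<And>\<sigma>. \<sigma> \<in> states (basis \<Gamma>) \<Longrightarrow> h \<sigma> = ennreal (g \<sigma>)" "0 \<le> v"
    "\<sigma> \<in> states (basis \<Gamma>)"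
  shows "total_payoff \<Gamma> h (ennreal v) (Conf (Some S) \<sigma>) = ennreal (reward g v (sem \<Gamma> S (\<sigma>, 0)))"
  using assms
proof (induction S arbitrary: K g h \<sigma>)
  case Skip
  then show ?case
    by (simp add: total_payoff_step reward_def)
next
  case (Init q)
  then show ?case
    by (simp add: total_payoff_step reward_def init_op_states)
next
  case (Unitary qs U)
  then have "kraus (basis \<Gamma>) (UNIV :: unit set) (\<lambda>_. extend_op \<Gamma> qs U)"
    by (auto intro: extend_op_kraus[OF _ unitary_kraus])
  from kraus_states[OF this] Unitary show ?case
    by (simp add: total_payoff_step reward_def)
next
  case (Observe qs R)
  let ?B = "basis \<Gamma>" and ?R = "extend_op \<Gamma> qs R"
  have "register \<Gamma> qs" "projection_on (reg_basis \<Gamma> qs) R" "op_on (reg_basis \<Gamma> qs) R"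
    using Observe.prems by (auto simp: projection_on_def)
  then have m: "ps_map ?B (conj_op ?R)"
    by (intro ps_map_conj_op extend_op_on extend_op_contraction projection_contraction) auto
  have "ps_linear ?B g"
    using Observe.prems by (simp add: ps_functional_def)
  note post = post_state_scaled[OF m Observe.prems(5) this]
  have "ennreal (tr (conj_op ?R \<sigma>)) * h (post_state ?R \<sigma>) = ennreal (g (conj_op ?R \<sigma>))"
    by (rule post_state_payoff[OF m Observe.prems(5,2)]) (rule Observe.prems(3))
  moreover have "0 \<le> g (conj_op ?R \<sigma>)"
    using Observe.prems(2) ps_map_ps[OF m states_ps[OF Observe.prems(5)]] by (simp add: ps_functional_def)
  moreover have "tr \<sigma> = 1"
    using Observe.prems(5) by (rule states_tr)
  ultimately show ?case
    using post(3,4) Observe.prems(4)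
    by (simp add: total_payoff_step reward_def ennreal_mult'[symmetric] ennreal_plus[symmetric] 
        mult.commute del: ennreal_plus)
next
  case (Seq S1 S2)
  let ?B = "basis \<Gamma>"
  have wf: "wf_prog \<Gamma> S1" "wf_prog \<Gamma> S2"
    using Seq.prems by auto
  note q1 = conjunct1[OF sem_qop[OF wf(1)]] and q2 = conjunct1[OF sem_qop[OF wf(2)]]
  let ?g = "\<lambda>\<rho>. reward g v (sem \<Gamma> S2 (\<rho>, 0))"
  have g': "ps_functional ?B (max K v) ?g"
    by (rule reward_functional[OF Seq.prems(2) q2 Seq.prems(4)])
  have "total_payoff \<Gamma> h (ennreal v) (Conf (Some (Seq S1 S2)) \<sigma>) =
      total_payoff \<Gamma> (\<lambda>\<sigma>. total_payoff \<Gamma> h (ennreal v) (Conf (Some S2) \<sigma>)) (ennreal v) (Conf (Some S1) \<sigma>)"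
    by (rule total_payoff_seq)
  also have "\<dots> = ennreal (reward ?g v (sem \<Gamma> S1 (\<sigma>, 0)))"
    using Seq.IH(2)[OF wf(2) Seq.prems(2,3,4)] by (intro Seq.IH(1)[OF wf(1) g' _ Seq.prems(4,5)])
  also have "reward ?g v (sem \<Gamma> S1 (\<sigma>, 0)) = reward g v (sem \<Gamma> (Seq S1 S2) (\<sigma>, 0))"
  proof -
    note d = qopD[OF q1 states_ps[OF Seq.prems(5)]]
    have "sem \<Gamma> (Seq S1 S2) (\<sigma>, 0) = sem \<Gamma> S2 (fst (sem \<Gamma> S1 (\<sigma>, 0)), snd (sem \<Gamma> S1 (\<sigma>, 0)))"
      by simp
    also have "\<dots> = sem \<Gamma> S2 (fst (sem \<Gamma> S1 (\<sigma>, 0)), 0) + (0, snd (sem \<Gamma> S1 (\<sigma>, 0)))"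
      using d states_tr[OF Seq.prems(5)] by (intro conjunct2[OF sem_qop[OF wf(2)], rule_format]) auto
    finally show ?thesis
      by (simp add: reward_def distrib_left del: sem.simps)
  qed
  finally show ?case .
next
  case (Measure qs I M Ss)
  let ?B = "basis \<Gamma>" and ?M = "\<lambda>m. extend_op \<Gamma> qs (M m)"
  have kr: "kraus ?B I ?M"
    using Measure.prems by (auto intro: extend_op_kraus[OF _ measurement_kraus])
  have wf: "wf_prog \<Gamma> (Ss m)" if "m \<in> I" for m
    using Measure.prems that by auto
  note q = conjunct1[OF sem_qop[OF wf]]
  note fam = qop_family_kraus[OF kr q]
  let ?f = "\<lambda>m \<rho>. reward g v (sem \<Gamma> (Ss m) (\<rho>, 0))"
  have f: "ps_functional ?B (max K v) (?f m)" if "m \<in> I" for m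
    by (rule reward_functional[OF Measure.prems(2) q[OF that] Measure.prems(4)])
  have "total_payoff \<Gamma> h (ennreal v) (Conf (Some (Measure qs I M Ss)) \<sigma>) =
      (\<integral>\<^sup>+m. total_payoff \<Gamma> h (ennreal v) (Conf (Some (Ss m)) (post_state (?M m) \<sigma>)) \<partial>measure_pmf (outcome_pmf I ?M \<sigma>))"
    by (simp add: total_payoff_step[of _ _ _ "Measure qs I M Ss"])
  also have "\<dots> = ennreal (reward g v (\<Sum>\<^sub>\<infinity>m\<in>I. sem \<Gamma> (Ss m) (conj_op (?M m) \<sigma>, 0)))"
  proof (rule nn_integral_outcome[OF Measure.prems(5) kr qop_family_reward[OF fam states_ps[OF Measure.prems(5)] Measure.prems(2)]])
    fix m assume m: "m \<in> I"
    note pm = ps_map_kraus[OF kr m]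
    show "0 \<le> ?f m (conj_op (?M m) \<sigma>)"
      using f[OF m] ps_map_ps[OF pm states_ps[OF Measure.prems(5)]] by (simp add: ps_functional_def)
    show "ennreal (tr (conj_op (?M m) \<sigma>)) *
        total_payoff \<Gamma> h (ennreal v) (Conf (Some (Ss m)) (post_state (?M m) \<sigma>)) = ennreal (?f m (conj_op (?M m) \<sigma>))"
      by (rule post_state_payoff[OF pm Measure.prems(5) f[OF m]])
        (rule Measure.IH[OF rangeI wf[OF m] Measure.prems(2,3,4)])
  qed
  finally show ?case
    by (simp add: zero_prod_def[symmetric])
next
  case (While qs M0 M1 S)
  let ?B = "basis \<Gamma>" and ?Mz = "extend_op \<Gamma> qs M0" and ?Mo = "extend_op \<Gamma> qs M1"
  let ?W = "While qs M0 M1 S" and ?F = "sem \<Gamma> S" and ?v = "ennreal v"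
  let ?M = "\<lambda>b. extend_op \<Gamma> qs (if b then M1 else M0)"
  have wf: "wf_prog \<Gamma> S"
    using While.prems by simp
  have kr: "kraus ?B UNIV ?M"
    using While.prems by (auto intro: extend_op_kraus[OF _ measurement_kraus])
  note q = conjunct1[OF sem_qop[OF wf]]
  note fam = loop_family[OF While.prems(1) q]
  \<comment> \<open>The reward of the first \<open>n\<close> rounds. The induction hypothesis for
    the body is applied with \<open>H n\<close> as payoff instead of \<open>g\<close>.\<close>
  define H where "H n \<rho> = (\<Sum>k<n. reward g v (loop_term ?Mz ?Mo ?F k \<rho>))" for n \<rho>
  have H: "ps_functional ?B (max K v) (H n)" for n
    unfolding H_def[abs_def] by (rule reward_family_functional[OF While.prems(2) fam While.prems(4)]) auto
  have H_Suc: "H (Suc n) \<rho> = g (conj_op ?Mz \<rho>) + reward (H n) v (?F (conj_op ?Mo \<rho>, 0))" for n \<rho>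
  proof -
    have "loop_term ?Mz ?Mo ?F (Suc k) \<rho> = loop_term ?Mz ?Mo ?F k (fst (?F (conj_op ?Mo \<rho>, 0)))" for k
      by (simp add: loop_term_def funpow_swap1) (simp add: loop_body_def)
    then show ?thesis
      unfolding H_def sum.lessThan_Suc_shift by (simp add: reward_def) (simp add: loop_term_def)
  qed
  have lim: "(\<lambda>n. H n \<sigma>) \<longlonglongrightarrow> reward g v (sem \<Gamma> ?W (\<sigma>, 0))" if "\<sigma> \<in> states ?B" for \<sigma>
  proof -
    have "sem \<Gamma> ?W (\<sigma>, 0) = (\<Sum>\<^sub>\<infinity>k. loop_term ?Mz ?Mo ?F k \<sigma>)"
      using sem_While[OF While.prems(1) q states_ps[OF that], of 0] states_tr[OF that]
      by (simp add: zero_prod_def[symmetric] del: sem.simps)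
    then show ?thesis
      using has_sum_imp_sums[OF qop_family_reward[OF fam states_ps[OF that] While.prems(2), of v]]
      unfolding H_def sums_def by simp
  qed
  \<comment> \<open>One round with payoff \<open>H n\<close> after the body. Only the values of
    \<open>h'\<close> on states matter, so both bounds below can use this computation.\<close>
  have step: "(\<integral>\<^sup>+b. (if b then total_payoff \<Gamma> h' ?v (Conf (Some S) (post_state ?Mo \<sigma>)) else h (post_state ?Mz \<sigma>))
        \<partial>measure_pmf (outcome_pmf UNIV ?M \<sigma>)) = ennreal (H (Suc n) \<sigma>)"
    if h': "\<And>\<sigma>. \<sigma> \<in> states ?B \<Longrightarrow> h' \<sigma> = ennreal (H n \<sigma>)" and \<sigma>: "\<sigma> \<in> states ?B" for h' n \<sigma>
  proof (rule nn_integral_outcome[OF \<sigma> kr])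
    let ?f1 = "\<lambda>\<rho>. reward (H n) v (?F (\<rho>, 0))"
    let ?G = "\<lambda>b. if b then ?f1 (conj_op ?Mo \<sigma>) else g (conj_op ?Mz \<sigma>)"
    have f1: "ps_functional ?B (max (max K v) v) ?f1"
      by (rule reward_functional[OF H q While.prems(4)])
    have pm: "ps_map ?B (conj_op ?Mz)" "ps_map ?B (conj_op ?Mo)"
      using ps_map_kraus[OF kr, of False] ps_map_kraus[OF kr, of True] by auto
    show "(?G has_sum H (Suc n) \<sigma>) UNIV"
      by (rule has_sum_finiteI) (simp_all add: UNIV_bool H_Suc)
    show "0 \<le> ?G b" for b
      using f1 While.prems(2) ps_map_ps[OF pm(1) states_ps[OF \<sigma>]] ps_map_ps[OF pm(2) states_ps[OF \<sigma>]]
      by (simp add: ps_functional_def)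
    have "ennreal (tr (conj_op ?Mz \<sigma>)) * h (post_state ?Mz \<sigma>) = ennreal (g (conj_op ?Mz \<sigma>))"
      by (rule post_state_payoff[OF pm(1) \<sigma> While.prems(2)]) (rule While.prems(3))
    moreover have "ennreal (tr (conj_op ?Mo \<sigma>)) * total_payoff \<Gamma> h' ?v (Conf (Some S) (post_state ?Mo \<sigma>)) =
        ennreal (?f1 (conj_op ?Mo \<sigma>))"
      by (rule post_state_payoff[OF pm(2) \<sigma> f1]) (rule While.IH[OF wf H h' While.prems(4)])
    ultimately show "ennreal (tr (conj_op (?M b) \<sigma>)) *
        (if b then total_payoff \<Gamma> h' ?v (Conf (Some S) (post_state ?Mo \<sigma>)) else h (post_state ?Mz \<sigma>)) = ennreal (?G b)" for b
      by simp
  qed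
  have upper: "exp_payoff \<Gamma> h ?v n (Conf (Some ?W) \<sigma>) \<le> ennreal (H n \<sigma>)" if "\<sigma> \<in> states ?B" for n \<sigma>
    using that
  proof (induction n arbitrary: \<sigma>)
    case (Suc n)
    \<comment> \<open>Nothing is known about operators that are not states. Giving them the value
      \<top> makes the comparison of payoffs hold everywhere.\<close>
    define h' where "h' \<sigma> = (if \<sigma> \<in> states ?B then ennreal (H n \<sigma>) else \<top>)" for \<sigma>
    have le: "exp_payoff \<Gamma> h ?v n (Conf (Some (Seq S ?W)) \<sigma>') \<le> total_payoff \<Gamma> h' ?v (Conf (Some S) \<sigma>')" for \<sigma>'
    proof -
      have "exp_payoff \<Gamma> h ?v n (Conf (Some (Seq S ?W)) \<sigma>') \<le>
          exp_payoff \<Gamma> (\<lambda>\<sigma>. exp_payoff \<Gamma> h ?v n (Conf (Some ?W) \<sigma>)) ?v n (Conf (Some S) \<sigma>')"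
        using exp_payoff_seq_le[of \<Gamma> h ?v n ?W "Conf (Some S) \<sigma>'"] by simp
      also have "\<dots> \<le> exp_payoff \<Gamma> h' ?v n (Conf (Some S) \<sigma>')"
        using Suc.IH by (intro exp_payoff_mono) (auto simp: h'_def)
      also have "\<dots> \<le> total_payoff \<Gamma> h' ?v (Conf (Some S) \<sigma>')"
        by (rule exp_le_total_payoff)
      finally show ?thesis .
    qed
    have "exp_payoff \<Gamma> h ?v (Suc n) (Conf (Some ?W) \<sigma>) \<le>
        (\<integral>\<^sup>+b. (if b then total_payoff \<Gamma> h' ?v (Conf (Some S) (post_state ?Mo \<sigma>)) else h (post_state ?Mz \<sigma>))
          \<partial>measure_pmf (outcome_pmf UNIV ?M \<sigma>))"
      by (simp add: exp_payoff_simps(5)[of _ _ _ _ ?W]) (intro nn_integral_mono, simp add: le)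
    also have "\<dots> = ennreal (H (Suc n) \<sigma>)"
      by (rule step) (auto simp: h'_def Suc.prems)
    finally show ?case .
  qed simp
  have lower: "ennreal (H n \<sigma>) \<le> total_payoff \<Gamma> h ?v (Conf (Some ?W) \<sigma>)" if "\<sigma> \<in> states ?B" for n \<sigma>
    using that
  proof (induction n arbitrary: \<sigma>)
    case 0
    then show ?case by (simp add: H_def)
  next
    case (Suc n)
    \<comment> \<open>Dually, for a lower bound the value off the states is 0.\<close>
    define h' where "h' \<sigma> = (if \<sigma> \<in> states ?B then ennreal (H n \<sigma>) else 0)" for \<sigma>
    have le: "total_payoff \<Gamma> h' ?v (Conf (Some S) \<sigma>') \<le> total_payoff \<Gamma> h ?v (Conf (Some (Seq S ?W)) \<sigma>')" for \<sigma>'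
      unfolding total_payoff_seq using Suc.IH by (intro total_payoff_mono) (auto simp: h'_def)
    have "ennreal (H (Suc n) \<sigma>) =
        (\<integral>\<^sup>+b. (if b then total_payoff \<Gamma> h' ?v (Conf (Some S) (post_state ?Mo \<sigma>)) else h (post_state ?Mz \<sigma>))
          \<partial>measure_pmf (outcome_pmf UNIV ?M \<sigma>))"
      by (rule step[symmetric]) (auto simp: h'_def Suc.prems)
    also have "\<dots> \<le> total_payoff \<Gamma> h ?v (Conf (Some ?W) \<sigma>)"
      by (simp add: total_payoff_step[of _ _ _ ?W]) (intro nn_integral_mono, simp add: le)
    finally show ?case .
  qed
  have lim': "(\<lambda>n. ennreal (H n \<sigma>)) \<longlonglongrightarrow> ennreal (reward g v (sem \<Gamma> ?W (\<sigma>, 0)))"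
    by (intro tendsto_ennrealI lim While.prems)
  show ?case
  proof (rule antisym)
    show "total_payoff \<Gamma> h ?v (Conf (Some ?W) \<sigma>) \<le> ennreal (reward g v (sem \<Gamma> ?W (\<sigma>, 0)))"
      by (rule LIMSEQ_le[OF exp_payoff_LIMSEQ lim']) (blast intro: upper[OF While.prems(5)])
    show "ennreal (reward g v (sem \<Gamma> ?W (\<sigma>, 0))) \<le> total_payoff \<Gamma> h ?v (Conf (Some ?W) \<sigma>)"
      using lim' lower[OF While.prems(5)] by (intro LIMSEQ_le_const2) auto
  qed
qed

section \<open>Reachability probabilities\<close>

text \<open>The expectation of 1 if \<open>T\<close> is visited within \<open>n\<close> steps, and
  of \<open>\<phi>\<close> at the last position otherwise. The terminal value \<open>\<phi>\<close>
  is there to absorb further steps of the path.\<close>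

primrec hit :: "('s \<Rightarrow> 's pmf) \<Rightarrow> 's set \<Rightarrow> ('s \<Rightarrow> ennreal) \<Rightarrow> nat \<Rightarrow> 's \<Rightarrow> ennreal" where
  "hit K T \<phi> 0 s = (if s \<in> T then 1 else \<phi> s)"
| "hit K T \<phi> (Suc n) s = (if s \<in> T then 1 else \<integral>\<^sup>+x. hit K T \<phi> n x \<partial>measure_pmf (K s))"

text \<open>Unfolds the recursion at its far end: the last step of a path is absorbed into the
  terminal value.\<close>

lemma hit_Suc: "hit K T (\<lambda>x. \<integral>\<^sup>+y. hit K T \<phi> 0 y \<partial>measure_pmf (K x)) n s = hit K T \<phi> (Suc n) s"
proof (induction n arbitrary: s)
  case (Suc n)
  have "hit K T (\<lambda>x. \<integral>\<^sup>+y. hit K T \<phi> 0 y \<partial>measure_pmf (K x)) (Suc n) s =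
      (if s \<in> T then 1 else \<integral>\<^sup>+x. hit K T \<phi> (Suc n) x \<partial>measure_pmf (K s))"
    unfolding hit.simps(2)[of K T _ n] Suc ..
  then show ?case
    by (simp only: hit.simps(2)[of K T \<phi> "Suc n"])
qed simp

lemma path_prefix_measurable:
  fixes \<phi> :: "'s \<Rightarrow> ennreal"
  shows "(\<lambda>\<omega>. if \<exists>k\<le>n. \<omega> k \<in> T then 1 else \<phi> (\<omega> n)) \<in> borel_measurable (PiM {0..<Suc n} (\<lambda>_. count_space UNIV))"
proof -
  have comp: "(\<lambda>\<omega>. \<omega> k) \<in> PiM {0..<Suc n} (\<lambda>_. count_space UNIV) \<rightarrow>\<^sub>M count_space UNIV" if "k \<le> n" for k
    using that by (intro measurable_component_singleton) simp
  have "(\<lambda>\<omega>. \<omega> k \<in> T) \<in> PiM {0..<Suc n} (\<lambda>_. count_space UNIV) \<rightarrow>\<^sub>M count_space UNIV" if "k \<le> n" for k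
    by (rule measurable_compose[OF comp[OF that]]) simp
  then have P: "Measurable.pred (PiM {0..<Suc n} (\<lambda>_. count_space UNIV)) (\<lambda>\<omega>. \<exists>k\<in>{..n}. \<omega> k \<in> T)"
    by (intro pred_intros_finite) auto
  have eq: "(\<exists>k\<in>{..n}. \<omega> k \<in> T) \<longleftrightarrow> (\<exists>k\<le>n. \<omega> k \<in> T)" for \<omega> :: "nat \<Rightarrow> 's"
    by auto
  have \<phi>: "(\<lambda>\<omega>. \<phi> (\<omega> n)) \<in> borel_measurable (PiM {0..<Suc n} (\<lambda>_. count_space UNIV))"
    by (rule measurable_compose[OF comp]) simp_all
  show ?thesis
    by (rule measurable_If[OF measurable_const \<phi>]) (use P in \<open>simp_all only: pred_def eq space_borel UNIV_I\<close>)
qed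

text \<open>Path prefixes grow at their last coordinate, whereas \<open>hit\<close> recurses on the
  first step. With \<open>\<phi>\<close> arbitrary, the integral over the last coordinate becomes a
  new terminal value, and \<open>hit_Suc\<close> restores the recursion.\<close>

lemma nn_integral_path_prefix:
  "(\<integral>\<^sup>+\<omega>. (if \<exists>k\<le>n. \<omega> k \<in> T then 1 else \<phi> (\<omega> n)) \<partial>paths.C K s 0 (Suc n) (\<lambda>_. undefined)) = hit K T \<phi> n s"
proof (induction n arbitrary: \<phi>)
  have u: "(\<lambda>_. undefined) \<in> space (PiM {0..<0::nat} (\<lambda>_. count_space UNIV))"
    by (simp add: space_PiM)
  \<comment> \<open>The distribution of \<open>Suc m\<close> coordinates is that of \<open>m\<close>
    coordinates followed by the extension kernel \<open>paths.eP\<close>, so the last coordinate can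
    be integrated out first.\<close>
  have step: "(\<integral>\<^sup>+\<omega>. f \<omega> \<partial>paths.C K s 0 (Suc m) (\<lambda>_. undefined)) =
      (\<integral>\<^sup>+\<omega>. (\<integral>\<^sup>+y. f (fun_upd \<omega> m y) \<partial>path_kernel K s m \<omega>) \<partial>paths.C K s 0 m (\<lambda>_. undefined))"
    if f: "f \<in> borel_measurable (PiM {0..<Suc m} (\<lambda>_. count_space UNIV))" for f :: "_ \<Rightarrow> ennreal" and m
  proof -
    have sp: "space (paths.C K s 0 m (\<lambda>_. undefined)) = space (PiM {0..<m} (\<lambda>_. count_space UNIV))"
      using paths.space_C[OF u, of K s m] by simp
    have "paths.eP K s m \<in> paths.C K s 0 m (\<lambda>_. undefined) \<rightarrow>\<^sub>M subprob_algebra (PiM {0..<Suc m} (\<lambda>_. count_space UNIV))"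
      using paths.measurable_eP[of K s m] paths.sets_C[OF u, of K s m] by (simp cong: measurable_cong_sets)
    then have "(\<integral>\<^sup>+\<omega>. f \<omega> \<partial>paths.C K s 0 (Suc m) (\<lambda>_. undefined)) =
        (\<integral>\<^sup>+\<omega>. \<integral>\<^sup>+x. f x \<partial>paths.eP K s m \<omega> \<partial>paths.C K s 0 m (\<lambda>_. undefined))"
      using f by (simp add: nn_integral_bind[where B = "PiM {0..<Suc m} (\<lambda>_. count_space UNIV)"])
    also have "\<dots> = (\<integral>\<^sup>+\<omega>. (\<integral>\<^sup>+y. f (fun_upd \<omega> m y) \<partial>path_kernel K s m \<omega>) \<partial>paths.C K s 0 m (\<lambda>_. undefined))"
      using f sp by (intro nn_integral_cong paths.nn_integral_eP) auto
    finally show ?thesis .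
  qed
  {
    case 0
    have "(\<integral>\<^sup>+\<omega>. (if \<exists>k\<le>0. \<omega> k \<in> T then 1 else \<phi> (\<omega> 0)) \<partial>paths.C K s 0 (Suc 0) (\<lambda>_. undefined)) =
      (\<integral>\<^sup>+\<omega>. (\<integral>\<^sup>+y. (if \<exists>k\<le>0. (fun_upd \<omega> 0 y) k \<in> T then 1 else \<phi> ((fun_upd \<omega> 0 y) 0))
        \<partial>path_kernel K s 0 \<omega>) \<partial>paths.C K s 0 0 (\<lambda>_. undefined))"
      by (rule step[OF path_prefix_measurable])
    also have "\<dots> = (\<integral>\<^sup>+\<omega>. hit K T \<phi> 0 s \<partial>paths.C K s 0 0 (\<lambda>_. undefined))"
      by (intro nn_integral_cong) (simp add: path_kernel_def)
    also have "\<dots> = hit K T \<phi> 0 s"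
      unfolding nn_integral_const prob_space.emeasure_space_1[OF paths.prob_space_C[OF u]] by (rule mult_1_right)
    finally show ?case .
  next
    case (Suc n)
    let ?\<phi> = "\<lambda>x. \<integral>\<^sup>+y. hit K T \<phi> 0 y \<partial>measure_pmf (K x)"
    have "(\<integral>\<^sup>+\<omega>. (if \<exists>k\<le>Suc n. \<omega> k \<in> T then 1 else \<phi> (\<omega> (Suc n))) \<partial>paths.C K s 0 (Suc (Suc n)) (\<lambda>_. undefined)) =
      (\<integral>\<^sup>+\<omega>. (\<integral>\<^sup>+y. (if \<exists>k\<le>Suc n. (fun_upd \<omega> (Suc n) y) k \<in> T then 1 else \<phi> ((fun_upd \<omega> (Suc n) y) (Suc n)))
        \<partial>path_kernel K s (Suc n) \<omega>) \<partial>paths.C K s 0 (Suc n) (\<lambda>_. undefined))"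
      by (rule step[OF path_prefix_measurable])
    also have "\<dots> = (\<integral>\<^sup>+\<omega>. (if \<exists>k\<le>n. \<omega> k \<in> T then 1 else ?\<phi> (\<omega> n)) \<partial>paths.C K s 0 (Suc n) (\<lambda>_. undefined))"
    proof (rule nn_integral_cong)
      fix \<omega> :: "nat \<Rightarrow> 'a"
      have eq: "(\<exists>k\<le>Suc n. (fun_upd \<omega> (Suc n) y) k \<in> T) \<longleftrightarrow> (\<exists>k\<le>n. \<omega> k \<in> T) \<or> y \<in> T" for y
      proof -
        have "(\<exists>k\<le>n. (fun_upd \<omega> (Suc n) y) k \<in> T) \<longleftrightarrow> (\<exists>k\<le>n. \<omega> k \<in> T)"
          by (intro ex_cong) auto
        then show ?thesis
          by (simp only: le_Suc_eq ex_disj_distrib conj_disj_distribR) simp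
      qed
      show "(\<integral>\<^sup>+y. (if \<exists>k\<le>Suc n. (fun_upd \<omega> (Suc n) y) k \<in> T then 1 else \<phi> ((fun_upd \<omega> (Suc n) y) (Suc n)))
          \<partial>path_kernel K s (Suc n) \<omega>) = (if \<exists>k\<le>n. \<omega> k \<in> T then 1 else ?\<phi> (\<omega> n))"
      proof (cases "\<exists>k\<le>n. \<omega> k \<in> T")
        case True
        then show ?thesis
          unfolding eq fun_upd_same by (simp add: path_kernel_def)
      next
        case False
        then have F: "(\<exists>k\<le>n. \<omega> k \<in> T) = False"
          by blast
        show ?thesis
          unfolding eq fun_upd_same F path_kernel_def by (simp only: simp_thms if_False nat.case hit.simps(1))
      qed
    qed
    also have "\<dots> = hit K T \<phi> (Suc n) s"
      by (rule trans[OF Suc[of ?\<phi>] hit_Suc])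
    finally show ?case .
  }
qed

section \<open>The measure on infinite paths\<close>

lemma sets_path_measure: "sets (path_measure K s) = sets (PiM UNIV (\<lambda>_. count_space UNIV))"
  unfolding path_measure_def by (rule paths.PF.sets_lim)

lemma space_path_measure: "space (path_measure K s) = UNIV"
  using sets_eq_imp_space_eq[OF sets_path_measure, of K s] by (simp add: space_PiM)

text \<open>The event is a cylinder over the coordinates 0 to \<open>n\<close>, so the projective
  limit measures it by its finite-dimensional marginal.\<close>

lemma emeasure_path_prefix:
  "emeasure (path_measure K s) {\<omega>. \<exists>k\<le>n. \<omega> k \<in> T} = hit K T (\<lambda>_. 0) n s"
proof -
  let ?J = "{0..<Suc n}" and ?M = "\<lambda>_. count_space UNIV :: 'a measure"
  let ?X = "{\<omega>\<in>space (PiM ?J ?M). \<exists>k\<le>n. \<omega> k \<in> T}"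
  have u: "(\<lambda>_. undefined) \<in> space (PiM {0..<0::nat} ?M)"
    by (simp add: space_PiM)
  have f: "(\<lambda>\<omega>. if \<exists>k\<le>n. \<omega> k \<in> T then 1 else 0 :: ennreal) \<in> borel_measurable (PiM ?J ?M)"
    using path_prefix_measurable[of n T "\<lambda>_. 0"] .
  have sets: "sets (paths.C K s 0 (Suc n) (\<lambda>_. undefined)) = sets (PiM ?J ?M)"
    using paths.sets_C[OF u, of K s "Suc n"] by (simp only: add_0)
  have vimage: "?X = (\<lambda>\<omega>. if \<exists>k\<le>n. \<omega> k \<in> T then 1 else 0 :: ennreal) -` {1} \<inter> space (PiM ?J ?M)"
    by (auto split: if_splits)
  have X: "?X \<in> sets (PiM ?J ?M)"
    unfolding vimage by (rule measurable_sets[OF f]) simp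
  have "prod_emb UNIV ?M ?J ?X = {\<omega>. \<exists>k\<le>n. \<omega> k \<in> T}"
    by (auto simp: prod_emb_def space_PiM PiE_iff restrict_def extensional_def less_Suc_eq_le)
  then have "emeasure (path_measure K s) {\<omega>. \<exists>k\<le>n. \<omega> k \<in> T} = emeasure (paths.CI K s ?J) ?X"
    unfolding path_measure_def using paths.lim[OF _ X] by simp
  also have "\<dots> = emeasure (paths.C K s 0 (Suc n) (\<lambda>_. undefined)) (prod_emb ?J ?M ?J ?X)"
    by (rule paths.emeasure_CI[OF _ X]) simp
  also have "prod_emb ?J ?M ?J ?X = ?X"
    by (rule prod_emb_id) (auto simp: space_PiM)
  also have "emeasure (paths.C K s 0 (Suc n) (\<lambda>_. undefined)) ?X =
      (\<integral>\<^sup>+\<omega>. indicator ?X \<omega> \<partial>paths.C K s 0 (Suc n) (\<lambda>_. undefined))"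
    by (intro nn_integral_indicator[symmetric]) (simp only: sets X)
  also have "\<dots> = (\<integral>\<^sup>+\<omega>. (if \<exists>k\<le>n. \<omega> k \<in> T then 1 else 0) \<partial>paths.C K s 0 (Suc n) (\<lambda>_. undefined))"
  proof (rule nn_integral_cong)
    fix \<omega> assume "\<omega> \<in> space (paths.C K s 0 (Suc n) (\<lambda>_. undefined))"
    then have "\<omega> \<in> space (PiM ?J ?M)"
      by (simp only: sets_eq_imp_space_eq[OF sets])
    then show "indicator ?X \<omega> = (if \<exists>k\<le>n. \<omega> k \<in> T then 1 else 0 :: ennreal)"
      by (simp only: indicator_def of_bool_def mem_Collect_eq simp_thms)
  qed
  also have "\<dots> = hit K T (\<lambda>_. 0) n s"
    by (rule nn_integral_path_prefix[where \<phi> = "\<lambda>_. 0"])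
  finally show ?thesis .
qed

lemma path_prefix_sets: "{\<omega>. \<exists>k\<le>n. \<omega> k \<in> T} \<in> sets (path_measure K s)"
proof -
  have "(\<lambda>\<omega>. \<omega> k) -` T \<inter> space (PiM UNIV (\<lambda>_. count_space UNIV)) \<in> sets (PiM UNIV (\<lambda>_. count_space UNIV))" for k :: nat
    by (rule measurable_sets[OF measurable_component_singleton]) auto
  then have "(\<Union>k\<in>{..n}. (\<lambda>\<omega>. \<omega> k) -` T) \<in> sets (path_measure K s)"
    unfolding sets_path_measure by (intro sets.finite_UN) (auto simp: space_PiM)
  also have "(\<Union>k\<in>{..n}. (\<lambda>\<omega>. \<omega> k) -` T) = {\<omega>. \<exists>k\<le>n. \<omega> k \<in> T}"
    by auto
  finally show ?thesis .
qed

text \<open>Visiting \<open>UNIV\<close> at time 0 is certain, so the prefix formula yields the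
  total mass.\<close>

lemma prob_space_path_measure: "prob_space (path_measure K s)"
  using emeasure_path_prefix[of K s 0 UNIV] by (intro prob_spaceI) (simp add: space_path_measure)

lemma hit_LIMSEQ: "(\<lambda>n. hit K T (\<lambda>_. 0) n s) \<longlonglongrightarrow> ennreal (reach_prob K s T)"
proof -
  interpret prob_space "path_measure K s"
    by (rule prob_space_path_measure)
  have "(\<lambda>n. emeasure (path_measure K s) {\<omega>. \<exists>k\<le>n. \<omega> k \<in> T}) \<longlonglongrightarrow>
      emeasure (path_measure K s) (\<Union>n. {\<omega>. \<exists>k\<le>n. \<omega> k \<in> T})"
    using path_prefix_sets by (intro Lim_emeasure_incseq) (auto intro!: incseq_SucI le_SucI)
  moreover have "(\<Union>n. {\<omega> :: nat \<Rightarrow> 'a. \<exists>k\<le>n. \<omega> k \<in> T}) = {\<omega>. \<exists>n. \<omega> n \<in> T}"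
  proof (intro set_eqI iffI)
    fix \<omega> :: "nat \<Rightarrow> 'a" assume "\<omega> \<in> {\<omega>. \<exists>n. \<omega> n \<in> T}"
    then obtain n where "\<omega> n \<in> T"
      by blast
    then show "\<omega> \<in> (\<Union>n. {\<omega>. \<exists>k\<le>n. \<omega> k \<in> T})"
      by (intro UN_I[of n]) auto
  qed blast
  ultimately show ?thesis
    by (simp add: emeasure_path_prefix reach_prob_def emeasure_eq_measure)
qed

lemma reach_prob_nonneg: "0 \<le> reach_prob K s T"
  by (simp add: reach_prob_def)

section \<open>Hitting probabilities of the program chain\<close>

lemma hit_Sink: "Sink \<notin> T \<Longrightarrow> hit (step \<Gamma>) T (\<lambda>_. 0) n Sink = 0"
  by (induction n) simp_all

lemma hit_exp_payoff:
  assumes "Sink \<notin> T" "\<And>S \<sigma>. Conf (Some S) \<sigma> \<notin> T"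
  shows "hit (step \<Gamma>) T (\<lambda>_. 0) n c = exp_payoff \<Gamma> (\<lambda>\<sigma>. indicator T (Conf None \<sigma>)) (indicator T Viol) n c"
proof (induction n arbitrary: c)
  case 0
  show ?case
    using assms by (cases c rule: conf_cases) auto
next
  case (Suc n)
  show ?case
    using assms hit_Sink[OF assms(1), of \<Gamma> n] by (cases c rule: conf_cases) (auto simp: Suc intro!: nn_integral_cong)
qed

lemma seq_conf_Sink: "Sink = seq_conf S2 c \<longleftrightarrow> c = Sink"
  by (cases c rule: conf_cases) auto

lemma prog_step_not_Sink: "Sink \<notin> set_pmf (prog_step \<Gamma> S \<sigma>)"
  by (induction S arbitrary: \<sigma>) (auto simp: seq_conf_Sink image_iff split: if_splits)

text \<open>Termination and violation both lead to the sink in exactly one further step, whence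
  \<open>Suc n\<close>.\<close>

lemma exp_payoff_le_hit_Sink: "exp_payoff \<Gamma> (\<lambda>_. 1) 1 n c \<le> hit (step \<Gamma>) {Sink} (\<lambda>_. 0) (Suc n) c"
proof (induction n arbitrary: c)
  case 0
  show ?case
    by (cases c rule: conf_cases) auto
next
  case (Suc n)
  show ?case
  proof (cases c rule: conf_cases)
    case (Run S \<sigma>)
    then show ?thesis
      using Suc by (simp del: hit.simps(2) add: hit.simps(2)[of _ _ _ "Suc n"] nn_integral_mono)
  qed auto
qed

text \<open>By \<open>prog_step_not_Sink\<close> the sink is entered only after termination or
  violation. The sink is excluded as a start: its hitting probability is 1 but its payoff 0.\<close>

lemma hit_Sink_le_exp_payoff: "c \<noteq> Sink \<Longrightarrow> hit (step \<Gamma>) {Sink} (\<lambda>_. 0) n c \<le> exp_payoff \<Gamma> (\<lambda>_. 1) 1 n c"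
proof (induction n arbitrary: c)
  case 0
  then show ?case by simp
next
  case (Suc n)
  have Sink: "hit (step \<Gamma>) {Sink} (\<lambda>_. 0) n Sink = 1" for n
    by (cases n) auto
  show ?case
  proof (cases c rule: conf_cases)
    case (Run S \<sigma>)
    have "(\<integral>\<^sup>+c. hit (step \<Gamma>) {Sink} (\<lambda>_. 0) n c \<partial>measure_pmf (prog_step \<Gamma> S \<sigma>)) \<le>
        (\<integral>\<^sup>+c. exp_payoff \<Gamma> (\<lambda>_. 1) 1 n c \<partial>measure_pmf (prog_step \<Gamma> S \<sigma>))"
      using prog_step_not_Sink[of \<Gamma> S \<sigma>] Suc.IH by (intro nn_integral_mono_AE) (auto simp: AE_measure_pmf_iff intro!: Suc.IH)
    with Run show ?thesis
      by simp
  qed (use Suc.prems in \<open>auto simp: Sink\<close>)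
qed

lemma Pr_reach_total_payoff:
  "ennreal (Pr_reach \<Gamma> S \<rho> (Conf None \<rho>')) = total_payoff \<Gamma> (\<lambda>\<sigma>. if \<sigma> = \<rho>' then 1 else 0) 0 (Conf (Some S) \<rho>)"
  "ennreal (Pr_reach \<Gamma> S \<rho> Viol) = total_payoff \<Gamma> (\<lambda>_. 0) 1 (Conf (Some S) \<rho>)"
  "ennreal (Pr_reach \<Gamma> S \<rho> Sink) = total_payoff \<Gamma> (\<lambda>_. 1) 1 (Conf (Some S) \<rho>)"
proof -
  let ?c = "Conf (Some S) \<rho> :: ('a, 'b) conf"
  have "(\<lambda>\<sigma>. indicator {Conf None \<rho>'} (Conf None \<sigma> :: ('a, 'b) conf) :: ennreal) = (\<lambda>\<sigma>. if \<sigma> = \<rho>' then 1 else 0)"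
    by (auto simp: indicator_def)
  then show "ennreal (Pr_reach \<Gamma> S \<rho> (Conf None \<rho>')) = total_payoff \<Gamma> (\<lambda>\<sigma>. if \<sigma> = \<rho>' then 1 else 0) 0 ?c"
    using hit_LIMSEQ[of "step \<Gamma>" "{Conf None \<rho>'}" ?c] hit_exp_payoff[of "{Conf None \<rho>'}" \<Gamma> _ ?c]
    by (auto simp: Pr_reach_def intro: LIMSEQ_unique exp_payoff_LIMSEQ)
  show "ennreal (Pr_reach \<Gamma> S \<rho> Viol) = total_payoff \<Gamma> (\<lambda>_. 0) 1 ?c"
    using hit_LIMSEQ[of "step \<Gamma>" "{Viol}" ?c] hit_exp_payoff[of "{Viol}" \<Gamma> _ ?c]
    by (auto simp: Pr_reach_def intro: LIMSEQ_unique exp_payoff_LIMSEQ)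
  show "ennreal (Pr_reach \<Gamma> S \<rho> Sink) = total_payoff \<Gamma> (\<lambda>_. 1) 1 ?c"
    unfolding Pr_reach_def
  proof (rule antisym)
    show "ennreal (reach_prob (step \<Gamma>) ?c {Sink}) \<le> total_payoff \<Gamma> (\<lambda>_. 1) 1 ?c"
      by (rule LIMSEQ_le[OF hit_LIMSEQ exp_payoff_LIMSEQ]) (auto intro: hit_Sink_le_exp_payoff)
    show "total_payoff \<Gamma> (\<lambda>_. 1) 1 ?c \<le> ennreal (reach_prob (step \<Gamma>) ?c {Sink})"
      by (rule LIMSEQ_le[OF exp_payoff_LIMSEQ LIMSEQ_Suc[OF hit_LIMSEQ]]) (auto intro: exp_payoff_le_hit_Sink simp del: hit.simps)
  qed
qed

section \<open>Expected payoffs as sums over terminal states\<close>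

lemma exp_payoff_point:
  "exp_payoff \<Gamma> (\<lambda>\<sigma>. if \<sigma> = \<rho>' then 1 else 0) 0 n c = ennreal (pmf (run \<Gamma> n c) (Conf None \<rho>'))"
proof -
  have "payoff (\<lambda>\<sigma>. if \<sigma> = \<rho>' then 1 else 0) 0 = (indicator {Conf None \<rho>'} :: ('a, 'b) conf \<Rightarrow> ennreal)"
  proof
    show "payoff (\<lambda>\<sigma>. if \<sigma> = \<rho>' then 1 else 0) 0 c' = indicator {Conf None \<rho>'} c'" for c' :: "('a, 'b) conf"
      by (cases c' rule: conf_cases) auto
  qed
  then show ?thesis
    unfolding exp_payoff_def by (simp add: emeasure_pmf_single)
qed

lemma exp_payoff_states:
  "exp_payoff \<Gamma> (\<lambda>\<sigma>. if \<sigma> \<in> A then h \<sigma> else 0) 0 n c =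
    (\<integral>\<^sup>+\<sigma>. exp_payoff \<Gamma> (\<lambda>\<tau>. if \<tau> = \<sigma> then 1 else 0) 0 n c * h \<sigma> \<partial>count_space A)"
proof -
  let ?h = "\<lambda>\<sigma>. if \<sigma> \<in> A then h \<sigma> else 0" and ?p = "pmf (run \<Gamma> n c)"
  have "exp_payoff \<Gamma> ?h 0 n c = (\<integral>\<^sup>+c'. ennreal (?p c') * payoff ?h 0 c' \<partial>count_space UNIV)"
    unfolding exp_payoff_def by (rule nn_integral_measure_pmf)
  also have "\<dots> = (\<integral>\<^sup>+c'. ennreal (?p c') * payoff ?h 0 c' \<partial>count_space (Conf None ` A))"
  proof (rule nn_integral_count_space_eq)
    fix c' :: "('a, 'b) conf" assume "c' \<in> UNIV - Conf None ` A"
    then show "ennreal (?p c') * payoff ?h 0 c' = 0"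
      by (cases c' rule: conf_cases) auto
  qed simp
  also have "\<dots> = (\<integral>\<^sup>+\<sigma>. ennreal (?p (Conf None \<sigma>)) * payoff ?h 0 (Conf None \<sigma> :: ('a, 'b) conf) \<partial>count_space A)"
    by (rule nn_integral_bij_count_space[symmetric]) (auto simp: bij_betw_def inj_on_def)
  also have "\<dots> = (\<integral>\<^sup>+\<sigma>. exp_payoff \<Gamma> (\<lambda>\<tau>. if \<tau> = \<sigma> then 1 else 0) 0 n c * h \<sigma> \<partial>count_space A)"
    by (intro nn_integral_cong) (simp add: exp_payoff_point)
  finally show ?thesis .
qed

text \<open>\<open>ER\<close> ranges over all density operators, in general uncountably many, hence
  the counting measure on \<open>A\<close>. For a fixed number of steps the distribution is
  discrete, and monotone convergence passes to the limit.\<close>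

lemma total_payoff_states:
  "total_payoff \<Gamma> (\<lambda>\<sigma>. if \<sigma> \<in> A then h \<sigma> else 0) 0 c =
    (\<integral>\<^sup>+\<sigma>. total_payoff \<Gamma> (\<lambda>\<tau>. if \<tau> = \<sigma> then 1 else 0) 0 c * h \<sigma> \<partial>count_space A)"
proof -
  have "(\<integral>\<^sup>+\<sigma>. total_payoff \<Gamma> (\<lambda>\<tau>. if \<tau> = \<sigma> then 1 else 0) 0 c * h \<sigma> \<partial>count_space A) =
      (\<integral>\<^sup>+\<sigma>. (SUP n. exp_payoff \<Gamma> (\<lambda>\<tau>. if \<tau> = \<sigma> then 1 else 0) 0 n c * h \<sigma>) \<partial>count_space A)"
    by (simp add: total_payoff_def SUP_mult_right_ennreal)
  also have "\<dots> = (SUP n. \<integral>\<^sup>+\<sigma>. exp_payoff \<Gamma> (\<lambda>\<tau>. if \<tau> = \<sigma> then 1 else 0) 0 n c * h \<sigma> \<partial>count_space A)"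
    by (rule nn_integral_monotone_convergence_SUP)
      (auto intro!: incseq_SucI le_funI mult_right_mono exp_payoff_Suc)
  finally show ?thesis
    by (simp add: exp_payoff_states[symmetric] total_payoff_def)
qed

text \<open>A finite integral for the counting measure gives absolute summability, so
  \<open>infsum\<close> is the genuine sum and not its default value 0.\<close>

lemma infsum_nn_integral:
  assumes "(\<integral>\<^sup>+i. ennreal (f i) \<partial>count_space A) = ennreal x" "0 \<le> x" "\<And>i. i \<in> A \<Longrightarrow> 0 \<le> f i"
  shows "infsum f A = (x :: real)"
proof -
  have "integrable (count_space A) f"
    using assms by (intro integrableI_nonneg) (auto simp: AE_count_space)
  then have abs: "Infinite_Set_Sum.abs_summable_on f A"
    by (simp add: Infinite_Set_Sum.abs_summable_on_def)
  then have "ennreal (infsetsum f A) = ennreal x"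
    using assms nn_integral_conv_infsetsum[OF abs] by simp
  then show ?thesis
    using assms infsetsum_nonneg[of A f] by (simp add: infsetsum_infsum[OF abs, symmetric])
qed

lemma ps_functional_tr: "ps_functional B 1 tr"
  by (auto simp: ps_functional_def ps_linear_def ps_iff tr_add[of _ B] tr_scaleR[of _ B] intro: tr_nonneg)

section \<open>Both sides of the theorem in terms of the denotation\<close>

context
  fixes \<Gamma> :: "'v qctx" and S :: "('v, 'm) prog" and \<rho> :: "('v \<Rightarrow> int) op"
  assumes wf: "wf_prog \<Gamma> S" and \<rho>: "\<rho> \<in> states (basis \<Gamma>)"
begin

lemma sem_nonneg: "0 \<le> tr (sem_state \<Gamma> S (\<rho>, 0))" "0 \<le> sem_err \<Gamma> S (\<rho>, 0)"
  using qopD[OF conjunct1[OF sem_qop[OF wf]] states_ps[OF \<rho>]] tr_nonneg by auto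

lemma ER_eq:
  assumes P: "P \<in> predicates (basis \<Gamma>)"
  shows "ER \<Gamma> S \<rho> P = tr (P o\<^sub>L sem_state \<Gamma> S (\<rho>, 0))"
proof -
  let ?A = "states (basis \<Gamma>)" and ?c = "Conf (Some S) \<rho>"
  have nonneg: "0 \<le> tr (P o\<^sub>L \<sigma>)" if "\<sigma> \<in> ?A" for \<sigma>
    using ps_functional_predicate[OF P] states_ps[OF that] by (simp add: ps_functional_def)
  have "(\<integral>\<^sup>+\<sigma>. ennreal (Pr_reach \<Gamma> S \<rho> (Conf None \<sigma>) * tr (P o\<^sub>L \<sigma>)) \<partial>count_space ?A) =
      (\<integral>\<^sup>+\<sigma>. total_payoff \<Gamma> (\<lambda>\<tau>. if \<tau> = \<sigma> then 1 else 0) 0 ?c * ennreal (tr (P o\<^sub>L \<sigma>)) \<partial>count_space ?A)"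
    unfolding Pr_reach_total_payoff[symmetric]
    by (intro nn_integral_cong ennreal_mult) (auto simp: Pr_reach_def reach_prob_nonneg nonneg)
  \<comment> \<open>\<open>ER\<close> counts terminal states only, so the payoff may be set to 0
    elsewhere; \<open>total_payoff_sem\<close> prescribes it on states alone.\<close>
  also have "\<dots> = total_payoff \<Gamma> (\<lambda>\<sigma>. if \<sigma> \<in> ?A then ennreal (tr (P o\<^sub>L \<sigma>)) else 0) (ennreal 0) ?c"
    by (simp add: total_payoff_states)
  also have "\<dots> = ennreal (reward (\<lambda>\<rho>. tr (P o\<^sub>L \<rho>)) 0 (sem \<Gamma> S (\<rho>, 0)))"
    by (rule total_payoff_sem[OF wf ps_functional_predicate[OF P]]) (auto simp: \<rho>)
  finally show ?thesis
    unfolding ER_def using ps_functional_predicate[OF P] qopD(4)[OF conjunct1[OF sem_qop[OF wf]] states_ps[OF \<rho>]]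
    by (intro infsum_nn_integral) (auto simp: reward_def ps_functional_def Pr_reach_def reach_prob_nonneg nonneg)
qed

lemma Pr_reach_Viol: "Pr_reach \<Gamma> S \<rho> Viol = sem_err \<Gamma> S (\<rho>, 0)"
proof -
  have "ps_functional (basis \<Gamma>) 0 (\<lambda>_. 0)"
    by (simp add: ps_functional_def ps_linear_def)
  from total_payoff_sem[OF wf this, of "\<lambda>_. 0" 1 \<rho>] \<rho>
  have "ennreal (Pr_reach \<Gamma> S \<rho> Viol) = ennreal (sem_err \<Gamma> S (\<rho>, 0))"
    by (simp add: Pr_reach_total_payoff reward_def)
  then show ?thesis
    using sem_nonneg by (simp add: Pr_reach_def reach_prob_nonneg)
qed

lemma Pr_reach_Sink: "Pr_reach \<Gamma> S \<rho> Sink = tr (sem_state \<Gamma> S (\<rho>, 0)) + sem_err \<Gamma> S (\<rho>, 0)"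
proof -
  from total_payoff_sem[OF wf ps_functional_tr, of "\<lambda>_. 1" 1 \<rho>] \<rho>
  have "ennreal (Pr_reach \<Gamma> S \<rho> Sink) = ennreal (tr (sem_state \<Gamma> S (\<rho>, 0)) + sem_err \<Gamma> S (\<rho>, 0))"
    by (simp add: Pr_reach_total_payoff reward_def states_tr)
  then show ?thesis
    using sem_nonneg by (simp add: Pr_reach_def reach_prob_nonneg del: ennreal_plus)
qed

lemma tr_qwp:
  assumes P: "P \<in> predicates (basis \<Gamma>)"
  shows "tr (qwp \<Gamma> S P o\<^sub>L \<rho>) = tr (P o\<^sub>L sem_state \<Gamma> S (\<rho>, 0))"
proof -
  have "ps_functional (basis \<Gamma>) 1 (\<lambda>\<rho>. tr (P o\<^sub>L sem_state \<Gamma> S (\<rho>, 0)))"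
    using reward_functional[OF ps_functional_predicate[OF P] conjunct1[OF sem_qop[OF wf]], of 0]
    by (simp add: reward_def)
  then show ?thesis
    unfolding qwp_def by (rule tr_greatest_predicate[OF _ states_ps[OF \<rho>]])
qed

lemma tr_qwlp:
  assumes P: "P \<in> predicates (basis \<Gamma>)"
  shows "tr (qwlp \<Gamma> S P o\<^sub>L \<rho>) =
    tr (P o\<^sub>L sem_state \<Gamma> S (\<rho>, 0)) + 1 - tr (sem_state \<Gamma> S (\<rho>, 0)) - sem_err \<Gamma> S (\<rho>, 0)"
proof -
  let ?B = "basis \<Gamma>" and ?D = "\<lambda>\<rho>. sem \<Gamma> S (\<rho>, 0)"
  let ?f = "\<lambda>\<rho>. tr (P o\<^sub>L fst (?D \<rho>)) + tr \<rho> - tr (fst (?D \<rho>)) - snd (?D \<rho>)"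
  note q = conjunct1[OF sem_qop[OF wf]] and g = ps_functional_predicate[OF P]
  have lin: "ps_linear ?B (\<lambda>\<rho>. tr (P o\<^sub>L fst (?D \<rho>)))" "ps_linear ?B tr" "ps_linear ?B (\<lambda>\<rho>. tr (fst (?D \<rho>)) + snd (?D \<rho>))"
    using reward_functional[OF g q, of 0] ps_functional_tr[of ?B] reward_functional[OF ps_functional_tr q, of 1]
    by (simp_all add: reward_def ps_functional_def)
  have "ps_linear ?B (\<lambda>\<rho>. tr (P o\<^sub>L fst (?D \<rho>)) + tr \<rho> - (tr (fst (?D \<rho>)) + snd (?D \<rho>)))"
    using lin unfolding ps_linear_def by (simp add: right_diff_distrib distrib_left)
  then have "ps_linear ?B ?f"
    by (simp only: diff_diff_eq)
  \<comment> \<open>The lower bound holds since terminated and violating mass stay below the trace,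
    the upper one since tr (P \<rho>') \<le> tr \<rho>' for the output \<rho>' and errors are
    nonnegative.\<close>
  moreover have "0 \<le> ?f \<rho> \<and> ?f \<rho> \<le> 1 * tr \<rho>" if "\<rho> \<in> partial_states ?B" for \<rho>
  proof -
    note d = qopD[OF q that]
    have "0 \<le> tr (P o\<^sub>L fst (?D \<rho>))" "tr (P o\<^sub>L fst (?D \<rho>)) \<le> tr (fst (?D \<rho>))"
      using g d(4) by (auto simp: ps_functional_def)
    with d show ?thesis
      by simp
  qed
  ultimately have "ps_functional ?B 1 ?f"
    by (simp only: ps_functional_def) blast
  from tr_greatest_predicate[OF this states_ps[OF \<rho>]] show ?thesis
    unfolding qwlp_def states_tr[OF \<rho>] .
qed

end

theorem theorem4p20:
  fixes \<Gamma> :: "'v qctx" and S :: "('v, 'm) prog" and \<rho> P :: "('v \<Rightarrow> int) op"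
  assumes "finite (dom \<Gamma>)" and "wf_prog \<Gamma> S"
    and "\<rho> \<in> states (basis \<Gamma>)" and "P \<in> predicates (basis \<Gamma>)"
  shows "CER \<Gamma> S \<rho> P = tr_hat (pair_app (qcwp \<Gamma> S (P, idop (basis \<Gamma>))) \<rho>)
    \<and> CLER \<Gamma> S \<rho> P = tr_hat (pair_app (qcwlp \<Gamma> S (P, idop (basis \<Gamma>))) \<rho>)"
proof -
  note wf = assms(2) and \<rho> = assms(3) and P = assms(4)
  have "op_on (basis \<Gamma>) (sem_state \<Gamma> S (\<rho>, 0))"
    by (rule ptc_op_on[OF qopD(1)[OF conjunct1[OF sem_qop[OF wf]] states_ps[OF \<rho>]]])
  \<comment> \<open>For the predicate I the traces of the final state cancel, leaving the
    probability of no violation, which is the common denominator.\<close>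
  then have "tr (qwlp \<Gamma> S (idop (basis \<Gamma>)) o\<^sub>L \<rho>) = 1 - sem_err \<Gamma> S (\<rho>, 0)"
    using tr_qwlp[OF wf \<rho> idop_predicate] by (simp add: idop_compose)
  then show ?thesis
    by (simp add: CER_def CLER_def LER_def Pr_not_reach_def tr_hat_def pair_app_def qcwp_def qcwlp_def
        ER_eq[OF wf \<rho> P] tr_qwp[OF wf \<rho> P] tr_qwlp[OF wf \<rho> P] Pr_reach_Viol[OF wf \<rho>] Pr_reach_Sink[OF wf \<rho>]
        add_diff_eq diff_diff_eq)
qed

end
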